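(* Let $(G,\chi)$ be an augmented group such that $\mathcal{M}$ either is a direct sum of cyclic modules, $\mathcal{M}\cong\mathcal{R}_1/(\pi_1)\oplus\cdots\oplus\mathcal{R}_1/(\pi_n)$ with $\pi_i\in\mathcal{R}_1$, or is torsion-free as an abelian group. Then the sequence of torsion numbers $b_r$ of $(G,\chi)$ satisfies a linear homogeneous recurrence relation with constant coefficients; that is, there exist an integer $m\ge1$ and constants $c_1,\dots,c_m\in\mathbb{C}$ such that $b_{r+m}=c_1b_{r+m-1}+\cdots+c_mb_r$ for all $r\ge1$.
   Context: An augmented group is a pair $(G,\chi)$ where $G$ is a finitely generated group and $\chi:G\to\mathbb{Z}$ is an epimorphism. Let $\mathcal{R}_1=\mathbb{Z}[t,t^{-1}]$. The abelianization $\mathcal{M}$ of $\ker\chi$ is a finitely generated $\mathcal{R}_1$-module, with $t$ acting by conjugation by an element $x\in G$ with $\chi(x)=1$. For a positive integer $r$, the $r$th torsion number $b_r$ is the order of the torsion subgroup of the finitely generated abelian group $\mathcal{M}/(t^r-1)\mathcal{M}$. *)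

theory Defs
  imports Complex_Main "HOL-Algebra.Algebra" "HOL-Library.Poly_Mapping"
begin

definition finitely_generated_group :: "('a, 'b) monoid_scheme \<Rightarrow> bool" where
  "finitely_generated_group G \<longleftrightarrow>
     group G \<and> (\<exists>S. finite S \<and> S \<subseteq> carrier G \<and> generate G S = carrier G)"

definition augmented_group :: "('a, 'b) monoid_scheme \<Rightarrow> ('a \<Rightarrow> int) \<Rightarrow> bool" where
  "augmented_group G \<chi> \<longleftrightarrow> finitely_generated_group G \<and> \<chi> \<in> epi G integer_group"

text \<open>
  Integral Laurent polynomials are finitely supported functions from integer exponents to
  integer coefficients; the multiplication of \<^typ>\<open>int \<Rightarrow>\<^sub>0 int\<close> is convolution.
\<close>

type_synonym laurent = "int \<Rightarrow>\<^sub>0 int"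

definition laurent_t :: laurent where
  "laurent_t = Poly_Mapping.single 1 1"

definition laurent_ring :: "laurent ring" where
  "laurent_ring = \<lparr>carrier = UNIV, monoid.mult = (*), one = 1, ring.zero = 0, add = (+)\<rparr>"

text \<open>
  The fields \<^const>\<open>monoid.mult\<close> and \<^const>\<open>monoid.one\<close> of a \<^typ>\<open>('r, 'm) module\<close> record play no
  role in the notion of a module and are left undefined below.
\<close>

definition cyclic_module :: "('r, 'k) ring_scheme \<Rightarrow> 'r \<Rightarrow> ('r, 'r set) module" where
  "cyclic_module R p = (let Q = R Quot (PIdl\<^bsub>R\<^esub> p) in
     \<lparr>carrier = carrier Q, monoid.mult = undefined, one = undefined,
      ring.zero = ring.zero Q, add = add Q,
      smult = (\<lambda>a Y. ((PIdl\<^bsub>R\<^esub> p) +>\<^bsub>R\<^esub> a) \<otimes>\<^bsub>Q\<^esub> Y)\<rparr>)"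

text \<open>The full product; it is the direct sum because it is only used for finite \<open>I\<close>.\<close>

definition module_sum :: "'i set \<Rightarrow> ('i \<Rightarrow> ('r, 'm) module) \<Rightarrow> ('r, 'i \<Rightarrow> 'm) module" where
  "module_sum I M =
     \<lparr>carrier = (\<Pi>\<^sub>E i\<in>I. carrier (M i)), monoid.mult = undefined, one = undefined,
      ring.zero = (\<lambda>i\<in>I. \<zero>\<^bsub>M i\<^esub>), add = (\<lambda>f g. \<lambda>i\<in>I. f i \<oplus>\<^bsub>M i\<^esub> g i),
      smult = (\<lambda>a f. \<lambda>i\<in>I. a \<odot>\<^bsub>M i\<^esub> f i)\<rparr>"

definition module_iso ::
    "('r, 'k) ring_scheme \<Rightarrow> ('r, 'm) module \<Rightarrow> ('r, 'n) module \<Rightarrow> ('m \<Rightarrow> 'n) set" where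
  "module_iso R M N =
     {h \<in> iso (add_monoid M) (add_monoid N).
        \<forall>a\<in>carrier R. \<forall>v\<in>carrier M. h (a \<odot>\<^bsub>M\<^esub> v) = a \<odot>\<^bsub>N\<^esub> h v}"

definition direct_sum_of_cyclics :: "(laurent, 'm) module \<Rightarrow> bool" where
  "direct_sum_of_cyclics M \<longleftrightarrow>
     (\<exists>(n::nat) \<pi>. module_iso laurent_ring M
        (module_sum {1..n} (\<lambda>i. cyclic_module laurent_ring (\<pi> i))) \<noteq> {})"

definition torsion_subgroup :: "('a, 'b) monoid_scheme \<Rightarrow> 'a set" where
  "torsion_subgroup A = {a \<in> carrier A. \<exists>n::nat. n > 0 \<and> a [^]\<^bsub>A\<^esub> n = \<one>\<^bsub>A\<^esub>}"

definition additively_torsion_free :: "('r, 'm) module \<Rightarrow> bool" where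
  "additively_torsion_free M \<longleftrightarrow> torsion_subgroup (add_monoid M) = {\<zero>\<^bsub>M\<^esub>}"

text \<open>
  The abelianization of \<open>ker \<chi>\<close>, written additively. Its elements are the cosets of the
  commutator subgroup of \<open>ker \<chi>\<close>; \<open>t\<close> sends the class of \<open>k\<close> to the class of \<open>x k x\<^sup>-\<^sup>1\<close>,
  so the Laurent polynomial with coefficients \<open>c\<^sub>i\<close> acts by
  \<open>Y \<mapsto> \<Prod>i. (x\<^sup>i Y x\<^sup>-\<^sup>i)\<close> with the \<open>i\<close>-th factor raised to the power \<open>c\<^sub>i\<close>.
\<close>

definition kernel_abelianization ::
    "('a, 'b) monoid_scheme \<Rightarrow> ('a \<Rightarrow> int) \<Rightarrow> 'a \<Rightarrow> (laurent, 'a set) module" where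
  "kernel_abelianization G \<chi> x =
     (let K = G\<lparr>carrier := kernel G integer_group \<chi>\<rparr>;
          A = K Mod (derived K (carrier K))
      in \<lparr>carrier = carrier A, monoid.mult = undefined, one = undefined,
          ring.zero = \<one>\<^bsub>A\<^esub>, add = (\<otimes>\<^bsub>A\<^esub>),
          smult = (\<lambda>p Y. finprod A
            (\<lambda>i. ((x [^]\<^bsub>G\<^esub> i) <#\<^bsub>G\<^esub> Y #>\<^bsub>G\<^esub> inv\<^bsub>G\<^esub> (x [^]\<^bsub>G\<^esub> i))
                   [^]\<^bsub>A\<^esub> Poly_Mapping.lookup p i)
            (Poly_Mapping.keys p))\<rparr>)"

definition torsion_number ::
    "('a, 'b) monoid_scheme \<Rightarrow> ('a \<Rightarrow> int) \<Rightarrow> 'a \<Rightarrow> nat \<Rightarrow> nat" where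
  "torsion_number G \<chi> x r =
     (let M = kernel_abelianization G \<chi> x
      in card (torsion_subgroup
           (add_monoid M Mod ((\<lambda>v. (laurent_t ^ r - 1) \<odot>\<^bsub>M\<^esub> v) ` carrier M))))"

end

theory Submission
  imports Defs "HOL-Computational_Algebra.Fundamental_Theorem_Algebra" "HOL-Computational_Algebra.Polynomial_Factorial"
    "HOL-Library.Set_Algebras" "HOL-Library.FuncSet" "HOL-Library.Function_Algebras" "Jordan_Normal_Form.Determinant"
begin

text \<open>
  Present the module by a map \<open>\<theta>\<close> from a space \<open>W\<close> of vectors of integer polynomials, with kernel \<open>N\<close>.  Then
  \<open>b_r\<close> is the index of \<open>N + (t^r - 1) W\<close> in its \<open>\<int>\<close>-saturation.  For a cyclic module with relation \<open>\<pi>\<close>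
  write \<open>\<pi> = d f\<close> and \<open>t^r - 1 = d q\<close> with \<open>d = gcd \<pi> (t^r - 1)\<close>: the saturation is generated by \<open>d\<close>, so the
  index is that of the ideal \<open>(f, q)\<close>, a resultant.  As \<open>d\<close> depends only on \<open>r\<close> modulo the orders of the
  roots of unity among the roots of \<open>\<pi>\<close>, on each residue class the index is, up to a periodic sign, a product of
  factors \<open>\<alpha>^r - 1\<close> and \<open>r \<alpha>^r\<close> with constant coefficients.  Such sequences, and sequences glued from finitely many of
  them along residue classes, satisfy linear recurrences.
\<close>

text \<open>Linear recurrences are not preserved by absolute values, so the sign of each resultant
  has to be shown periodic before the absolute value can be removed; for this the residue classes
  also fix the parity of \<open>r\<close>. Over \<open>int poly\<close>, which is not a principal
  ideal domain, a module with torsion-free additive group need not split into cyclic ones. It is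
  therefore filtered with cyclic factors, and each factor may differ by a finite module from one
  with a principal relation ideal: on a finite module, multiplication has kernel and cokernel of
  equal order. The cofactor of \<open>d\<close> is coprime to an annihilator of the torsion
  submodule, which makes multiplication by it injective and lets indices multiply along the
  filtration. The quotient by the torsion submodule contributes one more factor, and this factor is
  periodic in \<open>r\<close>. Ordinary polynomials can replace Laurent polynomials because
  \<open>t\<close> is invertible modulo \<open>t ^ r - 1\<close>.\<close>

section \<open>Sequences annihilated by polynomials in the shift operator\<close>

definition shift_minus :: "complex \<Rightarrow> (nat \<Rightarrow> complex) \<Rightarrow> nat \<Rightarrow> complex" where
  "shift_minus \<alpha> a = (\<lambda>r. a (Suc r) - \<alpha> * a r)"

abbreviation shifts_minus :: "complex list \<Rightarrow> (nat \<Rightarrow> complex) \<Rightarrow> nat \<Rightarrow> complex" where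
  "shifts_minus \<equiv> fold shift_minus"

text \<open>Over the complex numbers every nonzero polynomial in the shift operator splits, so a
  list of roots encodes an arbitrary recurrence, and closure properties become inductions on lists.
  The root 0 is allowed; index 0 is exempt because the recurrence is claimed only from
  \<open>r = 1\<close> on.\<close>

definition lin_rec :: "(nat \<Rightarrow> complex) \<Rightarrow> bool" where
  "lin_rec a \<longleftrightarrow> (\<exists>\<alpha>s. \<forall>r\<ge>1. shifts_minus \<alpha>s a r = 0)"

lemma shifts_minus_add: "shifts_minus \<alpha>s (\<lambda>r. a r + b r) = (\<lambda>r. shifts_minus \<alpha>s a r + shifts_minus \<alpha>s b r)"
proof (induction \<alpha>s arbitrary: a b)
  case (Cons \<alpha> \<alpha>s)
  have "shift_minus \<alpha> (\<lambda>r. a r + b r) = (\<lambda>r. shift_minus \<alpha> a r + shift_minus \<alpha> b r)"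
    by (auto simp: shift_minus_def algebra_simps)
  then show ?case using Cons by simp
qed auto

lemma shifts_minus_cmult: "shifts_minus \<alpha>s (\<lambda>r. c * a r) = (\<lambda>r. c * shifts_minus \<alpha>s a r)"
proof (induction \<alpha>s arbitrary: a)
  case (Cons \<alpha> \<alpha>s)
  have "shift_minus \<alpha> (\<lambda>r. c * a r) = (\<lambda>r. c * shift_minus \<alpha> a r)"
    by (auto simp: shift_minus_def algebra_simps)
  then show ?case using Cons by simp
qed auto

lemma shift_minus_commute: "shift_minus \<alpha> (shift_minus \<beta> a) = shift_minus \<beta> (shift_minus \<alpha> a)"
  by (auto simp: shift_minus_def algebra_simps)

lemma shifts_minus_shift_minus: "shifts_minus \<alpha>s (shift_minus \<beta> a) = shift_minus \<beta> (shifts_minus \<alpha>s a)"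
proof (induction \<alpha>s arbitrary: a)
  case (Cons \<alpha> \<alpha>s)
  show ?case using Cons[of "shift_minus \<alpha> a"] by (simp add: shift_minus_commute[of \<alpha> \<beta>])
qed auto

text \<open>The operators look only at later terms, so index 0 never influences the values from
  index 1 on.\<close>

lemma shifts_minus_cong:
  assumes "\<And>r. r \<ge> 1 \<Longrightarrow> a r = b r" "r \<ge> 1"
  shows "shifts_minus \<alpha>s a r = shifts_minus \<alpha>s b r"
  using assms
proof (induction \<alpha>s arbitrary: a b)
  case (Cons \<alpha> \<alpha>s)
  have "shift_minus \<alpha> a r = shift_minus \<alpha> b r" if "r \<ge> 1" for r
    using Cons.prems(1) that by (simp add: shift_minus_def)
  from Cons.IH[OF this Cons.prems(2)] show ?case by simp
qed auto

lemma shifts_minus_zero: "shifts_minus \<alpha>s (\<lambda>_. 0) = (\<lambda>_. 0)"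
  by (induction \<alpha>s) (auto simp: shift_minus_def)

lemma lin_rec_cong: "(\<And>r. r \<ge> 1 \<Longrightarrow> a r = b r) \<Longrightarrow> lin_rec a \<Longrightarrow> lin_rec b"
  unfolding lin_rec_def using shifts_minus_cong[of b a] by auto

text \<open>The concatenated list annihilates both summands: its factors commute, so the part that
  kills a given summand may be applied first.\<close>

lemma lin_rec_add:
  assumes "lin_rec a" "lin_rec b" shows "lin_rec (\<lambda>r. a r + b r)"
proof -
  obtain \<alpha>s \<beta>s where 1: "\<And>r. r\<ge>1 \<Longrightarrow> shifts_minus \<alpha>s a r = 0" "\<And>r. r\<ge>1 \<Longrightarrow> shifts_minus \<beta>s b r = 0"
    using assms unfolding lin_rec_def by blast
  have a: "shifts_minus (\<alpha>s @ \<beta>s) a r = 0" if "r \<ge> 1" for r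
    using shifts_minus_cong[of "shifts_minus \<alpha>s a" "\<lambda>_. 0" r \<beta>s] 1 that by (simp add: shifts_minus_zero)
  \<comment> \<open>\<open>fold\<close> lets \<open>\<alpha>s\<close> act first; commuting the
    factors moves \<open>\<beta>s\<close>, the part that kills \<open>b\<close>, next to
    \<open>b\<close>.\<close>
  have "shifts_minus (\<alpha>s @ \<beta>s) b = shifts_minus \<alpha>s (shifts_minus \<beta>s b)"
  proof (induction \<beta>s arbitrary: b)
    case (Cons \<beta> \<beta>s) then show ?case
      by (simp add: shifts_minus_shift_minus)
  qed auto
  then have b: "shifts_minus (\<alpha>s @ \<beta>s) b r = 0" if "r \<ge> 1" for r
    using shifts_minus_cong[of "shifts_minus \<beta>s b" "\<lambda>_. 0" r \<alpha>s] 1 that by (simp add: shifts_minus_zero)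
  show ?thesis unfolding lin_rec_def
    by (intro exI[of _ "\<alpha>s @ \<beta>s"]) (simp add: shifts_minus_add a b del: fold_append)
qed

lemma lin_rec_cmult: "lin_rec a \<Longrightarrow> lin_rec (\<lambda>r. c * a r)"
  unfolding lin_rec_def by (auto simp: shifts_minus_cmult)

lemma lin_rec_shift_minusD: "lin_rec (shift_minus \<alpha> a) \<Longrightarrow> lin_rec a"
  unfolding lin_rec_def by (metis fold_simps(2))

lemma lin_rec_zero: "lin_rec (\<lambda>_. 0)"
  unfolding lin_rec_def by (rule exI[of _ "[]"]) simp

text \<open>
  The Leibniz rule \<open>(E - \<alpha>\<beta>)(ab) = ((E - \<alpha>)a) \<cdot> Eb + \<alpha>a \<cdot> (E - \<beta>)b\<close> for the shift operator \<open>E\<close>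
  lowers the total number of factors annihilating \<open>a\<close> and \<open>b\<close>.
\<close>

lemma lin_rec_mult:
  assumes "lin_rec a" "lin_rec b" shows "lin_rec (\<lambda>r. a r * b r)"
proof -
  obtain \<alpha>s \<beta>s where "\<forall>r\<ge>1. shifts_minus \<alpha>s a r = 0" "\<forall>r\<ge>1. shifts_minus \<beta>s b r = 0"
    using assms unfolding lin_rec_def by blast
  then show ?thesis
  proof (induction "length \<alpha>s + length \<beta>s" arbitrary: \<alpha>s \<beta>s a b rule: less_induct)
    case less
    show ?case
    proof (cases "\<alpha>s = [] \<or> \<beta>s = []")
      case True
      then have "a r * b r = 0" if "r \<ge> 1" for r using less.prems that by auto
      then show ?thesis using lin_rec_cong[OF _ lin_rec_zero, of "\<lambda>r. a r * b r"] by auto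
    next
      case False
      then obtain \<alpha> \<alpha>' \<beta> \<beta>' where ab: "\<alpha>s = \<alpha> # \<alpha>'" "\<beta>s = \<beta> # \<beta>'" by (meson neq_Nil_conv)
      let ?a = "shift_minus \<alpha> a" and ?b = "shift_minus \<beta> b"
      have a: "\<forall>r\<ge>1. shifts_minus \<alpha>' ?a r = 0" and b: "\<forall>r\<ge>1. shifts_minus \<beta>' ?b r = 0"
        using less.prems ab by auto
      have "lin_rec (\<lambda>r. ?a r * b r)" "lin_rec (\<lambda>r. ?a r * ?b r)" "lin_rec (\<lambda>r. a r * ?b r)"
        using less.hyps[OF _ a less.prems(2)] less.hyps[OF _ a b] less.hyps[OF _ less.prems(1) b] ab by auto
      \<comment> \<open>In the Leibniz rule the shift of \<open>b\<close> is expanded as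
        \<open>?b + \<beta> * b\<close>, so that all three products fall under the induction
        hypothesis.\<close>
      then have "lin_rec (\<lambda>r. \<beta> * (?a r * b r) + (?a r * ?b r + \<alpha> * (a r * ?b r)))"
        by (intro lin_rec_add lin_rec_cmult)
      moreover have "shift_minus (\<alpha> * \<beta>) (\<lambda>r. a r * b r) = (\<lambda>r. \<beta> * (?a r * b r) + (?a r * ?b r + \<alpha> * (a r * ?b r)))"
        by (auto simp: shift_minus_def algebra_simps)
      ultimately show ?thesis using lin_rec_shift_minusD by metis
    qed
  qed
qed

lemma lin_rec_power: "lin_rec (\<lambda>r. \<alpha> ^ r)"
  unfolding lin_rec_def by (rule exI[of _ "[\<alpha>]"]) (simp add: shift_minus_def)

lemma lin_rec_const: "lin_rec (\<lambda>r. c)"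
  unfolding lin_rec_def by (rule exI[of _ "[1]"]) (simp add: shift_minus_def)

lemma lin_rec_of_nat: "lin_rec (\<lambda>r. of_nat r)"
  unfolding lin_rec_def by (rule exI[of _ "[1,1]"]) (simp add: shift_minus_def)

lemma lin_rec_sum: "(\<And>i. i \<in> I \<Longrightarrow> lin_rec (a i)) \<Longrightarrow> lin_rec (\<lambda>r. \<Sum>i\<in>I. a i r)"
  by (induction I rule: infinite_finite_induct) (auto simp: lin_rec_zero intro: lin_rec_add)

lemma lin_rec_prod: "(\<And>i. i \<in> I \<Longrightarrow> lin_rec (a i)) \<Longrightarrow> lin_rec (\<lambda>r. \<Prod>i\<in>I. a i r)"
  by (induction I rule: infinite_finite_induct) (auto simp: lin_rec_const intro: lin_rec_mult)

lemma lin_rec_prod_list: "(\<And>x. x \<in> set xs \<Longrightarrow> lin_rec (a x)) \<Longrightarrow> lin_rec (\<lambda>r. \<Prod>x\<leftarrow>xs. a x r)"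
  by (induction xs) (auto simp: lin_rec_const intro: lin_rec_mult)

text \<open>A polynomial acts on sequences with its variable acting as the shift.\<close>

definition shift_poly :: "complex poly \<Rightarrow> (nat \<Rightarrow> complex) \<Rightarrow> nat \<Rightarrow> complex" where
  "shift_poly p a = (\<lambda>r. \<Sum>i\<le>degree p. coeff p i * a (r + i))"

lemma shift_poly_bound:
  assumes "degree p \<le> n" shows "shift_poly p a r = (\<Sum>i\<le>n. coeff p i * a (r + i))"
  unfolding shift_poly_def using assms
  by (intro sum.mono_neutral_left) (auto simp: coeff_eq_0)

lemma shift_poly_linear_mult:
  "shift_poly (p * [:-\<alpha>, 1:]) a = shift_poly p (shift_minus \<alpha> a)"
proof
  fix r
  define n where "n = degree p"
  have "degree (p * [:-\<alpha>, 1:]) \<le> Suc n"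
    unfolding n_def by (rule order.trans[OF degree_mult_le]) simp
  then have "shift_poly (p * [:-\<alpha>, 1:]) a r = (\<Sum>i\<le>Suc n. coeff (p * [:-\<alpha>, 1:]) i * a (r + i))"
    by (rule shift_poly_bound)
  also have "p * [:-\<alpha>, 1:] = pCons 0 p + smult (-\<alpha>) p" by (simp add: algebra_simps)
  also have "(\<Sum>i\<le>Suc n. coeff (pCons 0 p + smult (-\<alpha>) p) i * a (r + i)) =
      (\<Sum>i\<le>Suc n. coeff (pCons 0 p) i * a (r + i)) - \<alpha> * (\<Sum>i\<le>Suc n. coeff p i * a (r + i))"
    by (simp add: algebra_simps sum.distrib sum_subtractf sum_distrib_left)
  also have "(\<Sum>i\<le>Suc n. coeff (pCons 0 p) i * a (r + i)) = (\<Sum>i\<le>n. coeff p i * a (r + Suc i))"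
    by (subst sum.atMost_Suc_shift) simp
  also have "(\<Sum>i\<le>Suc n. coeff p i * a (r + i)) = (\<Sum>i\<le>n. coeff p i * a (r + i))"
    by (simp add: n_def coeff_eq_0)
  finally show "shift_poly (p * [:-\<alpha>, 1:]) a r = shift_poly p (shift_minus \<alpha> a) r"
    by (simp add: shift_poly_def n_def shift_minus_def algebra_simps sum_subtractf sum_distrib_left)
qed

lemma shifts_minus_eq_shift_poly: "shifts_minus \<alpha>s a = shift_poly (\<Prod>\<alpha>\<leftarrow>\<alpha>s. [:-\<alpha>, 1:]) a"
proof (induction \<alpha>s arbitrary: a)
  case Nil then show ?case by (auto simp: shift_poly_def)
next
  case (Cons \<alpha> \<alpha>s) then show ?case
    using shift_poly_linear_mult[of "\<Prod>\<alpha>\<leftarrow>\<alpha>s. [:-\<alpha>, 1:]"] by (simp add: mult.commute)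
qed

text \<open>The fundamental theorem of algebra turns \<open>p\<close> into the list of its roots
  with multiplicity, up to the nonzero leading coefficient. Thus any nonzero polynomial annihilator
  will do.\<close>

lemma lin_rec_shift_poly:
  assumes "p \<noteq> 0" "\<And>r. r \<ge> 1 \<Longrightarrow> shift_poly p a r = 0" shows "lin_rec a"
proof -
  have "smult (lead_coeff p) (\<Prod>x\<in>#proots p. [:-x, 1:]) = p" by (rule complex_poly_decompose_multiset)
  moreover obtain \<alpha>s where "mset \<alpha>s = proots p" by (metis ex_mset)
  ultimately have p: "p = smult (lead_coeff p) (\<Prod>x\<leftarrow>\<alpha>s. [:-x, 1:])"
    by (metis mset_map prod_mset_prod_list)
  have "shift_poly (smult c q) a r = c * shift_poly q a r" if "c \<noteq> 0" for c q r
    using that by (simp add: shift_poly_def sum_distrib_left mult.assoc)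
  then have "shift_poly p a r = lead_coeff p * shifts_minus \<alpha>s a r" for r
    using p assms(1) by (metis leading_coeff_0_iff shifts_minus_eq_shift_poly)
  then show ?thesis unfolding lin_rec_def using assms by (metis leading_coeff_0_iff mult_eq_0_iff)
qed

text \<open>The annihilator is \<open>x ^ N - 1\<close>, which is nonzero because \<open>N\<close>
  is positive.\<close>

lemma lin_rec_periodic:
  assumes "N \<ge> 1" "\<And>r. r \<ge> 1 \<Longrightarrow> a (r + N) = a r" shows "lin_rec a"
proof (rule lin_rec_shift_poly)
  let ?p = "monom 1 N - 1 :: complex poly"
  have deg: "degree ?p \<le> N" by (rule degree_diff_le) (auto simp: degree_monom_le)
  have "coeff ?p N = 1" using assms(1) by simp
  then show "?p \<noteq> 0" by (metis coeff_0 one_neq_zero)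
  fix r :: nat assume r: "r \<ge> 1"
  have "shift_poly ?p a r = (\<Sum>i\<le>N. (if i = N then a (r + i) else 0) - (if i = 0 then a (r + i) else 0))"
    unfolding shift_poly_bound[OF deg] using assms(1) by (intro sum.cong) auto
  also have "\<dots> = a (r + N) - a r" by (simp add: sum_subtractf)
  finally show "shift_poly ?p a r = 0" using assms(2)[OF r] by simp
qed

text \<open>The indicator of a residue class is periodic, hence recurrent; multiplying each
  \<open>E\<close> by its indicator and summing over the classes recovers \<open>b\<close>.\<close>

lemma lin_rec_glue:
  assumes "N \<ge> 1" "\<And>c. \<exists>E. lin_rec E \<and> (\<forall>r\<ge>1. r mod N = c \<longrightarrow> b r = E r)"
  shows "lin_rec b"
proof -
  obtain E where E: "\<And>c. lin_rec (E c)" "\<And>c r. r \<ge> 1 \<Longrightarrow> r mod N = c \<Longrightarrow> b r = E c r"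
    using assms(2) by metis
  have ind: "lin_rec (\<lambda>r. if r mod N = c then 1 else 0)" for c
    using assms(1) by (intro lin_rec_periodic[of N]) auto
  define S where "S = (\<lambda>r. \<Sum>c<N. (if r mod N = c then 1 else 0) * E c r)"
  have "lin_rec S" unfolding S_def by (intro lin_rec_sum lin_rec_mult E ind)
  moreover have "S r = b r" if "r \<ge> 1" for r
  proof -
    have "S r = (\<Sum>c<N. if c = r mod N then E c r else 0)"
      unfolding S_def by (intro sum.cong) auto
    then show ?thesis using assms(1) E(2)[OF that] by simp
  qed
  ultimately show ?thesis using lin_rec_cong[of S b] by blast
qed

lemma lin_rec_recurrence:
  assumes "lin_rec b"
  shows "\<exists>m\<ge>1. \<exists>c :: nat \<Rightarrow> complex. \<forall>r\<ge>1. b (r + m) = (\<Sum>i = 1..m. c i * b (r + m - i))"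
proof -
  obtain \<alpha>s0 where "\<forall>r\<ge>1. shifts_minus \<alpha>s0 b r = 0" using assms unfolding lin_rec_def by blast
  \<comment> \<open>A further root 0 only shifts the zero sequence, and it makes the list nonempty,
    so that the order \<open>m\<close> is at least 1.\<close>
  then have "\<forall>r\<ge>1. shifts_minus (\<alpha>s0 @ [0]) b r = 0" by (simp add: shift_minus_def)
  then obtain \<alpha>s where \<alpha>s: "\<forall>r\<ge>1. shifts_minus \<alpha>s b r = 0" "\<alpha>s \<noteq> []"
    using snoc_eq_iff_butlast by blast
  define p where "p = (\<Prod>\<alpha>\<leftarrow>\<alpha>s. [:-\<alpha>, 1:])"
  define m where "m = length \<alpha>s"
  have deg: "degree p = m" and lc: "coeff p m = 1" and "p \<noteq> 0"
  proof -
    have *: "degree p = m \<and> lead_coeff p = 1" unfolding p_def m_def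
    proof (induction \<alpha>s)
      case (Cons \<alpha> \<alpha>s)
      let ?q = "\<Prod>\<alpha>\<leftarrow>\<alpha>s. [:-\<alpha>, 1:]"
      have "?q \<noteq> 0" by auto
      then have "degree ([:-\<alpha>, 1:] * ?q) = Suc (length \<alpha>s)"
        using Cons by (simp add: degree_mult_eq del: mult_pCons_left)
      moreover have "lead_coeff ([:-\<alpha>, 1:] * ?q) = 1"
        unfolding lead_coeff_mult using Cons by (metis lead_coeff_pCons(1) mult_1 one_neq_zero one_pCons coeff_pCons_Suc pCons_eq_0_iff lead_coeff_1)
      ultimately show ?case by simp
    qed auto
    show "degree p = m" using * by blast
    show "coeff p m = 1" using * by metis
    then show "p \<noteq> 0" by (metis coeff_0 one_neq_zero)
  qed
  \<comment> \<open>The annihilator is monic, so its top term can be solved for; the coefficients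
    are the negated lower ones in reverse order.\<close>
  have "b (r + m) = (\<Sum>i = 1..m. - coeff p (m - i) * b (r + m - i))" if "r \<ge> 1" for r
  proof -
    have "0 = (\<Sum>i\<le>m. coeff p i * b (r + i))"
      using \<alpha>s(1) that unfolding shifts_minus_eq_shift_poly p_def[symmetric] by (simp add: shift_poly_def deg)
    also have "\<dots> = b (r + m) + (\<Sum>i<m. coeff p i * b (r + i))"
      by (simp add: lessThan_Suc_atMost[symmetric] lc)
    also have "(\<Sum>i<m. coeff p i * b (r + i)) = (\<Sum>i = 1..m. coeff p (m - i) * b (r + m - i))"
      by (rule sum.reindex_bij_witness[of _ "\<lambda>i. m - i" "\<lambda>i. m - i"]) auto
    finally show ?thesis by (simp add: sum_negf eq_neg_iff_add_eq_0)
  qed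
  then show ?thesis using \<alpha>s(2) by (intro exI[of _ m] conjI exI[of _ "\<lambda>i. - coeff p (m - i)"]) (auto simp: m_def Suc_le_eq)
qed

section \<open>Subgroups of abelian groups and their indices\<close>

text \<open>Subgroups are sets closed under subtraction; \<open>idx A B\<close> is the index, with the value 0 if it is infinite.\<close>

definition sgrp :: "'v::ab_group_add set \<Rightarrow> bool" where
  "sgrp A \<longleftrightarrow> 0 \<in> A \<and> (\<forall>a\<in>A. \<forall>b\<in>A. a - b \<in> A)"

definition coset :: "'v::ab_group_add set \<Rightarrow> 'v \<Rightarrow> 'v set" where
  "coset B a = (\<lambda>b. a + b) ` B"

definition idx :: "'v::ab_group_add set \<Rightarrow> 'v set \<Rightarrow> nat" where
  "idx A B = card (coset B ` A)"

lemma sgrpD: assumes "sgrp A"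
  shows "0 \<in> A" "a \<in> A \<Longrightarrow> b \<in> A \<Longrightarrow> a - b \<in> A" "a \<in> A \<Longrightarrow> b \<in> A \<Longrightarrow> a + b \<in> A" "a \<in> A \<Longrightarrow> - a \<in> A"
proof -
  show z: "0 \<in> A" and d: "\<And>a b. a \<in> A \<Longrightarrow> b \<in> A \<Longrightarrow> a - b \<in> A" using assms by (auto simp: sgrp_def)
  show m: "- a \<in> A" if "a \<in> A" for a using d[OF z that] by simp
  show "a + b \<in> A" if "a \<in> A" "b \<in> A" using d[OF that(1) m[OF that(2)]] by simp
qed

lemma sgrp_diff_cancel:
  assumes "sgrp A" "b \<in> A" shows "a - b \<in> A \<longleftrightarrow> a \<in> A" "a + b \<in> A \<longleftrightarrow> a \<in> A" "b + a \<in> A \<longleftrightarrow> a \<in> A" "b - a \<in> A \<longleftrightarrow> a \<in> A"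
proof -
  note D = sgrpD[OF assms(1)]
  show 1: "a - b \<in> A \<longleftrightarrow> a \<in> A" by (metis D(2,3) assms(2) diff_add_cancel)
  show 2: "a + b \<in> A \<longleftrightarrow> a \<in> A" by (metis D(2,3) assms(2) add_diff_cancel)
  show "b + a \<in> A \<longleftrightarrow> a \<in> A" using 2 by (simp add: add.commute)
  show "b - a \<in> A \<longleftrightarrow> a \<in> A" by (metis 1 D(4) minus_diff_eq)
qed

lemma sgrp_minus_commute: "sgrp A \<Longrightarrow> a - b \<in> A \<longleftrightarrow> b - a \<in> A"
  by (metis sgrpD(4) minus_diff_eq)

lemma sgrp_UNIV: "sgrp UNIV" by (auto simp: sgrp_def)

lemma sgrp_Int: "sgrp A \<Longrightarrow> sgrp B \<Longrightarrow> sgrp (A \<inter> B)" by (auto simp: sgrp_def)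

lemma sgrp_set_plus: assumes "sgrp A" "sgrp B" shows "sgrp (A + B)"
  unfolding sgrp_def
proof (intro conjI ballI)
  show "0 \<in> A + B" using set_plus_intro[OF sgrpD(1)[OF assms(1)] sgrpD(1)[OF assms(2)]] by simp
  fix u v assume "u \<in> A + B" "v \<in> A + B"
  then obtain a b a' b' where *: "u = a + b" "v = a' + b'" "a \<in> A" "a' \<in> A" "b \<in> B" "b' \<in> B"
    by (auto elim!: set_plus_elim)
  have "u - v = (a - a') + (b - b')" using * by simp
  then show "u - v \<in> A + B" using * assms by (metis set_plus_intro sgrpD(2))
qed

lemma set_plus_left_subset: "sgrp B \<Longrightarrow> A \<subseteq> A + B" for A :: "'v::ab_group_add set"
  by (metis add.right_neutral set_plus_intro sgrpD(1) subsetI)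

lemma set_plus_right_subset: "sgrp A \<Longrightarrow> B \<subseteq> A + B" for A :: "'v::ab_group_add set"
  by (metis add.commute set_plus_left_subset)

lemma set_plus_subset_sgrp: "sgrp C \<Longrightarrow> A \<subseteq> C \<Longrightarrow> B \<subseteq> C \<Longrightarrow> A + B \<subseteq> C"
  by (auto elim!: set_plus_elim intro: sgrpD)

lemma mem_set_plus_iff: "v \<in> A + B \<longleftrightarrow> (\<exists>b\<in>B. v - b \<in> A)" for v :: "'v::ab_group_add"
proof
  show "v \<in> A + B \<Longrightarrow> \<exists>b\<in>B. v - b \<in> A" by (auto elim!: set_plus_elim intro!: bexI)
  show "\<exists>b\<in>B. v - b \<in> A \<Longrightarrow> v \<in> A + B" using set_plus_intro[of "v - _" A _ B] by fastforce
qed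

lemma mem_coset_iff: "v \<in> coset B a \<longleftrightarrow> v - a \<in> B"
  unfolding coset_def by (auto intro: image_eqI[of _ _ "v - a"])

lemma coset_eq_iff: "sgrp B \<Longrightarrow> coset B a = coset B b \<longleftrightarrow> a - b \<in> B"
proof
  assume B: "sgrp B"
  show "coset B a = coset B b \<Longrightarrow> a - b \<in> B"
    using mem_coset_iff[of a B a] mem_coset_iff[of a B b] B by (simp add: sgrpD)
  assume "a - b \<in> B"
  then have "v - a \<in> B \<longleftrightarrow> v - b \<in> B" for v
    using sgrp_diff_cancel(2)[OF B, of "a - b" "v - a"] by simp
  then show "coset B a = coset B b" by (auto simp: mem_coset_iff)
qed

text \<open>Maps with the same fibres have images in bijection. As \<open>card\<close> is 0 on both
  sides for infinite images, finiteness never has to be assumed.\<close>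

lemma card_image_eq_if_same_kernel:
  assumes "\<And>a b. a \<in> A \<Longrightarrow> b \<in> A \<Longrightarrow> f a = f b \<longleftrightarrow> g a = g b"
  shows "card (f ` A) = card (g ` A)"
proof (rule bij_betw_same_card)
  let ?h = "\<lambda>y. g (inv_into A f y)"
  have h: "?h (f a) = g a" if "a \<in> A" for a
    using assms[of "inv_into A f (f a)" a] that by (simp add: inv_into_into f_inv_into_f)
  show "bij_betw ?h (f ` A) (g ` A)"
  proof (rule bij_betw_imageI)
    show "inj_on ?h (f ` A)" using assms h by (intro inj_onI) (metis imageE)
    show "?h ` f ` A = g ` A" unfolding image_image using h by (intro image_cong) auto
  qed
qed

text \<open>An isomorphism theorem in which \<open>f\<close> need not be additive: it is enough that
  \<open>f\<close> induces a bijection on cosets. This admits maps that come from a choice of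
  representatives.\<close>

lemma idx_eqI:
  assumes "sgrp B" "sgrp B'" "\<And>a. a \<in> A \<Longrightarrow> f a \<in> A'"
    and "\<And>a b. a \<in> A \<Longrightarrow> b \<in> A \<Longrightarrow> f a - f b \<in> B' \<longleftrightarrow> a - b \<in> B"
    and "\<And>y. y \<in> A' \<Longrightarrow> \<exists>a\<in>A. y - f a \<in> B'"
  shows "idx A B = idx A' B'"
proof -
  have "coset B' ` A' = (\<lambda>a. coset B' (f a)) ` A"
  proof
    show "coset B' ` A' \<subseteq> (\<lambda>a. coset B' (f a)) ` A"
      using assms(5) coset_eq_iff[OF assms(2)] by blast
    show "(\<lambda>a. coset B' (f a)) ` A \<subseteq> coset B' ` A'" using assms(3) by blast
  qed
  then show ?thesis unfolding idx_def
    using card_image_eq_if_same_kernel[of A "coset B" "\<lambda>a. coset B' (f a)"] assms(1,2,4)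
    by (simp add: coset_eq_iff)
qed

text \<open>A representative \<open>s a\<close> for each coset of \<open>B\<close> identifies A/C
  with the product of A/B and B/C. With the value 0 for infinite indices the formula holds without
  finiteness.\<close>

lemma idx_tower:
  assumes A: "sgrp A" and B: "sgrp B" and C: "sgrp C" and "C \<subseteq> B" "B \<subseteq> A"
  shows "idx A C = idx A B * idx B C"
proof -
  define s where "s a = (SOME a'. a' \<in> A \<and> coset B a' = coset B a)" for a
  have s: "s a \<in> A" "a - s a \<in> B" if "a \<in> A" for a
  proof -
    have "s a \<in> A \<and> coset B (s a) = coset B a" unfolding s_def by (rule someI[of _ a]) (use that in simp)
    then show "s a \<in> A" "a - s a \<in> B" using coset_eq_iff[OF B, of a "s a"] by auto
  qed
  have s_eq: "s a = s b" if "a - b \<in> B" for a b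
    using that coset_eq_iff[OF B, of a b] unfolding s_def by metis
  define F where "F a = (coset B a, coset C (a - s a))" for a
  have "F ` A = coset B ` A \<times> coset C ` B"
  proof
    show "F ` A \<subseteq> coset B ` A \<times> coset C ` B" using s by (auto simp: F_def)
    show "coset B ` A \<times> coset C ` B \<subseteq> F ` A"
    proof clarify
      fix a b assume ab: "a \<in> A" "b \<in> B"
      let ?x = "s a + b"
      have x: "?x \<in> A" using s(1) ab assms sgrpD(3)[OF A] by blast
      have "a - ?x = (a - s a) - b" by (simp add: algebra_simps)
      then have 1: "a - ?x \<in> B" using s(2)[OF ab(1)] ab(2) sgrpD(2)[OF B] by metis
      then have "s ?x = s a" using s_eq by metis
      then have "F ?x = (coset B a, coset C b)"
        using 1 coset_eq_iff[OF B, of a ?x] by (simp add: F_def)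
      then show "(coset B a, coset C b) \<in> F ` A" using x by (metis imageI)
    qed
  qed
  then have "idx A B * idx B C = card (F ` A)" by (simp add: idx_def card_cartesian_product)
  also have "\<dots> = idx A C" unfolding idx_def
  proof (rule card_image_eq_if_same_kernel)
    fix a b assume "a \<in> A" "b \<in> A"
    have "F a = F b \<longleftrightarrow> a - b \<in> B \<and> (a - s a) - (b - s b) \<in> C"
      by (simp add: F_def coset_eq_iff B C)
    also have "\<dots> \<longleftrightarrow> a - b \<in> C" using s_eq[of a b] \<open>C \<subseteq> B\<close> by auto
    finally show "F a = F b \<longleftrightarrow> coset C a = coset C b" by (simp add: coset_eq_iff C)
  qed
  finally show ?thesis by simp
qed

text \<open>The second isomorphism theorem.\<close>

lemma idx_set_plus: "sgrp A \<Longrightarrow> sgrp B \<Longrightarrow> idx (A + B) B = idx A (A \<inter> B)"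
proof (rule sym, rule idx_eqI[of _ _ _ "\<lambda>a. a"])
  assume s: "sgrp A" "sgrp B"
  show "sgrp (A \<inter> B)" using s by (rule sgrp_Int)
  show "a \<in> A + B" if "a \<in> A" for a using set_plus_left_subset[OF s(2)] that by blast
  show "a - b \<in> B \<longleftrightarrow> a - b \<in> A \<inter> B" if "a \<in> A" "b \<in> A" for a b using that s by (simp add: sgrpD)
  show "\<exists>a\<in>A. y - a \<in> B" if "y \<in> A + B" for y using that by (metis add.commute mem_set_plus_iff)
qed auto

lemma idx_self: "sgrp A \<Longrightarrow> idx A A = 1"
proof -
  assume A: "sgrp A"
  have "coset A ` A = (\<lambda>_. coset A 0) ` A"
    using coset_eq_iff[OF A, of _ 0] by (intro image_cong) auto
  also have "\<dots> = {coset A 0}" using sgrpD(1)[OF A] by auto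
  finally show ?thesis by (simp add: idx_def)
qed

lemma idx_nonzero_iff: "sgrp A \<Longrightarrow> idx A B \<noteq> 0 \<longleftrightarrow> finite (coset B ` A)"
  by (auto simp: idx_def card_eq_0_iff dest: sgrpD(1))

lemma idx_nonzeroI:
  assumes "sgrp A" "sgrp B" "finite F" "\<And>a. a \<in> A \<Longrightarrow> \<exists>f\<in>F. a - f \<in> B"
  shows "idx A B \<noteq> 0"
proof -
  have "coset B ` A \<subseteq> coset B ` F" using assms(2,4) by (auto simp: image_iff coset_eq_iff)
  then show ?thesis using assms(1,3) finite_subset idx_nonzero_iff by blast
qed

lemma idx_product:
  fixes A B :: "'i \<Rightarrow> 'v::ab_group_add set"
  assumes "finite I" "\<And>i. i \<in> I \<Longrightarrow> sgrp (A i)" "\<And>i. i \<in> I \<Longrightarrow> sgrp (B i)"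
  shows "card ((\<lambda>v. \<lambda>i\<in>I. coset (B i) (v i)) ` {v. (\<forall>i\<in>I. v i \<in> A i) \<and> (\<forall>i. i \<notin> I \<longrightarrow> v i = 0)}) = (\<Prod>i\<in>I. idx (A i) (B i))"
proof -
  let ?S = "{v. (\<forall>i\<in>I. v i \<in> A i) \<and> (\<forall>i. i \<notin> I \<longrightarrow> v i = 0)}"
  let ?F = "\<lambda>v. \<lambda>i\<in>I. coset (B i) (v i)"
  have "?F ` ?S = (\<Pi>\<^sub>E i\<in>I. coset (B i) ` A i)"
  proof
    show "?F ` ?S \<subseteq> (\<Pi>\<^sub>E i\<in>I. coset (B i) ` A i)" by auto
    show "(\<Pi>\<^sub>E i\<in>I. coset (B i) ` A i) \<subseteq> ?F ` ?S"
    proof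
      fix h assume h: "h \<in> (\<Pi>\<^sub>E i\<in>I. coset (B i) ` A i)"
      then have "\<forall>i\<in>I. \<exists>a. a \<in> A i \<and> h i = coset (B i) a" by (auto simp: PiE_iff image_iff)
      then obtain a where a: "\<And>i. i \<in> I \<Longrightarrow> a i \<in> A i \<and> h i = coset (B i) (a i)" by metis
      let ?v = "\<lambda>i. if i \<in> I then a i else 0"
      have "?v \<in> ?S" using a by auto
      moreover have "?F ?v i = h i" for i using a[of i] h by (cases "i \<in> I") (auto simp: PiE_iff extensional_def)
      then have "?F ?v = h" by blast
      ultimately show "h \<in> ?F ` ?S" by (intro image_eqI[of _ _ ?v]) auto
    qed
  qed
  then show ?thesis using assms(1) by (simp add: card_PiE idx_def)
qed

text \<open>
  The snake lemma, as an identity of indices, for an endomorphism \<open>q\<close> of \<open>B/N\<close> that is injective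
  and preserves the subgroup \<open>A/N\<close>.
\<close>

lemma idx_snake:
  assumes N: "sgrp N" and A: "sgrp A" and B: "sgrp B" and "N \<subseteq> A" "A \<subseteq> B"
    and q: "\<And>u v. q (u - v) = q u - q v" and qN: "q ` N \<subseteq> N" and qA: "q ` A \<subseteq> A" and qB: "q ` B \<subseteq> B"
    and inj: "\<And>v. v \<in> B \<Longrightarrow> q v \<in> N \<Longrightarrow> v \<in> N"
  shows "idx B (N + q ` B) * idx {v \<in> B. q v \<in> A} A = idx A (N + q ` A) * idx B (A + q ` B)"
proof -
  have im: "sgrp (q ` S)" if "sgrp S" for S
  proof -
    have "q 0 = 0" using q[of 0 0] by simp
    then have "0 \<in> q ` S" using sgrpD(1)[OF that] by (intro image_eqI[of _ _ 0]) auto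
    moreover have "q u - q v \<in> q ` S" if "u \<in> S" "v \<in> S" for u v
      using sgrpD(2)[OF \<open>sgrp S\<close> that] by (intro image_eqI[of _ _ "u - v"]) (auto simp: q)
    ultimately show ?thesis unfolding sgrp_def by blast
  qed
  let ?B' = "{v \<in> B. q v \<in> A}"
  have B': "sgrp ?B'" using A B q q[of 0 0] by (auto simp: sgrp_def)
  note sums = sgrp_set_plus[OF N im[OF A]] sgrp_set_plus[OF N im[OF B]] sgrp_set_plus[OF A im[OF B]] sgrp_set_plus[OF N im[OF B']]
  have AB': "A \<subseteq> ?B'" using qA \<open>A \<subseteq> B\<close> by auto
  \<comment> \<open>This index is cut at A + q(B), and the lower part is then moved inside
    \<open>A\<close> by the second isomorphism theorem.\<close>
  have "idx B (N + q ` B) = idx B (A + q ` B) * idx (A + q ` B) (N + q ` B)"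
    using \<open>N \<subseteq> A\<close> \<open>A \<subseteq> B\<close> qB B sums by (intro idx_tower set_plus_subset_sgrp set_plus_mono2) auto
  also have "A + q ` B = A + (N + q ` B)"
  proof
    show "A + q ` B \<subseteq> A + (N + q ` B)" by (intro set_plus_mono2 set_plus_right_subset N) auto
    show "A + (N + q ` B) \<subseteq> A + q ` B"
      using \<open>N \<subseteq> A\<close> set_plus_left_subset[OF im[OF B], of A]
      by (intro set_plus_subset_sgrp sums set_plus_right_subset A) auto
  qed
  also have "idx (A + (N + q ` B)) (N + q ` B) = idx A (A \<inter> (N + q ` B))"
    by (intro idx_set_plus A sums)
  \<comment> \<open>Modular law: if \<open>q b\<close> is congruent modulo \<open>N\<close> to an
    element of \<open>A\<close>, it lies in \<open>A\<close> itself since \<open>N\<close> does; so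
    only elements \<open>b\<close> of \<open>?B'\<close> occur.\<close>
  also have "A \<inter> (N + q ` B) = N + q ` ?B'"
  proof
    show "A \<inter> (N + q ` B) \<subseteq> N + q ` ?B'"
    proof
      fix v assume v: "v \<in> A \<inter> (N + q ` B)"
      then obtain b where b: "b \<in> B" "v - q b \<in> N" by (auto simp: mem_set_plus_iff)
      then have "q b \<in> A" using sgrp_diff_cancel(4)[OF A, of v "q b"] \<open>N \<subseteq> A\<close> v by auto
      then show "v \<in> N + q ` ?B'" using b by (auto simp: mem_set_plus_iff)
    qed
    show "N + q ` ?B' \<subseteq> A \<inter> (N + q ` B)"
      using \<open>N \<subseteq> A\<close> by (intro Int_greatest set_plus_subset_sgrp set_plus_mono2 A) auto
  qed
  finally have 1: "idx B (N + q ` B) = idx B (A + (N + q ` B)) * idx A (N + q ` ?B')" .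
  have "idx A (N + q ` A) = idx A (N + q ` ?B') * idx (N + q ` ?B') (N + q ` A)"
    using \<open>N \<subseteq> A\<close> AB' by (intro idx_tower A sums set_plus_subset_sgrp set_plus_mono2) auto
  \<comment> \<open>As \<open>q\<close> is injective modulo \<open>N\<close>, it identifies the
    quotient of \<open>?B'\<close> by \<open>A\<close> with this one.\<close>
  also have "idx (N + q ` ?B') (N + q ` A) = idx ?B' A"
  proof (rule sym, rule idx_eqI[of _ _ _ q])
    show "q a \<in> N + q ` ?B'" if "a \<in> ?B'" for a
      by (rule subsetD[OF set_plus_right_subset[OF N]]) (use that in blast)
    show "q a - q b \<in> N + q ` A \<longleftrightarrow> a - b \<in> A" if ab: "a \<in> ?B'" "b \<in> ?B'" for a b
    proof
      assume "a - b \<in> A" then show "q a - q b \<in> N + q ` A"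
        using q set_plus_right_subset[OF N] by (metis image_eqI in_mono)
    next
      assume "q a - q b \<in> N + q ` A"
      then obtain c where c: "c \<in> A" "q a - q b - q c \<in> N" by (auto simp: mem_set_plus_iff)
      then have "q (a - b - c) \<in> N" by (simp add: q)
      moreover have "a - b - c \<in> B" using ab c \<open>A \<subseteq> B\<close> B by (auto intro!: sgrpD(2))
      ultimately have "a - b - c \<in> A" using inj \<open>N \<subseteq> A\<close> by auto
      then show "a - b \<in> A" using sgrp_diff_cancel(1)[OF A] c by blast
    qed
    show "\<exists>a\<in>?B'. y - q a \<in> N + q ` A" if "y \<in> N + q ` ?B'" for y
      using that set_plus_left_subset[OF im[OF A], of N] unfolding mem_set_plus_iff[of y] by blast
  qed (use A sums in auto)
  finally show ?thesis using 1 \<open>A + q ` B = A + (N + q ` B)\<close> by simp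
qed

section \<open>Modules over \<open>int poly\<close> and finite generation\<close>

locale zt_module = Modules.module scale for scale :: "int poly \<Rightarrow> 'b::ab_group_add \<Rightarrow> 'b" (infixr \<open>*s\<close> 75)

text \<open>The ring as a module over itself: ideals are \<open>ring.subspace\<close>, and
  \<open>ring.span\<close> is the ideal generated by a set.\<close>

interpretation ring: zt_module "(*) :: int poly \<Rightarrow> int poly \<Rightarrow> int poly"
  by unfold_locales (auto simp: algebra_simps)

abbreviation t_pow_minus_1 :: "nat \<Rightarrow> int poly" where
  "t_pow_minus_1 r \<equiv> monom 1 r - 1"

lemma sgrp_int_mult: assumes "sgrp (A :: int set)" "a \<in> A" shows "k * a \<in> A"
proof (induction k rule: int_induct[where k = 0])
  case base show ?case using sgrpD(1)[OF assms(1)] by simp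
next
  case (step1 i) then show ?case using sgrpD(3)[OF assms(1) _ assms(2), of "i * a"] by (simp add: algebra_simps)
next
  case (step2 i) then show ?case using sgrpD(2)[OF assms(1) _ assms(2), of "i * a"] by (simp add: algebra_simps)
qed

text \<open>Division with remainder shows that the least positive element divides all others; the
  zero group has \<open>g = 0\<close>.\<close>

lemma sgrp_int_principal: assumes "sgrp (A :: int set)" shows "\<exists>g\<in>A. g \<ge> 0 \<and> (\<forall>a\<in>A. g dvd a)"
proof (cases "A = {0}")
  case False
  then obtain a where a: "a \<in> A" "a \<noteq> 0" using sgrpD(1)[OF assms] by blast
  define P where "P n \<longleftrightarrow> n > 0 \<and> int n \<in> A" for n
  have "\<bar>a\<bar> \<in> A" using a sgrpD(4)[OF assms, of a] by (auto simp: abs_if)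
  then have "P (nat \<bar>a\<bar>)" using a by (simp add: P_def)
  then have L: "P (LEAST n. P n)" by (rule LeastI)
  define g where "g = (LEAST n. P n)"
  have g: "g > 0" "int g \<in> A" using L unfolding g_def[symmetric] by (auto simp: P_def)
  have "int g dvd b" if "b \<in> A" for b
  proof -
    have "b mod int g = b - (b div int g) * int g" by (simp add: minus_div_mult_eq_mod)
    then have "b mod int g \<in> A" using sgrpD(2)[OF assms that sgrp_int_mult[OF assms g(2)]] by simp
    moreover have "b mod int g \<ge> 0" "b mod int g < int g" using g by simp_all
    moreover from this have "\<not> P (nat (b mod int g))"
      by (intro not_less_Least) (simp add: g_def[symmetric] nat_less_iff)
    ultimately show ?thesis by (simp add: dvd_eq_mod_eq_0 P_def)
  qed
  then show ?thesis using g by (intro bexI[of _ "int g"]) auto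
qed auto

context zt_module begin

lemma subspace_sgrp: "subspace V \<Longrightarrow> sgrp V"
  by (auto simp: sgrp_def subspace_0 subspace_diff)

lemma subspace_set_plus: "subspace U \<Longrightarrow> subspace V \<Longrightarrow> subspace (U + V)"
proof (rule subspaceI)
  assume U: "subspace U" and V: "subspace V"
  show "0 \<in> U + V" using set_plus_intro[OF subspace_0[OF U] subspace_0[OF V]] by simp
  show "x + y \<in> U + V" if "x \<in> U + V" "y \<in> U + V" for x y
    using that sgrpD(3)[OF sgrp_set_plus[OF subspace_sgrp[OF U] subspace_sgrp[OF V]]] by blast
  fix c x assume "x \<in> U + V"
  then obtain u v where "u \<in> U" "v \<in> V" "x = u + v" by (rule set_plus_elim)
  then have "c *s x = c *s u + c *s v" "c *s u \<in> U" "c *s v \<in> V"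
    using subspace_scale[OF U] subspace_scale[OF V] by (auto simp: scale_right_distrib)
  then show "c *s x \<in> U + V" using set_plus_intro by metis
qed

lemma subspace_scale_image: assumes "subspace V" shows "subspace ((*s) a ` V)"
proof (rule subspaceI)
  show "0 \<in> (*s) a ` V" using subspace_0[OF assms] by (intro image_eqI[of _ _ 0]) auto
next
  fix x y assume "x \<in> (*s) a ` V" "y \<in> (*s) a ` V"
  then obtain u v where "u \<in> V" "v \<in> V" "x = a *s u" "y = a *s v" by blast
  then show "x + y \<in> (*s) a ` V" using subspace_add[OF assms]
    by (intro image_eqI[of _ _ "u + v"]) (auto simp: scale_right_distrib)
next
  fix c x assume "x \<in> (*s) a ` V"
  then obtain u where "u \<in> V" "x = a *s u" by blast
  then show "c *s x \<in> (*s) a ` V" using subspace_scale[OF assms]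
    by (intro image_eqI[of _ _ "c *s u"]) (auto simp: mult.commute)
qed

lemma span_insert_iff: "v \<in> span (insert c C) \<longleftrightarrow> (\<exists>k. v - k *s c \<in> span C)"
  by (simp add: span_insert)

end

lemma ring_span_single: "ring.span {a} = range ((*) a)"
  by (auto simp: ring.span_singleton mult.commute)

lemma ideal_UNIV: assumes "ring.subspace J" "1 \<in> J" shows "J = UNIV"
proof -
  have "a \<in> J" for a using ring.subspace_scale[OF assms, of a] by simp
  then show ?thesis by blast
qed

text \<open>Hilbert's basis theorem for \<open>\<int>[t]\<close>.\<close>

lemma hilbert_basis:
  assumes I: "ring.subspace I" shows "\<exists>B. finite B \<and> I = ring.span B"
proof -
  \<comment> \<open>These subgroups of the integers increase with \<open>n\<close>, because
    multiplication by \<open>t\<close> raises the degree by one. Their union is generated by a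
    single \<open>g\<close>, which is reached at some level \<open>D\<close>.\<close>
  define C where "C n = {coeff p n | p. p \<in> I \<and> degree p \<le> n}" for n
  have sC: "sgrp (C n)" for n
    unfolding sgrp_def
  proof (intro conjI ballI)
    show "0 \<in> C n" unfolding C_def using ring.subspace_0[OF I] by (intro CollectI exI[of _ 0]) auto
    fix a b assume "a \<in> C n" "b \<in> C n"
    then obtain p q where "p \<in> I" "q \<in> I" "degree p \<le> n" "degree q \<le> n" "a = coeff p n" "b = coeff q n"
      unfolding C_def by blast
    then show "a - b \<in> C n" unfolding C_def using ring.subspace_diff[OF I]
      by (intro CollectI exI[of _ "p - q"]) (auto intro: degree_diff_le)
  qed
  have mono1: "C n \<subseteq> C (Suc n)" for n
  proof
    fix a assume "a \<in> C n"
    then obtain p where "p \<in> I" "degree p \<le> n" "a = coeff p n" unfolding C_def by blast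
    moreover from this have "monom 1 1 * p \<in> I" by (intro ring.subspace_scale[OF I])
    moreover have "degree (monom 1 1 * p) \<le> Suc (degree p)"
      using degree_mult_le[of "monom 1 1" p] degree_monom_le[of "1::int" 1] by linarith
    moreover have "coeff (monom 1 1 * p) (Suc n) = coeff p n" by (simp add: coeff_monom_mult)
    ultimately show "a \<in> C (Suc n)" unfolding C_def
      by (intro CollectI exI[of _ "monom 1 1 * p"]) linarith
  qed
  have mono: "C m \<subseteq> C n" if "m \<le> n" for m n using lift_Suc_mono_le[of C, OF mono1 that] .
  have "sgrp (\<Union>n. C n)" unfolding sgrp_def
  proof (intro conjI ballI)
    show "0 \<in> (\<Union>n. C n)" using sgrpD(1)[OF sC] by blast
    fix a b assume "a \<in> (\<Union>n. C n)" "b \<in> (\<Union>n. C n)"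
    then obtain m n where "a \<in> C m" "b \<in> C n" by blast
    then have "a \<in> C (max m n)" "b \<in> C (max m n)" using mono[of m "max m n"] mono[of n "max m n"] by auto
    then show "a - b \<in> (\<Union>n. C n)" using sgrpD(2)[OF sC] by blast
  qed
  from sgrp_int_principal[OF this] obtain g where "g \<in> (\<Union>n. C n)" and g0: "\<forall>a\<in>\<Union>n. C n. g dvd a" by blast
  then obtain D where gD: "g \<in> C D" by blast
  have g: "g dvd a" if "a \<in> C n" for n a using g0 that by blast
  have "\<exists>p. p \<in> I \<and> degree p \<le> n \<and> (\<forall>a\<in>C n. coeff p n dvd a)" for n
  proof -
    obtain g where "g \<in> C n" "\<forall>a\<in>C n. g dvd a" using sgrp_int_principal[OF sC] by metis
    moreover from this(1) obtain p where "p \<in> I" "degree p \<le> n" "g = coeff p n" unfolding C_def by blast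
    ultimately show ?thesis by metis
  qed
  then obtain P where P: "\<And>n. P n \<in> I" "\<And>n. degree (P n) \<le> n" "\<And>n a. a \<in> C n \<Longrightarrow> coeff (P n) n dvd a" by metis
  obtain h where h: "h \<in> I" "degree h \<le> D" "coeff h D = g" using gD unfolding C_def by blast
  \<comment> \<open>Above degree \<open>D\<close> the products of \<open>h\<close> with monomials
    already cancel every leading coefficient; up to degree \<open>D\<close> one \<open>P n\<close>
    per degree is needed.\<close>
  define B where "B = insert h (P ` {..D})"
  have BI: "B \<subseteq> I" using P h by (auto simp: B_def)
  have "p \<in> ring.span B" if "p \<in> I" for p
    using that
  proof (induction "degree p" arbitrary: p rule: less_induct)
    case less
    define n where "n = degree p"
    have lc: "lead_coeff p \<in> C n" unfolding C_def n_def using less.prems by blast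
    have "\<exists>b\<in>ring.span B. degree b \<le> n \<and> coeff b n = lead_coeff p"
    proof (cases "n \<le> D")
      case True
      obtain k where k: "lead_coeff p = coeff (P n) n * k" using P(3)[OF lc] by (elim dvdE)
      have "P n \<in> ring.span B" using True by (intro ring.span_base) (auto simp: B_def)
      then have "[:k:] * P n \<in> ring.span B" by (rule ring.span_scale)
      moreover have "degree ([:k:] * P n) \<le> n"
        using degree_smult_le[of k "P n"] P(2)[of n] by simp
      moreover have "coeff ([:k:] * P n) n = lead_coeff p" using k by (simp add: mult.commute)
      ultimately show ?thesis by blast
    next
      case False
      obtain k where k: "lead_coeff p = g * k" using g[OF lc] by (elim dvdE)
      have "h \<in> ring.span B" by (intro ring.span_base) (auto simp: B_def)
      then have "monom k (n - D) * h \<in> ring.span B" by (rule ring.span_scale)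
      moreover have "degree (monom k (n - D) * h) \<le> n"
        using degree_mult_le[of "monom k (n - D)" h] degree_monom_le[of k "n - D"] h(2) False by linarith
      moreover have "coeff (monom k (n - D) * h) n = lead_coeff p"
        using h(3) k False by (simp add: coeff_monom_mult)
      ultimately show ?thesis by blast
    qed
    then obtain b where b: "b \<in> ring.span B" "degree b \<le> n" "coeff b n = lead_coeff p" by blast
    have bI: "b \<in> I" using b(1) ring.span_minimal[OF BI I] by blast
    have pb: "p - b \<in> I" using ring.subspace_diff[OF I less.prems bI] .
    have "p - b \<in> ring.span B"
    proof (cases "p - b = 0")
      case False
      have "degree (p - b) \<le> n" using b(2) by (intro degree_diff_le) (auto simp: n_def)
      moreover have "coeff (p - b) n = 0" using b(3) by (simp add: n_def)
      ultimately have "degree (p - b) < degree p"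
        using False by (metis leading_coeff_0_iff n_def order_le_less)
      then show ?thesis using less.hyps pb by blast
    qed (simp add: ring.span_zero)
    from ring.span_add[OF this b(1)] show ?case by simp
  qed
  then have "I = ring.span B" using ring.span_minimal[OF BI I] by blast
  moreover have "finite B" by (simp add: B_def)
  ultimately show ?thesis by blast
qed

text \<open>Induction on the generators. The coefficients with which \<open>b\<close> occurs in
  elements of \<open>S\<close> form an ideal; lifts to \<open>S\<close> of its finitely many
  generators, together with generators of the part of \<open>S\<close> inside \<open>span B\<close>,
  generate \<open>S\<close>.\<close>

lemma (in zt_module) subspace_of_span_finite:
  assumes "finite B" "subspace S" "S \<subseteq> span B"
  shows "\<exists>C. finite C \<and> S = span C"
  using assms
proof (induction B arbitrary: S rule: finite_induct)
  case empty
  then have "S = span {}" using subspace_0 by auto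
  then show ?case by blast
next
  case (insert b B)
  define I where "I = {a. \<exists>w\<in>span B. a *s b + w \<in> S}"
  have sB: "subspace (span B)" by (rule subspace_span)
  have "ring.subspace I"
  proof (rule ring.subspaceI)
    show "0 \<in> I" unfolding I_def using subspace_0[OF insert.prems(1)] span_zero by (auto intro!: bexI[of _ 0])
  next
    fix x y assume "x \<in> I" "y \<in> I"
    then obtain u v where uv: "u \<in> span B" "v \<in> span B" "x *s b + u \<in> S" "y *s b + v \<in> S" unfolding I_def by blast
    have "(x + y) *s b + (u + v) = (x *s b + u) + (y *s b + v)" by (simp add: scale_left_distrib)
    then have "(x + y) *s b + (u + v) \<in> S"
      using subspace_add[OF insert.prems(1) uv(3,4)] by (simp only:)
    then show "x + y \<in> I" unfolding I_def using span_add[OF uv(1,2)] by blast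
  next
    fix c x assume "x \<in> I"
    then obtain u where u: "u \<in> span B" "x *s b + u \<in> S" unfolding I_def by blast
    have "(c * x) *s b + c *s u = c *s (x *s b + u)" by (simp add: scale_right_distrib)
    then have "(c * x) *s b + c *s u \<in> S"
      using subspace_scale[OF insert.prems(1) u(2)] by (simp only:)
    then show "c * x \<in> I" unfolding I_def using span_scale[OF u(1)] by blast
  qed
  then obtain G where G: "finite G" "I = ring.span G" using hilbert_basis by blast
  have "\<exists>w. w \<in> span B \<and> a *s b + w \<in> S" if "a \<in> G" for a
    using that G ring.span_base[of a G] unfolding I_def by blast
  then obtain w where w: "\<And>a. a \<in> G \<Longrightarrow> w a \<in> span B" "\<And>a. a \<in> G \<Longrightarrow> a *s b + w a \<in> S" by metis
  obtain D where D: "finite D" "S \<inter> span B = span D"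
    using insert.IH[of "S \<inter> span B"] subspace_inter[OF insert.prems(1) sB] by blast
  define E where "E = D \<union> (\<lambda>a. a *s b + w a) ` G"
  have "D \<subseteq> S" using D span_superset[of D] by blast
  then have "E \<subseteq> S" using w by (auto simp: E_def)
  then have "span E \<subseteq> S" by (intro span_minimal insert.prems)
  have key: "\<exists>e\<in>span E. \<exists>u\<in>span B. e = a *s b + u" if "a \<in> ring.span G" for a
    using that
  proof (induction rule: ring.span_induct_alt)
    case base show ?case by (intro bexI[of _ 0]) (auto simp: span_zero)
  next
    case (step c x y)
    then obtain e u where eu: "e \<in> span E" "u \<in> span B" "e = y *s b + u" by blast
    have "x *s b + w x \<in> span E" using step by (intro span_base) (auto simp: E_def)
    then have "c *s (x *s b + w x) + e \<in> span E" by (rule span_add[OF span_scale eu(1)])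
    moreover have "c *s (x *s b + w x) + e = (c * x + y) *s b + (c *s w x + u)"
      using eu by (simp add: scale_left_distrib scale_right_distrib)
    moreover have "c *s w x + u \<in> span B" using w step eu by (intro span_add span_scale) auto
    ultimately show ?case by metis
  qed
  have "S \<subseteq> span E"
  proof
    fix s assume s: "s \<in> S"
    then obtain k where k: "s - k *s b \<in> span B" using insert.prems span_insert_iff by blast
    have "k *s b + (s - k *s b) \<in> S" using s by simp
    then have "k \<in> I" unfolding I_def using k by blast
    then obtain e u where eu: "e \<in> span E" "u \<in> span B" "e = k *s b + u" using key G by blast
    have "s - e \<in> S" using subspace_diff[OF insert.prems(1) s] eu \<open>span E \<subseteq> S\<close> by blast
    moreover have "s - e = (s - k *s b) - u" using eu by simp
    then have "s - e \<in> span B" using span_diff[OF k eu(2)] by (simp only:)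
    ultimately have "s - e \<in> span D" using D by blast
    then have "s - e \<in> span E" using span_mono[of D E] by (auto simp: E_def)
    from span_add[OF this eu(1)] show "s \<in> span E" by simp
  qed
  then have "S = span E" using \<open>span E \<subseteq> S\<close> by blast
  moreover have "finite E" using D G by (simp add: E_def)
  ultimately show ?case by blast
qed

section \<open>Periodicity in the exponent \<open>r\<close>\<close>

text \<open>The values may have any type, since submodules, gcds and truth values will be periodic
  as well as numbers.\<close>

definition cyclic_seq :: "(nat \<Rightarrow> 'a) \<Rightarrow> bool" where
  "cyclic_seq f \<longleftrightarrow> (\<exists>p\<ge>1. \<forall>r\<ge>1. f (r + p) = f r)"

lemma cyclic_multiple:
  fixes r p k :: nat
  assumes "\<And>r. r \<ge> 1 \<Longrightarrow> f (r + p) = f r" "r \<ge> 1"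
  shows "f (r + p * k) = f r"
proof (induction k)
  case (Suc k)
  have "f (r + p * Suc k) = f ((r + p * k) + p)" by (simp add: algebra_simps)
  also have "\<dots> = f (r + p * k)" using assms(2) by (intro assms(1)) simp
  finally show ?case using Suc by simp
qed simp

lemma cyclic_seq_comp: "cyclic_seq f \<Longrightarrow> cyclic_seq (\<lambda>r. h (f r))"
  unfolding cyclic_seq_def by fastforce

lemma cyclic_seq_const: "cyclic_seq (\<lambda>r. c)"
  unfolding cyclic_seq_def by (intro exI[of _ 1]) auto

lemma cyclic_seq_Pair:
  assumes "cyclic_seq f" "cyclic_seq g" shows "cyclic_seq (\<lambda>r. (f r, g r))"
proof -
  obtain p q where p: "p \<ge> 1" "\<And>r. r \<ge> 1 \<Longrightarrow> f (r + p) = f r" and q: "q \<ge> 1" "\<And>r. r \<ge> 1 \<Longrightarrow> g (r + q) = g r"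
    using assms unfolding cyclic_seq_def by metis
  show ?thesis unfolding cyclic_seq_def
  proof (intro exI[of _ "p * q"] conjI allI impI)
    show "p * q \<ge> 1" using p q by simp
    fix r :: nat assume "r \<ge> 1"
    then show "(f (r + p * q), g (r + p * q)) = (f r, g r)"
      using cyclic_multiple[of f p r q] cyclic_multiple[of g q r p] p q by (simp add: mult.commute)
  qed
qed

lemma cyclic_seq_Collect:
  assumes "finite A" "\<And>x. x \<in> A \<Longrightarrow> cyclic_seq (P x)"
  shows "cyclic_seq (\<lambda>r. {x \<in> A. P x r})"
  using assms
proof (induction A rule: finite_induct)
  case empty
  show ?case using cyclic_seq_const[of "{}"] by simp
next
  case (insert a A)
  have 1: "cyclic_seq (\<lambda>r. {x \<in> A. P x r})" using insert by blast
  have 2: "cyclic_seq (P a)" using insert.prems by blast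
  have "cyclic_seq (\<lambda>r. (\<lambda>(b, S). if b then insert a S else S) (P a r, {x \<in> A. P x r}))"
    by (rule cyclic_seq_comp[OF cyclic_seq_Pair[OF 2 1]])
  moreover have "(\<lambda>(b, S). if b then insert a S else S) (P a r, {x \<in> A. P x r}) = {x \<in> insert a A. P x r}" for r
    by auto
  ultimately show ?case by simp
qed

lemma t_pow_minus_1_add: "t_pow_minus_1 (r + s) = monom 1 r * t_pow_minus_1 s + t_pow_minus_1 r"
  by (simp add: algebra_simps mult_monom)

lemma t_pow_minus_1_dvd_mult: "t_pow_minus_1 s dvd t_pow_minus_1 (s * k)"
proof (induction k)
  case (Suc k)
  have "t_pow_minus_1 (s * Suc k) = monom 1 (s * k) * t_pow_minus_1 s + t_pow_minus_1 (s * k)"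
    using t_pow_minus_1_add[of "s * k" s] by (simp add: add.commute)
  then show ?case using Suc by (simp only: dvd_add dvd_triv_right)
qed simp

lemma t_pow_minus_1_nonzero: "r \<ge> 1 \<Longrightarrow> t_pow_minus_1 r \<noteq> 0"
proof
  assume r: "r \<ge> 1" and "t_pow_minus_1 r = 0"
  then have "coeff (t_pow_minus_1 r) r = 0" by simp
  then show False using r by simp
qed

lemma coeff_t_pow_minus_1: "r \<ge> 1 \<Longrightarrow> coeff (t_pow_minus_1 r) r = 1" by simp

lemma degree_t_pow_minus_1: "r \<ge> 1 \<Longrightarrow> degree (t_pow_minus_1 r) = r"
  by (intro antisym degree_diff_le le_degree) (auto simp: degree_monom_le)

lemma lead_coeff_t_pow_minus_1: "r \<ge> 1 \<Longrightarrow> lead_coeff (t_pow_minus_1 r) = 1"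
  using degree_t_pow_minus_1[of r] coeff_t_pow_minus_1[of r] by simp

context zt_module begin

text \<open>If \<open>t ^ s - 1\<close> sends \<open>w\<close> into \<open>V\<close> for some
  positive \<open>s\<close>, then \<open>t ^ (r + s) - 1\<close> and \<open>t ^ r - 1\<close> agree
  on \<open>w\<close> modulo \<open>V\<close>, so \<open>s\<close> is a period. Otherwise the
  condition is false for all positive \<open>r\<close>.\<close>

lemma cyclic_seq_mem:
  assumes V: "subspace V" shows "cyclic_seq (\<lambda>r. t_pow_minus_1 r *s w \<in> V)"
proof (cases "\<exists>s\<ge>1. t_pow_minus_1 s *s w \<in> V")
  case True
  then obtain s where s: "s \<ge> 1" "t_pow_minus_1 s *s w \<in> V" by blast
  have "t_pow_minus_1 (r + s) *s w \<in> V \<longleftrightarrow> t_pow_minus_1 r *s w \<in> V" for r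
  proof -
    have "t_pow_minus_1 (r + s) *s w = monom 1 r *s (t_pow_minus_1 s *s w) + t_pow_minus_1 r *s w"
      unfolding t_pow_minus_1_add by (simp only: scale_left_distrib scale_scale)
    then show ?thesis using sgrp_diff_cancel(3)[OF subspace_sgrp[OF V] subspace_scale[OF V s(2), of "monom 1 r"]] by metis
  qed
  then show ?thesis unfolding cyclic_seq_def using s(1) by blast
next
  case False
  then show ?thesis unfolding cyclic_seq_def by (intro exI[of _ 1]) auto
qed

text \<open>Only finitely many submodules occur among the \<open>V r\<close>. The set of those that
  contain the element is periodic by \<open>cyclic_seq_mem\<close>, and so is the question whether
  the current \<open>V r\<close> is one of them.\<close>

lemma cyclic_seq_mem_cyclic:
  assumes V: "\<And>r. subspace (V r)" and "cyclic_seq V"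
  shows "cyclic_seq (\<lambda>r. t_pow_minus_1 r *s w \<in> V r)"
proof -
  obtain p where p: "p \<ge> 1" "\<And>r. r \<ge> 1 \<Longrightarrow> V (r + p) = V r"
    using assms(2) unfolding cyclic_seq_def by metis
  define A where "A = V ` {1..p}"
  have VA: "V r \<in> A" if "r \<ge> 1" for r
  proof -
    \<comment> \<open>The representative of \<open>r\<close> modulo \<open>p\<close> is taken in
      \<open>{1..p}\<close>, as periodicity starts only at index 1.\<close>
    define s where "s = 1 + (r - 1) mod p"
    have "r = s + p * ((r - 1) div p)" using that by (simp add: s_def)
    then have "V r = V s" using cyclic_multiple[of V p s "(r - 1) div p"] p(2) by (simp add: s_def)
    moreover have "s \<in> {1..p}" using p(1) by (simp add: s_def Suc_le_eq)
    ultimately show ?thesis unfolding A_def by blast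
  qed
  define S where "S r = {U \<in> A. t_pow_minus_1 r *s w \<in> U}" for r
  have "cyclic_seq S" unfolding S_def
  proof (rule cyclic_seq_Collect)
    show "finite A" by (simp add: A_def)
    fix U assume "U \<in> A"
    then have "subspace U" using V by (auto simp: A_def)
    then show "cyclic_seq (\<lambda>r. t_pow_minus_1 r *s w \<in> U)" by (rule cyclic_seq_mem)
  qed
  then have "cyclic_seq (\<lambda>r. (\<lambda>(U, T). U \<in> T) (V r, S r))"
    by (rule cyclic_seq_comp[OF cyclic_seq_Pair[OF assms(2)]])
  then obtain q where q: "q \<ge> 1" "\<And>r. r \<ge> 1 \<Longrightarrow> (V (r + q) \<in> S (r + q)) = (V r \<in> S r)"
    unfolding cyclic_seq_def by auto
  have "V r \<in> S r \<longleftrightarrow> t_pow_minus_1 r *s w \<in> V r" if "r \<ge> 1" for r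
    using VA[OF that] by (simp add: S_def)
  then have "(t_pow_minus_1 (r + q) *s w \<in> V (r + q)) = (t_pow_minus_1 r *s w \<in> V r)" if "r \<ge> 1" for r
    using q(2)[OF that] that by simp
  then show ?thesis unfolding cyclic_seq_def using q(1) by blast
qed

end

lemma ring_span_pair: "v \<in> ring.span {a, b} \<longleftrightarrow> (\<exists>x y. v = x * a + y * b)"
proof -
  have "v \<in> ring.span {a, b} \<longleftrightarrow> (\<exists>k. v - k * a \<in> range ((*) b))"
    by (simp add: ring.span_insert_iff ring_span_single)
  also have "\<dots> \<longleftrightarrow> (\<exists>x y. v = x * a + y * b)"
    by (auto simp: image_iff algebra_simps)
  finally show ?thesis .
qed

lemma const_poly_dvd_coeffD: "[:k:] dvd p \<Longrightarrow> k dvd coeff p i" for k :: int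
  by (simp add: const_poly_dvd_iff)

text \<open>A divisor of a nonzero constant is itself constant, and a constant that divides a
  coefficient 1 is a unit. It is applied to \<open>t_pow_minus_1 r\<close>, whose top coefficient is
  1.\<close>

lemma unit_of_dvd_const:
  assumes "e dvd [:n:]" "n \<noteq> 0" "e dvd p" "coeff p i = 1" shows "is_unit (e :: int poly)"
proof -
  have "degree e \<le> degree [:n:]" using assms(1,2) by (intro dvd_imp_degree_le) auto
  then obtain k where k: "e = [:k:]" using degree_eq_zeroE by auto
  have "k dvd 1" using const_poly_dvd_coeffD[of k p i] assms(3,4) k by simp
  then show ?thesis using k by (metis const_poly_dvd_const_poly_iff one_pCons)
qed

text \<open>Among the common divisors of \<open>f\<close> and some \<open>t ^ s - 1\<close>, take
  \<open>e\<close> of the largest degree, dividing \<open>t ^ N - 1\<close>. For any other such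
  \<open>d\<close>, the lcm of \<open>e\<close> and \<open>d\<close> is again of this kind, so it
  exceeds \<open>e\<close> by a constant factor only; that constant divides a monic polynomial and
  is a unit. Hence every such \<open>d\<close> divides \<open>t ^ N - 1\<close>, and
  \<open>N\<close> is a period.\<close>

lemma cyclic_seq_gcd:
  assumes f: "f \<noteq> 0" shows "cyclic_seq (\<lambda>r. gcd f (t_pow_minus_1 r))"
proof -
  define P where "P d \<longleftrightarrow> d dvd f \<and> (\<exists>s\<ge>1. d dvd t_pow_minus_1 s)" for d
  have "P 1" unfolding P_def by auto
  moreover have "\<forall>d. P d \<longrightarrow> degree d \<le> degree f" unfolding P_def using f dvd_imp_degree_le by blast
  ultimately have "\<exists>e. P e \<and> (\<forall>d. P d \<longrightarrow> degree d \<le> degree e)"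
    by (intro ex_has_greatest_nat[of P 1 degree "Suc (degree f)"]) (auto simp: less_Suc_eq_le)
  then obtain e where e: "P e" and "\<forall>d. P d \<longrightarrow> degree d \<le> degree e" by (elim exE conjE)
  then have max: "degree d \<le> degree e" if "P d" for d using that by blast
  from e obtain N where N: "N \<ge> 1" "e dvd t_pow_minus_1 N" unfolding P_def by metis
  have PN: "d dvd t_pow_minus_1 N" if "P d" for d
  proof -
    obtain s where s: "s \<ge> 1" "d dvd t_pow_minus_1 s" using \<open>P d\<close> unfolding P_def by blast
    have "e dvd t_pow_minus_1 (N * s)" by (rule dvd_trans[OF N(2) t_pow_minus_1_dvd_mult])
    moreover have "d dvd t_pow_minus_1 (N * s)"
      using dvd_trans[OF s(2) t_pow_minus_1_dvd_mult, of N] by (simp add: mult.commute)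
    ultimately have l: "lcm e d dvd t_pow_minus_1 (N * s)" by (rule lcm_least)
    have Ns: "N * s \<ge> 1" using N s by simp
    have "lcm e d dvd f" using \<open>P e\<close> \<open>P d\<close> unfolding P_def by (intro lcm_least) blast+
    then have "P (lcm e d)" unfolding P_def using l Ns by blast
    then have deg: "degree (lcm e d) \<le> degree e" by (rule max)
    obtain k where k: "lcm e d = e * k" using dvd_lcm1[of e d] by (elim dvdE)
    have "lcm e d \<noteq> 0" using l t_pow_minus_1_nonzero[OF Ns] by (metis dvd_0_left)
    then have nz: "e \<noteq> 0" "k \<noteq> 0" using k by auto
    then have "degree k = 0" using deg k by (simp add: degree_mult_eq)
    then obtain c where c: "k = [:c:]" by (rule degree_eq_zeroE)
    have "k dvd t_pow_minus_1 (N * s)" using l k by (metis dvd_mult_right)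
    then have "is_unit k"
      using unit_of_dvd_const[of k c, OF _ _ _ coeff_t_pow_minus_1[OF Ns]] c nz by simp
    then have "lcm e d dvd e" unfolding k by simp
    then show ?thesis using N(2) by (meson dvd_lcm2 dvd_trans)
  qed
  have "gcd f (t_pow_minus_1 (r + N)) = gcd f (t_pow_minus_1 r)" if r: "r \<ge> 1" for r
  proof (rule associated_eqI)
    let ?d = "gcd f (t_pow_minus_1 r)" and ?d' = "gcd f (t_pow_minus_1 (r + N))"
    have "P ?d" unfolding P_def by (intro conjI exI[of _ r] gcd_dvd1 gcd_dvd2 r)
    then have "?d dvd t_pow_minus_1 N" by (rule PN)
    then have "?d dvd t_pow_minus_1 (r + N)" unfolding t_pow_minus_1_add by (intro dvd_add dvd_mult gcd_dvd2)
    then show "?d dvd ?d'" by (intro gcd_greatest gcd_dvd1)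
    have "P ?d'" unfolding P_def using r by (intro conjI exI[of _ "r + N"] gcd_dvd1 gcd_dvd2) simp
    then have "?d' dvd monom 1 r * t_pow_minus_1 N" by (intro dvd_mult PN)
    moreover have "?d' dvd monom 1 r * t_pow_minus_1 N + t_pow_minus_1 r"
      unfolding t_pow_minus_1_add[symmetric] by (rule gcd_dvd2)
    ultimately have "?d' dvd t_pow_minus_1 r" by (simp only: dvd_add_right_iff)
    then show "?d' dvd ?d" by (intro gcd_greatest gcd_dvd1)
  qed auto
  then show ?thesis unfolding cyclic_seq_def using N(1) by blast
qed

lemma coprime_const_t_pow_minus_1: "n \<noteq> 0 \<Longrightarrow> r \<ge> 1 \<Longrightarrow> coprime [:n:] (t_pow_minus_1 r)"
  using unit_of_dvd_const[of _ n "t_pow_minus_1 r" r] coeff_t_pow_minus_1 by (intro coprimeI) blast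

text \<open>The square of a common factor divides \<open>t ^ r - 1\<close>, so the factor divides
  the derivative as well. Since \<open>t\<close> times the derivative minus \<open>r\<close> times
  \<open>t ^ r - 1\<close> is the constant \<open>r\<close>, it divides a nonzero constant and a
  monic polynomial, and is a unit.\<close>

lemma t_pow_minus_1_squarefree:
  assumes "t_pow_minus_1 r = d * q" "r \<ge> 1" shows "coprime d q"
proof (rule coprimeI)
  fix e assume "e dvd d" "e dvd q"
  then obtain x y where xy: "d = e * x" "q = e * y" by (elim dvdE)
  have "t_pow_minus_1 r = e * (e * (x * y))" using xy assms(1) by simp
  moreover have "pderiv (e * (e * (x * y))) = e * (pderiv (e * (x * y)) + (x * y) * pderiv e)"
    unfolding pderiv_mult[of e "e * (x * y)"] by (simp only: distrib_left mult.assoc)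
  ultimately have "pderiv (t_pow_minus_1 r) = e * (pderiv (e * (x * y)) + (x * y) * pderiv e)" by (simp only:)
  then have "e dvd pderiv (t_pow_minus_1 r)" by (rule dvdI)
  moreover have "pderiv (t_pow_minus_1 r) = monom (int r) (r - 1)" by (simp add: pderiv_diff pderiv_monom)
  moreover have e: "e dvd t_pow_minus_1 r" using xy assms(1) by simp
  ultimately have "e dvd monom (int r) (r - 1)" by (simp only:)
  then have "e dvd monom 1 1 * monom (int r) (r - 1) - [:int r:] * t_pow_minus_1 r"
    by (rule dvd_diff[OF dvd_mult dvd_mult[OF e]])
  also have "monom 1 1 * monom (int r) (r - 1) = monom (int r) r" using assms(2) by (simp add: mult_monom)
  also have "monom (int r) r - [:int r:] * t_pow_minus_1 r = [:int r:]"
    by (simp add: smult_diff_right smult_monom)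
  finally have "e dvd [:int r:]" .
  then show "is_unit e"
    by (rule unit_of_dvd_const[OF _ _ e coeff_t_pow_minus_1[OF assms(2)]]) (use assms(2) in simp)
qed

section \<open>Ideals of \<open>int poly\<close> and finite quotients\<close>

text \<open>Over the rationals \<open>I\<close> is generated by an element \<open>u\<close> of least
  degree. Its primitive part \<open>g\<close> divides all of \<open>I\<close> by pseudo-division and
  Gauss's lemma, and its content \<open>c\<close> brings \<open>g\<close> back into
  \<open>I\<close>.\<close>

lemma ideal_generator:
  assumes I: "ring.subspace I" and "f \<in> I" "f \<noteq> 0"
  obtains g c where "c \<noteq> 0" "g \<noteq> 0" "\<And>a. a \<in> I \<Longrightarrow> g dvd a" "[:c:] * g \<in> I"
proof -
  obtain u where u: "u \<in> I" "u \<noteq> 0" and min: "\<And>a. a \<in> I \<Longrightarrow> a \<noteq> 0 \<Longrightarrow> degree u \<le> degree a"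
    using ex_has_least_nat[of "\<lambda>a. a \<in> I \<and> a \<noteq> 0" f degree] assms(2,3) by blast
  define g where "g = primitive_part u"
  define c where "c = content u"
  have cg: "[:c:] * g = u" unfolding c_def g_def by simp
  have "g dvd a" if a: "a \<in> I" for a
  proof -
    obtain b q where bq: "b \<noteq> 0" "smult b a = u * q + pseudo_mod a u" "pseudo_mod a u = 0 \<or> degree (pseudo_mod a u) < degree u"
      using pseudo_mod[OF u(2), of a] by blast
    have "pseudo_mod a u = [:b:] * a - q * u" using bq(2) by (simp add: mult.commute)
    then have "pseudo_mod a u \<in> I"
      using ring.subspace_diff[OF I ring.subspace_scale[OF I a] ring.subspace_scale[OF I u(1)]] by metis
    then have "pseudo_mod a u = 0" using min bq(3) by (meson not_le)
    then have eq: "smult b a = g * ([:c:] * q)" using bq(2) cg by (metis add_0_right mult.assoc mult.commute)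
    have "content g = 1" using u(2) by (simp add: g_def)
    then have "content (smult b a) = content ([:c:] * q)" unfolding eq by (simp add: content_mult)
    moreover have "b dvd content (smult b a)" by simp
    ultimately have "b dvd content ([:c:] * q)" by (simp only:)
    then have "[:b:] dvd [:c:] * q" by (simp only: const_poly_dvd_iff_dvd_content)
    then obtain s where "[:c:] * q = [:b:] * s" by (elim dvdE)
    then have "smult b a = smult b (g * s)" using eq by simp
    then have "a = g * s" using bq(1) by (simp add: poly_eq_iff)
    then show ?thesis by simp
  qed
  moreover have "c \<noteq> 0" "g \<noteq> 0" using u(2) by (auto simp: c_def g_def)
  moreover have "[:c:] * g \<in> I" using u(1) cg by (simp only:)
  ultimately show ?thesis using that by blast
qed

text \<open>Coprime elements need not generate the unit ideal, as 2 and \<open>t\<close> show. But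
  the common divisor supplied by \<open>ideal_generator\<close> is a unit, so some nonzero integer
  lies in the ideal.\<close>

lemma int_poly_bezout:
  assumes "coprime p q" "p \<noteq> (0 :: int poly)"
  obtains c x y where "c \<noteq> 0" "[:c:] = x * p + y * q"
proof -
  have pq: "p \<in> ring.span {p, q}" "q \<in> ring.span {p, q}" by (auto intro: ring.span_base)
  obtain g c where g: "c \<noteq> 0" "g \<noteq> 0" "\<And>a. a \<in> ring.span {p, q} \<Longrightarrow> g dvd a" "[:c:] * g \<in> ring.span {p, q}"
    using ideal_generator[OF ring.subspace_span pq(1) assms(2)] by blast
  have "is_unit g" by (rule coprime_common_divisor[OF assms(1) g(3)[OF pq(1)] g(3)[OF pq(2)]])
  then obtain h where "1 = g * h" by (elim dvdE)
  then have "[:c:] = h * ([:c:] * g)" by (simp add: mult.commute)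
  then have "[:c:] \<in> ring.span {p, q}" using ring.span_scale[OF g(4)] by metis
  then obtain x y where "[:c:] = x * p + y * q" unfolding ring_span_pair by blast
  then show ?thesis by (rule that[OF g(1)])
qed

lemma finite_bounded_polys: "finite {p :: int poly. degree p \<le> D \<and> (\<forall>i. coeff p i \<in> {0..<n})}"
proof (rule finite_subset)
  let ?L = "{xs. set xs \<subseteq> {0..<n} \<and> length xs \<le> Suc D}"
  show "finite (Poly ` ?L)" by (intro finite_imageI finite_lists_length_le) simp
  show "{p. degree p \<le> D \<and> (\<forall>i. coeff p i \<in> {0..<n})} \<subseteq> Poly ` ?L"
  proof
    fix p assume p: "p \<in> {p. degree p \<le> D \<and> (\<forall>i. coeff p i \<in> {0..<n})}"
    then have "set (coeffs p) \<subseteq> {0..<n}" by (auto simp: coeffs_def)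
    moreover have "length (coeffs p) \<le> Suc D" using p by (cases "p = 0") (auto simp: length_coeffs_degree)
    ultimately show "p \<in> Poly ` ?L" by (intro image_eqI[of _ _ "coeffs p"]) auto
  qed
qed

lemma monic_division:
  fixes k m :: "int poly"
  assumes "lead_coeff m = 1" shows "\<exists>q r. k = q * m + r \<and> (\<forall>i\<ge>degree m. coeff r i = 0)"
proof -
  have m: "m \<noteq> 0" using assms by auto
  obtain q r where qr: "pseudo_divmod k m = (q, r)" by fastforce
  have "smult (coeff m (degree m) ^ (Suc (degree k) - degree m)) k = m * q + r" "r = 0 \<or> degree r < degree m"
    using pseudo_divmod[OF m qr] by auto
  moreover from this(2) have "coeff r i = 0" if "i \<ge> degree m" for i
    using that by (cases "r = 0") (auto intro!: coeff_eq_0)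
  ultimately show ?thesis using assms by (intro exI[of _ q] exI[of _ r]) (simp add: mult.commute)
qed

text \<open>Modulo \<open>Q\<close> the coefficient of each generator matters only modulo
  \<open>m\<close> and \<open>n\<close>: division by the monic \<open>m\<close> bounds its degree,
  and reduction modulo \<open>n\<close> bounds its coefficients.\<close>

lemma (in zt_module) finite_span_mod_subspace:
  assumes Q: "subspace Q" and "finite C" "n > 0" "lead_coeff m = 1"
    and "\<And>c. c \<in> C \<Longrightarrow> m *s c \<in> Q" "\<And>c. c \<in> C \<Longrightarrow> [:n:] *s c \<in> Q"
  shows "\<exists>F. finite F \<and> (\<forall>v\<in>span C. \<exists>f\<in>F. v - f \<in> Q)"
  using assms(2,5,6)
proof (induction C rule: finite_induct)
  case empty
  show ?case using subspace_0[OF Q] by (intro exI[of _ "{0}"]) auto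
next
  case (insert c C)
  then obtain F where F: "finite F" "\<And>v. v \<in> span C \<Longrightarrow> \<exists>f\<in>F. v - f \<in> Q" by (metis insertCI)
  define P where "P = {p :: int poly. degree p \<le> degree m \<and> (\<forall>i. coeff p i \<in> {0..<n})}"
  define F' where "F' = (\<lambda>(f, p). f + p *s c) ` (F \<times> P)"
  have "finite F'" using F(1) finite_bounded_polys unfolding F'_def P_def by (intro finite_imageI finite_cartesian_product)
  moreover have "\<exists>f\<in>F'. v - f \<in> Q" if "v \<in> span (insert c C)" for v
  proof -
    obtain k where k: "v - k *s c \<in> span C" using \<open>v \<in> span (insert c C)\<close> unfolding span_insert_iff by blast
    then obtain f where f: "f \<in> F" "v - k *s c - f \<in> Q" using F(2) by blast
    obtain q r where qr: "k = q * m + r" "\<forall>i\<ge>degree m. coeff r i = 0"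
      using monic_division[OF assms(4), of k] by blast
    define r0 where "r0 = map_poly (\<lambda>x. x mod n) r"
    define r1 where "r1 = map_poly (\<lambda>x. x div n) r"
    have r: "r = r1 * [:n:] + r0"
      by (rule poly_eqI) (simp add: r0_def r1_def coeff_map_poly)
    have "degree r0 \<le> degree m" unfolding r0_def using qr(2)
      by (intro degree_le) (auto simp: coeff_map_poly coeff_eq_0)
    then have "r0 \<in> P" using assms(3) by (auto simp: P_def r0_def coeff_map_poly)
    then have "f + r0 *s c \<in> F'" unfolding F'_def using f(1) by (intro image_eqI[of _ _ "(f, r0)"]) auto
    moreover have "v - (f + r0 *s c) = (v - k *s c - f) + (q *s (m *s c) + r1 *s ([:n:] *s c))"
      unfolding qr(1) r by (simp only: scale_left_distrib scale_scale) (simp add: algebra_simps)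
    moreover have "\<dots> \<in> Q"
      by (rule subspace_add[OF Q f(2) subspace_add[OF Q subspace_scale[OF Q] subspace_scale[OF Q]]])
        (rule insert.prems, simp)+
    ultimately show ?thesis by metis
  qed
  ultimately show ?case by blast
qed

text \<open>While the leading coefficient is divisible by \<open>p\<close>, the leading term lies in
  \<open>K\<close> and can be removed; this ends because \<open>p\<close> does not divide
  \<open>a\<close>. A leading coefficient prime to \<open>p\<close> becomes 1 by a Bezout identity,
  again up to multiples of \<open>p\<close>, which lie in \<open>K\<close>.\<close>

lemma monic_mod_prime:
  fixes p :: int
  assumes K: "ring.subspace K" and p: "normalization_semidom_class.prime p" and pK: "\<And>v. [:p:] * v \<in> K"
  shows "a \<in> K \<Longrightarrow> \<not> [:p:] dvd a \<Longrightarrow> \<exists>m\<in>K. lead_coeff m = 1"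
proof (induction "degree a" arbitrary: a rule: less_induct)
  case less
  let ?d = "degree a" and ?c = "lead_coeff a"
  show ?case
  proof (cases "p dvd ?c")
    case False
    then have "coprime p ?c" using p by (metis prime_imp_coprime)
    then obtain u v where uv: "u * ?c + v * p = 1" using bezout_int[of ?c p] by (metis coprime_iff_gcd_eq_1 gcd.commute)
    let ?m = "[:u:] * a + [:p:] * monom v ?d"
    have "degree ?m \<le> ?d"
      by (rule degree_add_le) (use degree_smult_le[of u a] degree_smult_le[of p "monom v ?d"] degree_monom_le[of v ?d] in auto)
    moreover have "coeff ?m ?d = 1" using uv by (simp add: mult.commute)
    ultimately have "lead_coeff ?m = 1" by (metis coeff_eq_0 le_neq_implies_less zero_neq_one)
    moreover have "?m \<in> K" by (intro ring.subspace_add[OF K] ring.subspace_scale[OF K] less.prems pK)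
    ultimately show ?thesis by blast
  next
    case True
    then obtain e where e: "?c = p * e" by (elim dvdE)
    let ?b = "a - [:p:] * monom e ?d"
    have bK: "?b \<in> K" by (intro ring.subspace_diff[OF K] less.prems pK)
    have nb: "\<not> [:p:] dvd ?b" using less.prems(2) by (metis diff_add_cancel dvd_add dvd_triv_left)
    then have "?b \<noteq> 0" by auto
    have "degree ?b \<le> ?d"
      by (rule degree_diff_le) (use degree_smult_le[of p "monom e ?d"] degree_monom_le[of e ?d] in auto)
    moreover have "coeff ?b ?d = 0" using e by simp
    ultimately have "degree ?b < ?d" using \<open>?b \<noteq> 0\<close> by (metis leading_coeff_0_iff order_le_less)
    from less.hyps[OF this bK nb] show ?thesis .
  qed
qed

text \<open>An ideal without common divisors that contains a nonzero constant has finite index: factor the constant into primes.\<close>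

lemma idx_ideal_nonzero:
  assumes "ring.subspace J" "[:c:] \<in> J" "c \<noteq> 0" "\<And>d. (\<And>a. a \<in> J \<Longrightarrow> d dvd a) \<Longrightarrow> is_unit d"
  shows "idx UNIV J \<noteq> 0"
  using assms
proof (induction "nat \<bar>c\<bar>" arbitrary: c J rule: less_induct)
  case less
  note J = less.prems(1)
  show ?case
  proof (cases "is_unit c")
    case True
    then obtain u where "1 = c * u" by (elim dvdE)
    then have "[:u:] * [:c:] = 1" by (simp add: mult.commute one_pCons)
    then have "1 \<in> J" using ring.subspace_scale[OF J less.prems(2)] by metis
    then have "J = UNIV" by (rule ideal_UNIV[OF J])
    then show ?thesis using idx_self[OF sgrp_UNIV, where ?'a = "int poly"] by (simp only: one_neq_zero not_False_eq_True)
  next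
    case False
    then obtain p where p: "normalization_semidom_class.prime p" "p dvd c" using prime_divisor_exists[of c] less.prems(3) by blast
    then obtain e where e: "c = p * e" by (elim dvdE)
    have "p > 1" using p(1) by (simp add: prime_gt_1_int)
    \<comment> \<open>Multiplication by \<open>p\<close> shows that the index of \<open>J\<close> is
      that of the colon ideal \<open>Jp\<close> times that of the ideal \<open>K\<close> below,
      generated by \<open>p\<close> and \<open>J\<close>. The first contains the smaller constant
      \<open>e\<close>; the second contains \<open>p\<close> and a monic polynomial, because
      \<open>p\<close> does not divide all of \<open>J\<close>.\<close>
    define Jp where "Jp = {a. [:p:] * a \<in> J}"
    have Jp: "ring.subspace Jp"
      unfolding ring.subspace_def Jp_def
    proof (intro conjI ballI allI)
      show "0 \<in> {a. [:p:] * a \<in> J}" using ring.subspace_0[OF J] by simp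
      show "x + y \<in> {a. [:p:] * a \<in> J}" if "x \<in> {a. [:p:] * a \<in> J}" "y \<in> {a. [:p:] * a \<in> J}" for x y
        using that ring.subspace_add[OF J] unfolding mem_Collect_eq distrib_left by blast
      show "k * x \<in> {a. [:p:] * a \<in> J}" if "x \<in> {a. [:p:] * a \<in> J}" for k x
        using ring.subspace_scale[OF J, of "[:p:] * x" k] that unfolding mem_Collect_eq mult.left_commute[of "[:p:]" k x] by blast
    qed
    have JJp: "J \<subseteq> Jp" unfolding Jp_def using ring.subspace_scale[OF J] by blast
    have "idx UNIV Jp \<noteq> 0"
    proof (rule less.hyps[of e])
      have "\<bar>c\<bar> = p * \<bar>e\<bar>" using e \<open>p > 1\<close> by (simp add: abs_mult)
      moreover have "\<bar>e\<bar> > 0" using e less.prems(3) by auto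
      ultimately show "nat \<bar>e\<bar> < nat \<bar>c\<bar>" using \<open>p > 1\<close> by (simp add: nat_less_iff)
      show "[:e:] \<in> Jp" using less.prems(2) by (simp add: Jp_def e)
      show "e \<noteq> 0" using e less.prems(3) by auto
      show "is_unit d" if "\<And>a. a \<in> Jp \<Longrightarrow> d dvd a" for d
        using that JJp by (intro less.prems(4)) auto
    qed (rule Jp)
    define R where "R = range ((*) [:p:])"
    have R: "ring.subspace R" unfolding R_def by (rule ring.subspace_scale_image) simp
    define K where "K = R + J"
    have K: "ring.subspace K" unfolding K_def by (rule ring.subspace_set_plus[OF R J])
    note sg = ring.subspace_sgrp[OF J] ring.subspace_sgrp[OF R] ring.subspace_sgrp[OF K] ring.subspace_sgrp[OF Jp]
    have RK: "R \<subseteq> K" and JK: "J \<subseteq> K" unfolding K_def using sg set_plus_left_subset set_plus_right_subset by blast+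
    have pK: "[:p:] * v \<in> K" for v using RK unfolding R_def by blast
    have "\<not> is_unit [:p:]" using \<open>p > 1\<close> by (metis const_poly_dvd_const_poly_iff one_pCons p(1) not_prime_unit)
    then obtain a where a: "a \<in> J" "\<not> [:p:] dvd a" using less.prems(4) by blast
    then have "a \<in> K" using JK by blast
    then obtain m where m: "m \<in> K" "lead_coeff m = 1" using monic_mod_prime[OF K p(1) pK] a(2) by metis
    obtain F where F: "finite F" "\<And>v. v \<in> ring.span {1} \<Longrightarrow> \<exists>f\<in>F. v - f \<in> K"
      using ring.finite_span_mod_subspace[OF K, of "{1}" p m] m pK[of 1] \<open>p > 1\<close> by auto
    have "idx UNIV K \<noteq> 0"
    proof (rule idx_nonzeroI[OF sgrp_UNIV sg(3) F(1)])
      fix v :: "int poly"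
      have "v \<in> ring.span {1}" unfolding ring_span_single by (intro image_eqI[of _ _ v]) auto
      then show "\<exists>f\<in>F. v - f \<in> K" by (rule F(2))
    qed
    moreover have "idx K J = idx UNIV Jp"
    proof -
      have "idx K J = idx R (R \<inter> J)" unfolding K_def by (rule idx_set_plus[OF sg(2,1)])
      also have "\<dots> = idx UNIV Jp"
      proof (rule sym, rule idx_eqI[OF sg(4) sgrp_Int[OF sg(2,1)], of _ "\<lambda>a. [:p:] * a"])
        show "[:p:] * a \<in> R" for a unfolding R_def by blast
        have "[:p:] * a - [:p:] * b = [:p:] * (a - b)" for a b by (rule right_diff_distrib[symmetric])
        then show "([:p:] * a - [:p:] * b \<in> R \<inter> J) = (a - b \<in> Jp)" for a b unfolding Jp_def R_def by simp
        show "\<exists>a\<in>UNIV. y - [:p:] * a \<in> R \<inter> J" if "y \<in> R" for y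
        proof -
          obtain a where "y = [:p:] * a" using \<open>y \<in> R\<close> unfolding R_def by blast
          then show ?thesis using sgrpD(1)[OF sgrp_Int[OF sg(2,1)]] by (intro bexI[of _ a]) auto
        qed
      qed
      finally show ?thesis .
    qed
    ultimately show ?thesis using idx_tower[OF sgrp_UNIV sg(3,1) JK] \<open>idx UNIV Jp \<noteq> 0\<close> by simp
  qed
qed

section \<open>Orders of finite quotients as resultants\<close>

text \<open>Residues modulo \<open>d\<close> classify the cosets. For \<open>d = 0\<close> the index
  is infinite, and both sides are 0.\<close>

lemma idx_int: assumes "d \<ge> 0" shows "idx (UNIV :: int set) (range ((*) d)) = nat d"
proof -
  have sg: "sgrp (range ((*) d))"
    unfolding sgrp_def by (auto simp: right_diff_distrib[symmetric])
  have "idx (UNIV :: int set) (range ((*) d)) = card (range (\<lambda>a. a mod d))"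
    unfolding idx_def
  proof (rule card_image_eq_if_same_kernel)
    fix a b :: int
    have "a - b \<in> range ((*) d) \<longleftrightarrow> d dvd a - b" by (auto simp: dvd_def)
    then show "coset (range ((*) d)) a = coset (range ((*) d)) b \<longleftrightarrow> a mod d = b mod d"
      by (simp add: coset_eq_iff[OF sg] mod_eq_dvd_iff)
  qed
  also have "\<dots> = nat d"
  proof (cases "d = 0")
    case False
    then have "range (\<lambda>a. a mod d) = {0..<d}"
      using assms by (auto simp: image_iff) (metis mod_pos_pos_trivial)
    then show ?thesis by simp
  qed (simp add: infinite_UNIV_int)
  finally show ?thesis .
qed

lemma mat_mult_mat:
  "mat n n (\<lambda>(i, j). f i j) * mat n n (\<lambda>(i, j). g i j) = mat n n (\<lambda>(i, j). \<Sum>k<n. f i k * (g k j :: 'a :: comm_semiring_0))"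
  by (rule eq_matI) (auto simp: scalar_prod_def atLeast0LessThan)

text \<open>Phrased by coefficients so that the zero polynomial lies in \<open>deg_less 0\<close>,
  where \<open>degree p < n\<close> would exclude it.\<close>

definition deg_less :: "nat \<Rightarrow> int poly set" where
  "deg_less n = {p. \<forall>k\<ge>n. coeff p k = 0}"

lemma sgrp_deg_less: "sgrp (deg_less n)" by (auto simp: sgrp_def deg_less_def)

lemma deg_less_mono: "deg_less n \<subseteq> deg_less (Suc n)" by (auto simp: deg_less_def)

text \<open>An ideal is described in each degree by the minimal leading coefficient of its elements of that degree.\<close>

lemma idx_deg_less:
  assumes J: "ring.subspace J"
  shows "\<exists>P. (\<forall>i. P i \<in> deg_less (Suc i) \<inter> J \<and> coeff (P i) i \<ge> 0 \<and> (\<forall>p\<in>deg_less (Suc i) \<inter> J. coeff (P i) i dvd coeff p i))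
    \<and> (\<forall>n. idx (deg_less n) (deg_less n \<inter> J) = (\<Prod>i<n. nat (coeff (P i) i)))"
proof -
  note sJ = ring.subspace_sgrp[OF J]
  note sR = sgrp_deg_less
  define Jn where "Jn n = deg_less n \<inter> J" for n
  have sJn: "sgrp (Jn n)" for n unfolding Jn_def by (rule sgrp_Int[OF sR sJ])
  have "\<exists>p. p \<in> Jn (Suc i) \<and> coeff p i \<ge> 0 \<and> (\<forall>q\<in>Jn (Suc i). coeff p i dvd coeff q i)" for i
  proof -
    have "sgrp ((\<lambda>p. coeff p i) ` Jn (Suc i))"
      unfolding sgrp_def
    proof (intro conjI ballI)
      show "0 \<in> (\<lambda>p. coeff p i) ` Jn (Suc i)" using sgrpD(1)[OF sJn] by (intro image_eqI[of _ _ 0]) auto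
      fix a b assume "a \<in> (\<lambda>p. coeff p i) ` Jn (Suc i)" "b \<in> (\<lambda>p. coeff p i) ` Jn (Suc i)"
      then obtain x y where "x \<in> Jn (Suc i)" "y \<in> Jn (Suc i)" "a = coeff x i" "b = coeff y i" by blast
      then show "a - b \<in> (\<lambda>p. coeff p i) ` Jn (Suc i)"
        using sgrpD(2)[OF sJn] by (intro image_eqI[of _ _ "x - y"]) auto
    qed
    from sgrp_int_principal[OF this] show ?thesis by blast
  qed
  then have "\<exists>P. \<forall>i. P i \<in> Jn (Suc i) \<and> coeff (P i) i \<ge> 0 \<and> (\<forall>q\<in>Jn (Suc i). coeff (P i) i dvd coeff q i)"
    by (intro choice allI)
  then obtain P where P0: "\<forall>i. P i \<in> Jn (Suc i) \<and> coeff (P i) i \<ge> 0 \<and> (\<forall>q\<in>Jn (Suc i). coeff (P i) i dvd coeff q i)" ..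
  then have P: "\<And>i. P i \<in> Jn (Suc i)" "\<And>i. coeff (P i) i \<ge> 0" "\<And>i q. q \<in> Jn (Suc i) \<Longrightarrow> coeff (P i) i dvd coeff q i"
    by auto
  have "idx (deg_less n) (Jn n) = (\<Prod>i<n. nat (coeff (P i) i))" for n
  proof (induction n)
    case 0
    have "p = 0" if "p \<in> deg_less 0" for p using that by (auto simp: deg_less_def poly_eq_iff)
    then have "deg_less 0 = {0}" using sgrpD(1)[OF sR] by blast
    moreover have "Jn 0 = {0}" using calculation sgrpD(1)[OF sJ] by (auto simp: Jn_def)
    ultimately show ?case using idx_self[OF sR, of 0] by simp
  next
    case (Suc n)
    let ?K = "deg_less n + Jn (Suc n)"
    have sK: "sgrp ?K" by (rule sgrp_set_plus[OF sR sJn])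
    have "idx (deg_less (Suc n)) (Jn (Suc n)) = idx (deg_less (Suc n)) ?K * idx ?K (Jn (Suc n))"
    proof (rule idx_tower[OF sR sK sJn])
      show "Jn (Suc n) \<subseteq> ?K" by (rule set_plus_right_subset[OF sR])
      show "?K \<subseteq> deg_less (Suc n)"
        by (rule set_plus_subset_sgrp[OF sR deg_less_mono]) (simp add: Jn_def)
    qed
    also have "idx ?K (Jn (Suc n)) = idx (deg_less n) (deg_less n \<inter> Jn (Suc n))"
      by (rule idx_set_plus[OF sR sJn])
    also have "deg_less n \<inter> Jn (Suc n) = Jn n" using deg_less_mono[of n] by (auto simp: Jn_def)
    \<comment> \<open>The coefficient of \<open>t ^ n\<close> identifies the top layer with the
      integers modulo the generator \<open>coeff (P n) n\<close>; a generator 0 gives an infinite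
      layer, in accordance with the value 0.\<close>
    also have "idx (deg_less (Suc n)) ?K = idx (UNIV :: int set) (range ((*) (coeff (P n) n)))"
    proof (rule idx_eqI[of _ _ _ "\<lambda>p. coeff p n"])
      let ?d = "coeff (P n) n"
      show "sgrp (range ((*) ?d))" unfolding sgrp_def by (auto simp: right_diff_distrib[symmetric])
      show "\<exists>a\<in>deg_less (Suc n). y - coeff a n \<in> range ((*) ?d)" for y
        by (intro bexI[of _ "monom y n"]) (auto simp: deg_less_def intro: image_eqI[of _ _ 0])
      fix a b assume ab: "a \<in> deg_less (Suc n)" "b \<in> deg_less (Suc n)"
      show "coeff a n - coeff b n \<in> range ((*) ?d) \<longleftrightarrow> a - b \<in> ?K"
      proof
        assume "coeff a n - coeff b n \<in> range ((*) ?d)"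
        then obtain k where k: "coeff a n - coeff b n = ?d * k" by blast
        have kP: "[:k:] * P n \<in> Jn (Suc n)"
          using P(1)[of n] ring.subspace_scale[OF J, of "P n" "[:k:]"] by (auto simp: Jn_def deg_less_def)
        have "coeff (a - b - [:k:] * P n) i = 0" if "i \<ge> n" for i
          using that k ab kP by (cases "i = n") (auto simp: deg_less_def Jn_def)
        then have "a - b - [:k:] * P n \<in> deg_less n" by (simp add: deg_less_def)
        then show "a - b \<in> ?K" using kP unfolding mem_set_plus_iff by blast
      next
        assume "a - b \<in> ?K"
        then obtain c where c: "c \<in> Jn (Suc n)" "a - b - c \<in> deg_less n" unfolding mem_set_plus_iff by blast
        then have "coeff a n - coeff b n = coeff c n" by (simp add: deg_less_def)
        then show "coeff a n - coeff b n \<in> range ((*) ?d)" using P(3)[OF c(1)] by (auto simp: dvd_def)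
      qed
    qed (rule sK UNIV_I)+
    also have "\<dots> = nat (coeff (P n) n)" by (rule idx_int[OF P(2)])
    finally show ?case using Suc by (simp add: mult.commute)
  qed
  then show ?thesis using P unfolding Jn_def by (intro exI[of _ P]) simp
qed

abbreviation cpoly :: "int poly \<Rightarrow> complex poly" where
  "cpoly \<equiv> map_poly of_int"

lemma coeff_cpoly: "coeff (cpoly p) i = of_int (coeff p i)"
  by (simp add: coeff_map_poly)

lemma cpoly_mult: "cpoly (p * q) = cpoly p * cpoly q"
  by (rule poly_eqI) (simp add: coeff_cpoly coeff_mult)

lemma cpoly_add: "cpoly (p + q) = cpoly p + cpoly q"
  by (rule poly_eqI) (simp add: coeff_cpoly)

lemma cpoly_diff: "cpoly (p - q) = cpoly p - cpoly q"
  by (rule poly_eqI) (simp add: coeff_cpoly)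

lemma degree_cpoly: "degree (cpoly p) = degree p"
  by (rule degree_map_poly) simp

lemma poly_cpoly_deg_less:
  assumes "p \<in> deg_less n" shows "poly (cpoly p) z = (\<Sum>k<n. of_int (coeff p k) * z ^ k)"
proof -
  have "poly (cpoly p) z = (\<Sum>k\<le>degree p. of_int (coeff p k) * z ^ k)"
    by (simp add: poly_altdef coeff_cpoly degree_cpoly)
  also have "\<dots> = (\<Sum>k<n + Suc (degree p). of_int (coeff p k) * z ^ k)"
    by (intro sum.mono_neutral_left) (auto simp: coeff_eq_0)
  also have "\<dots> = (\<Sum>k<n. of_int (coeff p k) * z ^ k)"
    using assms by (intro sum.mono_neutral_right) (auto simp: deg_less_def)
  finally show ?thesis .
qed

text \<open>A vector in the kernel of the transpose would be the coefficient list of a polynomial of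
  degree below \<open>n\<close> with \<open>n\<close> distinct roots.\<close>

lemma vandermonde_det_nonzero:
  assumes "inj_on z {..<n}" shows "det (mat n n (\<lambda>(k, j). z j ^ k)) \<noteq> (0 :: complex)"
proof
  let ?V = "mat n n (\<lambda>(k, j). z j ^ k)"
  have V: "?V \<in> carrier_mat n n" by simp
  assume "det ?V = 0"
  then have "det (transpose_mat ?V) = 0" using det_transpose[OF V] by simp
  then obtain v where v: "v \<in> carrier_vec n" "v \<noteq> 0\<^sub>v n" "transpose_mat ?V *\<^sub>v v = 0\<^sub>v n"
    using det_0_iff_vec_prod_zero[of "transpose_mat ?V" n] by auto
  define p where "p = (\<Sum>k<n. monom (v $ k) k)"
  have cp: "coeff p k = (if k < n then v $ k else 0)" for k
    unfolding p_def by (simp add: coeff_sum)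
  have "poly p (z j) = 0" if j: "j < n" for j
  proof -
    have "(transpose_mat ?V *\<^sub>v v) $ j = (\<Sum>k<n. z j ^ k * v $ k)"
      using j v(1) by (simp add: scalar_prod_def atLeast0LessThan)
    then have "(\<Sum>k<n. z j ^ k * v $ k) = 0" using v(3) j by simp
    then show ?thesis unfolding p_def by (simp add: poly_sum poly_monom mult.commute)
  qed
  then have roots: "z ` {..<n} \<subseteq> {x. poly p x = 0}" by blast
  have "p = 0"
  proof (rule ccontr)
    assume p: "p \<noteq> 0"
    then have "n \<noteq> 0" unfolding p_def by (metis lessThan_0 sum.empty)
    have "degree p \<le> n - 1" using cp by (intro degree_le) auto
    moreover have "card (z ` {..<n}) \<le> card {x. poly p x = 0}"
      by (intro card_mono roots poly_roots_finite p)
    then have "n \<le> degree p" using card_poly_roots_bound[OF p] card_image[OF assms] by simp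
    ultimately show False using \<open>n \<noteq> 0\<close> by simp
  qed
  then have "v $ k = 0" if "k < n" for k using cp[of k] that by simp
  then have "v = 0\<^sub>v n" using v(1) by (intro eq_vecI) auto
  then show False using v(2) by simp
qed

text \<open>
  The order of \<open>\<int>[t]/(g, q)\<close> for monic \<open>q\<close> is the absolute value of the determinant of
  multiplication by \<open>g\<close> on the lattice \<open>\<int>[t]/(q)\<close>, which the Vandermonde matrix of the roots
  of \<open>q\<close> diagonalises.
\<close>

lemma idx_eq_norm_prod_roots:
  fixes g q :: "int poly"
  assumes q: "lead_coeff q = 1" and sf: "rsquarefree (cpoly q)"
    and nz: "\<And>z. poly (cpoly q) z = 0 \<Longrightarrow> poly (cpoly g) z \<noteq> 0"
  shows "real (idx UNIV (ring.span {g, q})) = cmod (\<Prod>z | poly (cpoly q) z = 0. poly (cpoly g) z)"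
proof -
  let ?Z = "{z. poly (cpoly q) z = 0}"
  define n where "n = degree q"
  define J where "J = ring.span {g, q}"
  have J: "ring.subspace J" unfolding J_def by (rule ring.subspace_span)
  have gJ: "g \<in> J" and qJ: "q \<in> J" unfolding J_def by (auto intro: ring.span_base)
  have q0: "q \<noteq> 0" using q by auto
  then have cq0: "cpoly q \<noteq> 0" by (metis degree_cpoly coeff_cpoly coeff_0 of_int_1 q one_neq_zero)
  have finZ: "finite ?Z" by (rule poly_roots_finite[OF cq0])
  have "cpoly q = (\<Prod>z\<in>?Z. [:-z, 1:])"
    using complex_poly_decompose_rsquarefree[OF sf] by (simp add: coeff_cpoly degree_cpoly q)
  moreover have "degree (\<Prod>z\<in>?Z. [:-z, 1:]) = (\<Sum>z\<in>?Z. degree [:-z, 1:])"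
    by (rule degree_prod_sum_eq) auto
  ultimately have "degree (cpoly q) = (\<Sum>z\<in>?Z. degree [:-z, 1:])" by (simp only:)
  then have cardZ: "card ?Z = n" by (simp add: degree_cpoly n_def)
  obtain z where "bij_betw z {0..<n} ?Z" using ex_bij_betw_nat_finite[OF finZ] unfolding cardZ by blast
  then have z: "bij_betw z {..<n} ?Z" by (simp add: atLeast0LessThan)
  have zq: "poly (cpoly q) (z j) = 0" if "j < n" for j using bij_betwE[OF z] that by blast
  obtain P where P0: "\<forall>i. P i \<in> deg_less (Suc i) \<inter> J \<and> coeff (P i) i \<ge> 0 \<and> (\<forall>p\<in>deg_less (Suc i) \<inter> J. coeff (P i) i dvd coeff p i)"
    and P5: "\<forall>n. idx (deg_less n) (deg_less n \<inter> J) = (\<Prod>i<n. nat (coeff (P i) i))"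
    using idx_deg_less[OF J] by (elim exE conjE)
  then have P: "\<And>i. P i \<in> J" "\<And>i. P i \<in> deg_less (Suc i)" "\<And>i. coeff (P i) i \<ge> 0"
      "\<And>i p. p \<in> J \<Longrightarrow> p \<in> deg_less (Suc i) \<Longrightarrow> coeff (P i) i dvd coeff p i"
    by auto
  note sJ = ring.subspace_sgrp[OF J] and sR = sgrp_deg_less[of n]
  have "(UNIV :: int poly set) = deg_less n + J"
  proof -
    have "k \<in> deg_less n + J" for k
    proof -
      obtain x r where "k = x * q + r" "\<forall>i\<ge>degree q. coeff r i = 0" using monic_division[OF q, of k] by blast
      then show ?thesis unfolding mem_set_plus_iff using ring.subspace_scale[OF J qJ, of x]
        by (intro bexI[of _ "x * q"]) (auto simp: deg_less_def n_def)
    qed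
    then show ?thesis by blast
  qed
  then have "idx UNIV J = idx (deg_less n) (deg_less n \<inter> J)"
    using idx_set_plus[OF sR sJ] by simp
  then have idxJ: "idx UNIV J = (\<Prod>i<n. nat (coeff (P i) i))" using P5 by simp
  \<comment> \<open>\<open>a i\<close> is the remainder of \<open>t ^ i * g\<close> modulo
    \<open>q\<close>, that is, row \<open>i\<close> of the matrix of multiplication by
    \<open>g\<close>.\<close>
  have "\<exists>a w. monom 1 i * g = w * q + a \<and> a \<in> deg_less n" for i
    using monic_division[OF q, of "monom 1 i * g"] unfolding deg_less_def n_def by blast
  then obtain a w where a: "\<And>i. monom 1 i * g = w i * q + a i" "\<And>i. a i \<in> deg_less n" by metis
  have aJ: "a i \<in> J" for i
    using ring.subspace_diff[OF J ring.subspace_scale[OF J gJ, of "monom 1 i"] ring.subspace_scale[OF J qJ, of "w i"]] a(1)[of i] by simp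
  have Pn: "P i \<in> deg_less n" if "i < n" for i using P(2)[of i] that by (auto simp: deg_less_def)
  \<comment> \<open>The \<open>P j\<close> generate the elements of \<open>J\<close> of bounded
    degree triangularly: leading coefficients are removed one degree at a time.\<close>
  have "\<exists>b. p = (\<Sum>j<m. [:b j:] * P j)" if "p \<in> J" "p \<in> deg_less m" for p m
    using that
  proof (induction m arbitrary: p)
    case 0 then show ?case by (auto simp: deg_less_def poly_eq_iff)
  next
    case (Suc m)
    obtain k where k: "coeff p m = coeff (P m) m * k" using P(4)[OF Suc.prems] by (elim dvdE)
    have "p - [:k:] * P m \<in> J" by (intro ring.subspace_diff[OF J] ring.subspace_scale[OF J] P Suc.prems)
    moreover have "coeff (p - [:k:] * P m) i = 0" if "i \<ge> m" for i
      using that k Suc.prems(2) P(2)[of m] by (cases "i = m") (auto simp: deg_less_def)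
    then have "p - [:k:] * P m \<in> deg_less m" by (simp add: deg_less_def)
    ultimately obtain b where b: "p - [:k:] * P m = (\<Sum>j<m. [:b j:] * P j)" using Suc.IH by blast
    have "p = (\<Sum>j<Suc m. [:(b(m := k)) j:] * P j)" using b by (simp add: diff_eq_eq)
    then show ?case by blast
  qed
  then have "\<exists>b. a i = (\<Sum>j<n. [:b j:] * P j)" for i using aJ a(2) by blast
  then obtain b where b: "\<And>i. a i = (\<Sum>j<n. [:b i j:] * P j)" by metis
  \<comment> \<open>Conversely the remainders \<open>a j\<close> generate the \<open>P i\<close>.
    The multiplier of \<open>g\<close> is reduced modulo \<open>q\<close>; what is left over is a
    multiple \<open>h * q\<close> of degree below \<open>n\<close>, hence zero.\<close>
  have "\<exists>c. P i = (\<Sum>j<n. [:c j:] * a j)" if i: "i < n" for i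
  proof -
    obtain x y where xy: "P i = x * g + y * q" using P(1)[of i] unfolding J_def ring_span_pair by blast
    obtain u r where r: "x = u * q + r" "\<forall>i\<ge>degree q. coeff r i = 0" using monic_division[OF q, of x] by blast
    have "r = (\<Sum>k<n. monom (coeff r k) k)"
      by (rule poly_eqI) (use r(2) in \<open>auto simp: coeff_sum n_def not_less\<close>)
    also have "\<dots> = (\<Sum>k<n. [:coeff r k:] * monom 1 k)" by (simp add: smult_monom)
    finally have "r * g = (\<Sum>k<n. [:coeff r k:] * (monom 1 k * g))"
      by (metis (no_types, lifting) sum_distrib_right mult.assoc sum.cong)
    also have "\<dots> = (\<Sum>k<n. [:coeff r k:] * w k) * q + (\<Sum>k<n. [:coeff r k:] * a k)"
      unfolding a(1) by (simp only: distrib_left sum.distrib sum_distrib_right mult.assoc)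
    finally have rg: "r * g = (\<Sum>k<n. [:coeff r k:] * w k) * q + (\<Sum>k<n. [:coeff r k:] * a k)" .
    define s where "s = (\<Sum>k<n. [:coeff r k:] * a k)"
    define h where "h = u * g + (\<Sum>k<n. [:coeff r k:] * w k) + y"
    have "(u * q + r) * g + y * q - s = (u * g + S + y) * q" if "r * g = S * q + s" for S
    proof -
      have "(u * q + r) * g + y * q - s = (u * q) * g + r * g + y * q - s" by (simp only: distrib_right)
      also have "\<dots> = (u * q) * g + (S * q + s) + y * q - s" by (simp only: that)
      also have "\<dots> = (u * q) * g + S * q + y * q" by simp
      also have "(u * q) * g = (u * g) * q" by (simp only: mult.assoc mult.commute[of q g])
      also have "(u * g) * q + S * q + y * q = (u * g + S + y) * q" by (simp only: distrib_right)
      finally show ?thesis .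
    qed
    from this[OF rg[folded s_def]] have Ph: "P i - s = h * q" unfolding xy r(1) h_def .
    have "s \<in> deg_less n" unfolding s_def deg_less_def using a(2) by (auto simp: coeff_sum deg_less_def intro!: sum.neutral)
    then have "h * q \<in> deg_less n" unfolding Ph[symmetric] using sgrpD(2)[OF sR Pn[OF i]] by blast
    moreover have "coeff (h * q) (degree h + n) = lead_coeff h" unfolding n_def coeff_mult_degree_sum using q by simp
    ultimately have "h = 0" by (simp add: deg_less_def)
    then show ?thesis using Ph unfolding s_def by (intro exI[of _ "coeff r"]) simp
  qed
  then obtain c where c: "\<And>i. i < n \<Longrightarrow> P i = (\<Sum>j<n. [:c i j:] * a j)" by metis
  \<comment> \<open>The rows of \<open>A\<close> and of the triangular matrix \<open>G\<close>
    generate the same lattice. Integral base changes \<open>B\<close> and \<open>C\<close> in both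
    directions make their determinants agree up to sign, and \<open>det G\<close> is the
    index.\<close>
  define A where "A = mat n n (\<lambda>(i, k). coeff (a i) k)"
  define G where "G = mat n n (\<lambda>(i, k). coeff (P i) k)"
  define B where "B = mat n n (\<lambda>(i, k). b i k)"
  define C where "C = mat n n (\<lambda>(i, k). c i k)"
  have carr: "A \<in> carrier_mat n n" "G \<in> carrier_mat n n" "B \<in> carrier_mat n n" "C \<in> carrier_mat n n"
    by (simp_all add: A_def G_def B_def C_def)
  have "A = B * G" unfolding A_def B_def G_def mat_mult_mat
    by (rule eq_matI) (auto simp: b coeff_sum)
  then have AB: "det A = det B * det G" using det_mult carr by blast
  have "G = C * A" unfolding A_def C_def G_def mat_mult_mat
    by (rule eq_matI) (auto simp: c coeff_sum)
  then have GC: "det G = det C * det A" using det_mult carr by blast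
  have "det G = prod_list (diag_mat G)"
    by (rule det_lower_triangular[OF _ carr(2)]) (use P(2) in \<open>auto simp: G_def deg_less_def\<close>)
  also have "\<dots> = (\<Prod>i<n. coeff (P i) i)" by (simp add: prod_list_diag_prod G_def atLeast0LessThan)
  finally have detG: "det G = (\<Prod>i<n. coeff (P i) i)" .
  let ?A = "map_mat complex_of_int A"
  let ?V = "mat n n (\<lambda>(k, j). z j ^ k)"
  let ?D = "mat n n (\<lambda>(k, j). if k = j then poly (cpoly g) (z j) else 0)"
  have az: "poly (cpoly (a i)) (z j) = z j ^ i * poly (cpoly g) (z j)" if "j < n" for i j
  proof -
    have "cpoly (monom 1 i * g) = cpoly (w i) * cpoly q + cpoly (a i)" unfolding a(1) by (simp only: cpoly_add cpoly_mult)
    then have "poly (cpoly (monom 1 i)) (z j) * poly (cpoly g) (z j) = poly (cpoly (a i)) (z j)"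
      using zq[OF that] by (metis add_0 cpoly_mult mult_zero_right poly_add poly_mult)
    then show ?thesis by (simp add: map_poly_monom poly_monom)
  qed
  have "?A = mat n n (\<lambda>(i, k). of_int (coeff (a i) k))" unfolding A_def by (rule eq_matI) auto
  then have "?A * ?V = mat n n (\<lambda>(i, j). \<Sum>k<n. of_int (coeff (a i) k) * z j ^ k)" by (simp only: mat_mult_mat)
  also have "\<dots> = mat n n (\<lambda>(i, j). \<Sum>k<n. z k ^ i * (if k = j then poly (cpoly g) (z j) else 0))"
  proof (rule eq_matI)
    fix i j assume "i < dim_row (mat n n (\<lambda>(i, j). \<Sum>k<n. z k ^ i * (if k = j then poly (cpoly g) (z j) else 0)))"
      "j < dim_col (mat n n (\<lambda>(i, j). \<Sum>k<n. z k ^ i * (if k = j then poly (cpoly g) (z j) else 0)))"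
    then have ij: "i < n" "j < n" by auto
    have "(\<Sum>k<n. z k ^ i * (if k = j then poly (cpoly g) (z j) else 0)) = (\<Sum>k<n. if k = j then z k ^ i * poly (cpoly g) (z j) else 0)"
      by (rule sum.cong) auto
    also have "\<dots> = z j ^ i * poly (cpoly g) (z j)" using ij by simp
    also have "\<dots> = (\<Sum>k<n. of_int (coeff (a i) k) * z j ^ k)"
      using az[OF ij(2), of i] poly_cpoly_deg_less[OF a(2)[of i], of "z j"] by (simp only:)
    finally show "mat n n (\<lambda>(i, j). \<Sum>k<n. of_int (coeff (a i) k) * z j ^ k) $$ (i, j) =
      mat n n (\<lambda>(i, j). \<Sum>k<n. z k ^ i * (if k = j then poly (cpoly g) (z j) else 0)) $$ (i, j)" using ij by simp
  qed auto
  also have "\<dots> = ?V * ?D" by (rule mat_mult_mat[symmetric])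
  finally have "det (?A * ?V) = det (?V * ?D)" by (rule arg_cong)
  moreover have "det (?A * ?V) = det ?A * det ?V" by (rule det_mult[of _ n]) (use carr in auto)
  moreover have "det (?V * ?D) = det ?V * det ?D" by (rule det_mult[of _ n]) auto
  moreover have "det ?V \<noteq> 0" using z by (intro vandermonde_det_nonzero) (auto simp: bij_betw_def)
  ultimately have "det ?A = det ?D" by simp
  also have "det ?D = prod_list (diag_mat ?D)" by (rule det_lower_triangular[of n]) auto
  also have "\<dots> = (\<Prod>j<n. poly (cpoly g) (z j))" by (simp add: prod_list_diag_prod atLeast0LessThan)
  also have "\<dots> = (\<Prod>z\<in>?Z. poly (cpoly g) z)" by (rule prod.reindex_bij_betw[OF z])
  finally have detA: "complex_of_int (det A) = (\<Prod>z\<in>?Z. poly (cpoly g) z)" by (simp add: of_int_hom.hom_det)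
  also have "\<dots> \<noteq> 0" using nz finZ by auto
  finally have "det A \<noteq> 0" by auto
  then have "det B * det C = 1" using AB GC by (metis mult.assoc mult_cancel_right1 mult.commute)
  then have "\<bar>det B\<bar> = 1" by (metis abs_zmult_eq_1 abs_one)
  then have "\<bar>det A\<bar> = \<bar>det G\<bar>" using AB by (simp add: abs_mult)
  also have "\<dots> = (\<Prod>i<n. coeff (P i) i)" unfolding detG using P(3) by (simp add: prod_nonneg)
  also have "\<dots> = int (idx UNIV J)" unfolding idxJ using P(3) by simp
  finally have "real (idx UNIV J) = \<bar>real_of_int (det A)\<bar>" by linarith
  also have "\<dots> = cmod (complex_of_int (det A))" by simp
  finally show ?thesis unfolding J_def detA .
qed

lemma prod_prod_list_swap:
  fixes f :: "'a \<Rightarrow> 'b \<Rightarrow> 'c :: comm_monoid_mult"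
  shows "(\<Prod>z\<in>Z. \<Prod>a\<leftarrow>as. f z a) = (\<Prod>a\<leftarrow>as. \<Prod>z\<in>Z. f z a)"
  by (induction as) (auto simp: prod.distrib)

lemma poly_prod_list_linear: "poly (\<Prod>a\<leftarrow>as. [:-a, 1:]) z = (\<Prod>a\<leftarrow>as. z - (a :: complex))"
proof (induction as)
  case (Cons a as)
  have "poly [:-a, 1:] z = z - a" by simp
  then show ?case using Cons by (simp only: list.map prod_list.Cons poly_mult)
qed simp

lemma cpoly_nonzero: "p \<noteq> 0 \<Longrightarrow> cpoly p \<noteq> 0"
  by (metis coeff_cpoly coeff_0 leading_coeff_0_iff of_int_eq_0_iff)

lemma poly_cpoly_cnj: "poly (cpoly p) (cnj z) = cnj (poly (cpoly p) z)"
  by (simp add: poly_altdef coeff_cpoly degree_cpoly)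

lemma cpoly_t_pow_minus_1: "r \<ge> 1 \<Longrightarrow> poly (cpoly (t_pow_minus_1 r)) z = z ^ r - 1"
  by (simp add: cpoly_diff map_poly_monom poly_monom)

text \<open>By the Bezout identity a common root would be a root of a nonzero constant.\<close>

lemma coprime_no_common_root:
  assumes "coprime p q" "p \<noteq> (0 :: int poly)" "poly (cpoly p) z = 0" shows "poly (cpoly q) z \<noteq> 0"
proof
  assume z: "poly (cpoly q) z = 0"
  obtain c x y where c: "c \<noteq> 0" "[:c:] = x * p + y * q" by (rule int_poly_bezout[OF assms(1,2)])
  have "poly (cpoly [:c:]) z = poly (cpoly (x * p + y * q)) z" using c(2) by (simp only:)
  also have "\<dots> = 0" unfolding cpoly_add cpoly_mult poly_add poly_mult assms(3) z by simp
  finally show False using c(1) by (simp add: map_poly_pCons)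
qed

text \<open>
  The non-real roots of a real polynomial come in conjugate pairs, so the sign of the resultant is
  determined by the real roots.
\<close>

lemma sgn_prod_roots:
  assumes fin: "finite Z" and cnj: "\<And>z. z \<in> Z \<Longrightarrow> cnj z \<in> Z" and unit: "\<And>z. z \<in> Z \<Longrightarrow> norm z = 1"
    and nz: "\<And>z. z \<in> Z \<Longrightarrow> poly (cpoly g) z \<noteq> 0"
  shows "sgn (\<Prod>z\<in>Z. poly (cpoly g) z) = (\<Prod>z\<in>Z \<inter> {1, -1}. sgn (poly (cpoly g) z))"
proof -
  define h where "h z = sgn (poly (cpoly g) z)" for z
  define U where "U = {z \<in> Z. Im z > 0}"
  define L where "L = {z \<in> Z. Im z < 0}"
  \<comment> \<open>All points of \<open>Z\<close> lie on the unit circle, where only 1 and -1 are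
    real.\<close>
  have real: "z = 1 \<or> z = -1" if "z \<in> Z" "Im z = 0" for z
  proof -
    have "cmod z = \<bar>Re z\<bar>" using that(2) by (simp add: cmod_eq_Re)
    then have "\<bar>Re z\<bar> = 1" using unit[OF that(1)] by simp
    then show ?thesis using that(2) by (auto simp: complex_eq_iff abs_if split: if_splits)
  qed
  have "z \<in> (Z \<inter> {1, -1}) \<union> (U \<union> L)" if "z \<in> Z" for z
    using real[OF that] that by (cases "Im z" "0 :: real" rule: linorder_cases) (auto simp: U_def L_def)
  then have Z: "Z = (Z \<inter> {1, -1}) \<union> (U \<union> L)" by (auto simp: U_def L_def)
  have finU: "finite U" "finite L" using fin by (auto simp: U_def L_def)
  have disj: "(Z \<inter> {1, -1}) \<inter> (U \<union> L) = {}" "U \<inter> L = {}" by (auto simp: U_def L_def)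
  have "bij_betw cnj U L"
    by (rule bij_betwI[of _ _ _ cnj]) (auto simp: U_def L_def cnj)
  then have "prod h L = (\<Prod>z\<in>U. h (cnj z))" by (rule prod.reindex_bij_betw[symmetric])
  then have "prod h U * prod h L = (\<Prod>z\<in>U. h z * h (cnj z))" by (simp add: prod.distrib)
  also have "\<dots> = 1"
  proof (rule prod.neutral, rule ballI)
    fix z assume "z \<in> U"
    then have nz': "poly (cpoly g) z \<noteq> 0" using nz by (simp add: U_def)
    \<comment> \<open>A conjugate pair contributes the squared modulus of a number of modulus
      1.\<close>
    have "h z * h (cnj z) = h z * cnj (h z)" by (simp add: h_def poly_cpoly_cnj sgn_eq)
    also have "\<dots> = of_real ((cmod (h z))\<^sup>2)" by (simp only: complex_norm_square)
    also have "\<dots> = 1" using nz' by (simp add: h_def norm_sgn)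
    finally show "h z * h (cnj z) = 1" .
  qed
  finally have UL: "prod h U * prod h L = 1" .
  have "sgn (\<Prod>z\<in>S. poly (cpoly g) z) = prod h S" for S
    unfolding h_def by (induction S rule: infinite_finite_induct) (auto simp: sgn_mult)
  then have "sgn (\<Prod>z\<in>Z. poly (cpoly g) z) = prod h Z" .
  also have "prod h Z = prod h (Z \<inter> {1, -1}) * prod h (U \<union> L)"
    using prod.union_disjoint[of "Z \<inter> {1, -1}" "U \<union> L" h] fin finU disj(1) Z by (metis finite_Int finite_UnI)
  also have "prod h (U \<union> L) = prod h U * prod h L" by (rule prod.union_disjoint[OF finU disj(2)])
  finally show ?thesis using UL by (simp add: h_def)
qed

text \<open>At a root of \<open>d\<close> the product rule replaces division: the derivative of
  \<open>d * q\<close> at \<open>a\<close> is d'(a) q(a). Multiplying by \<open>a\<close> to obtain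
  \<open>a ^ r\<close> leaves only \<open>of_nat r\<close>, \<open>a ^ r\<close> and constants, all
  recurrent in \<open>r\<close>.\<close>

lemma poly_quotient_root:
  assumes "t_pow_minus_1 r = d * q" "r \<ge> 1"
  shows "poly (cpoly q) a = (if poly (cpoly d) a = 0
      then of_nat r * a ^ r * (1 / (a * poly (pderiv (cpoly d)) a)) else (a ^ r + (- 1)) * (1 / poly (cpoly d) a))"
proof -
  have dq: "cpoly (t_pow_minus_1 r) = cpoly d * cpoly q" unfolding assms(1) by (rule cpoly_mult)
  then have val: "poly (cpoly d) a * poly (cpoly q) a = a ^ r - 1"
    using cpoly_t_pow_minus_1[OF assms(2), of a] by simp
  show ?thesis
  proof (cases "poly (cpoly d) a = 0")
    case False
    then show ?thesis using val by (simp add: field_simps)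
  next
    case True
    then have ar: "a ^ r = 1" using val by simp
    then have a0: "a \<noteq> 0" using assms(2) by (auto simp: power_0_left)
    have "pderiv (cpoly d * cpoly q) = pderiv (monom 1 r - 1)"
      unfolding dq[symmetric] by (simp add: cpoly_diff map_poly_monom)
    then have "poly (pderiv (cpoly d * cpoly q)) a = of_nat r * a ^ (r - 1)"
      by (simp add: pderiv_diff pderiv_monom poly_monom)
    then have "poly (pderiv (cpoly d)) a * poly (cpoly q) a = of_nat r * a ^ (r - 1)"
      using True by (simp add: pderiv_mult mult.commute)
    then have e: "a * poly (pderiv (cpoly d)) a * poly (cpoly q) a = of_nat r * a ^ r"
      using assms(2) by (cases r) (auto simp: algebra_simps)
    have "of_nat r * a ^ r \<noteq> 0" using ar assms(2) by simp
    then have "a * poly (pderiv (cpoly d)) a \<noteq> 0" using e by (metis mult_zero_left)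
    then have "poly (cpoly q) a = of_nat r * a ^ r * (1 / (a * poly (pderiv (cpoly d)) a))"
      using e by (simp add: field_simps)
    then show ?thesis using True by simp
  qed
qed

text \<open>A multiple root would be a root of \<open>t ^ r - 1\<close> and of its derivative, but
  the latter can vanish only at 0.\<close>

lemma rsquarefree_quotient:
  assumes "t_pow_minus_1 r = d * q" "r \<ge> 1" shows "rsquarefree (cpoly q)"
  unfolding rsquarefree_roots
proof (intro allI notI)
  fix a assume a: "poly (cpoly q) a = 0 \<and> poly (pderiv (cpoly q)) a = 0"
  have dq: "cpoly (t_pow_minus_1 r) = cpoly d * cpoly q" unfolding assms(1) by (rule cpoly_mult)
  then have ar: "a ^ r = 1" using cpoly_t_pow_minus_1[OF assms(2), of a] a by simp
  have "pderiv (cpoly d * cpoly q) = pderiv (monom 1 r - 1)"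
    unfolding dq[symmetric] by (simp add: cpoly_diff map_poly_monom)
  then have "poly (pderiv (cpoly d * cpoly q)) a = of_nat r * a ^ (r - 1)"
    by (simp add: pderiv_diff pderiv_monom poly_monom)
  then have "of_nat r * a ^ (r - 1) = 0" using a by (simp add: pderiv_mult)
  then have "a = 0" using assms(2) by auto
  then show False using ar assms(2) by (simp add: power_0_left)
qed

text \<open>The resultant is a product over the roots of \<open>q r\<close>, whose number grows with
  \<open>r\<close>. Exchanging the two polynomials turns it into a product over the fixed roots of
  \<open>g\<close>, with factors given by \<open>poly_quotient_root\<close>. Its sign is constant on
  \<open>S\<close>, so the absolute value amounts to a constant factor.\<close>

lemma lin_rec_idx_class:
  fixes g d :: "int poly" and q :: "nat \<Rightarrow> int poly"
  assumes g: "g \<noteq> 0" and d: "lead_coeff d = 1"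
    and S: "\<And>r. r \<in> S \<Longrightarrow> r \<ge> 1 \<and> t_pow_minus_1 r = d * q r \<and> coprime (q r) g \<and> (even r \<longleftrightarrow> b)"
  shows "\<exists>E. lin_rec E \<and> (\<forall>r\<in>S. of_nat (idx UNIV (ring.span {g, q r})) = E r)"
proof -
  define e where "e a r = (if poly (cpoly d) a = 0
      then of_nat r * a ^ r * (1 / (a * poly (pderiv (cpoly d)) a)) else (a ^ r + (- 1)) * (1 / poly (cpoly d) a))" for a r
  obtain as where as: "mset as = proots (cpoly g)" by (metis ex_mset)
  define l where "l = lead_coeff (cpoly g)"
  define D where "D = degree d"
  \<comment> \<open>1 is always a root of \<open>t ^ r - 1\<close>, and -1 exactly for even
    \<open>r\<close>; such a root belongs to \<open>q r\<close> unless it is a root of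
    \<open>d\<close>.\<close>
  define \<sigma> where "\<sigma> = (\<Prod>z\<in>{z \<in> {1, -1}. poly (cpoly d) z \<noteq> 0 \<and> (z = 1 \<or> b)}. sgn (poly (cpoly g) z))"
  \<comment> \<open>The degree of \<open>q r\<close> is \<open>r - D\<close>. This accounts for the
    powers of \<open>l\<close> and of -1, the latter from reversing the differences of
    roots.\<close>
  define E where "E = (\<lambda>r. (inverse \<sigma> * (1 / l ^ D)) * (l ^ r * (\<Prod>a\<leftarrow>as. (1 / (-1) ^ D) * ((-1) ^ r * e a r))))"
  have cg: "cpoly g \<noteq> 0" by (rule cpoly_nonzero[OF g])
  have gz: "poly (cpoly g) z = l * (\<Prod>a\<leftarrow>as. z - a)" for z
  proof -
    have "(\<Prod>x\<in>#proots (cpoly g). [:-x, 1:]) = (\<Prod>a\<leftarrow>as. [:-a, 1:])" by (metis as mset_map prod_mset_prod_list)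
    then have "cpoly g = smult l (\<Prod>a\<leftarrow>as. [:-a, 1:])"
      using complex_poly_decompose_multiset[of "cpoly g"] by (simp add: l_def)
    then have "poly (cpoly g) z = poly (smult l (\<Prod>a\<leftarrow>as. [:-a, 1:])) z" by (simp only:)
    then show ?thesis by (simp add: poly_prod_list_linear)
  qed
  have le: "lin_rec (e a)" for a
  proof (cases "poly (cpoly d) a = 0")
    case True
    then have "e a = (\<lambda>r. of_nat r * a ^ r * (1 / (a * poly (pderiv (cpoly d)) a)))" by (auto simp: e_def)
    moreover have "lin_rec (\<lambda>r. of_nat r * a ^ r * (1 / (a * poly (pderiv (cpoly d)) a)))"
      by (rule lin_rec_mult[OF lin_rec_mult[OF lin_rec_of_nat lin_rec_power] lin_rec_const])
    ultimately show ?thesis by (simp only:)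
  next
    case False
    then have "e a = (\<lambda>r. (a ^ r + (- 1)) * (1 / poly (cpoly d) a))" by (auto simp: e_def)
    moreover have "lin_rec (\<lambda>r. (a ^ r + (- 1)) * (1 / poly (cpoly d) a))"
      by (rule lin_rec_mult[OF lin_rec_add[OF lin_rec_power lin_rec_const] lin_rec_const])
    ultimately show ?thesis by (simp only:)
  qed
  have "lin_rec (\<lambda>r. \<Prod>a\<leftarrow>as. (1 / (-1) ^ D) * ((-1) ^ r * e a r))"
    by (rule lin_rec_prod_list) (rule lin_rec_cmult[OF lin_rec_mult[OF lin_rec_power le]])
  then have "lin_rec E" unfolding E_def by (rule lin_rec_cmult[OF lin_rec_mult[OF lin_rec_power]])
  moreover have "of_nat (idx UNIV (ring.span {g, q r})) = E r" if r: "r \<in> S" for r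
  proof -
    have r1: "r \<ge> 1" and dq: "t_pow_minus_1 r = d * q r" and cop: "coprime (q r) g" and ev: "even r \<longleftrightarrow> b"
      using S[OF r] by auto
    let ?Z = "{z. poly (cpoly (q r)) z = 0}"
    define W where "W = (\<Prod>z\<in>?Z. poly (cpoly g) z)"
    have q0: "q r \<noteq> 0" using dq t_pow_minus_1_nonzero[OF r1] by (metis mult_zero_right)
    have lq: "lead_coeff (q r) = 1"
      using lead_coeff_t_pow_minus_1[OF r1] unfolding dq lead_coeff_mult d by simp
    have d0: "d \<noteq> 0" using d by auto
    have deg: "r = D + degree (q r)"
      using degree_t_pow_minus_1[OF r1] degree_mult_eq[OF d0 q0] unfolding dq D_def by simp
    have sf: "rsquarefree (cpoly (q r))" by (rule rsquarefree_quotient[OF dq r1])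
    have cq0: "cpoly (q r) \<noteq> 0" by (rule cpoly_nonzero[OF q0])
    have finZ: "finite ?Z" by (rule poly_roots_finite[OF cq0])
    have dec: "cpoly (q r) = (\<Prod>z\<in>?Z. [:-z, 1:])"
      using complex_poly_decompose_rsquarefree[OF sf] by (simp add: coeff_cpoly degree_cpoly lq)
    have "degree (\<Prod>z\<in>?Z. [:-z, 1:]) = (\<Sum>z\<in>?Z. degree [:-z, 1:])" by (rule degree_prod_sum_eq) auto
    then have cardZ: "card ?Z = degree (q r)" unfolding dec[symmetric] by (simp add: degree_cpoly)
    have nz: "poly (cpoly g) z \<noteq> 0" if "z \<in> ?Z" for z
      using coprime_no_common_root[OF cop q0] that by blast
    have root: "z ^ r = 1" if "z \<in> ?Z" for z
    proof -
      have "z ^ r - 1 = poly (cpoly d * cpoly (q r)) z"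
        using cpoly_t_pow_minus_1[OF r1, of z] unfolding dq cpoly_mult by (rule sym)
      also have "\<dots> = 0" using that by simp
      finally show ?thesis by simp
    qed
    have sgW: "sgn W = \<sigma>"
    proof -
      have "sgn W = (\<Prod>z\<in>?Z \<inter> {1, -1}. sgn (poly (cpoly g) z))"
        unfolding W_def
      proof (rule sgn_prod_roots[OF finZ _ _ nz])
        show "cnj z \<in> ?Z" if "z \<in> ?Z" for z using that by (simp add: poly_cpoly_cnj)
        show "norm z = 1" if "z \<in> ?Z" for z
        proof -
          have "norm z ^ r = 1" using root[OF that] by (metis norm_one norm_power)
          then show ?thesis using r1 power_eq_imp_eq_base[of "norm z" r 1] by simp
        qed
      qed
      moreover have "z \<in> ?Z \<longleftrightarrow> poly (cpoly d) z \<noteq> 0 \<and> (z = 1 \<or> b)" if z: "z \<in> {1, -1}" for z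
      proof
        assume q: "z \<in> ?Z"
        have "poly (cpoly d) z \<noteq> 0"
          using coprime_no_common_root[OF _ q0, of d z] t_pow_minus_1_squarefree[OF dq r1] q by (auto simp: coprime_commute)
        moreover have "z = 1 \<or> b" using root[OF q] z ev by auto
        ultimately show "poly (cpoly d) z \<noteq> 0 \<and> (z = 1 \<or> b)" by blast
      next
        assume *: "poly (cpoly d) z \<noteq> 0 \<and> (z = 1 \<or> b)"
        then have "z ^ r = 1" using z ev by auto
        then have "poly (cpoly d) z * poly (cpoly (q r)) z = 0"
          using cpoly_t_pow_minus_1[OF r1, of z] unfolding dq cpoly_mult by simp
        then show "z \<in> ?Z" using * by simp
      qed
      then have "?Z \<inter> {1, -1} = {z \<in> {1, -1}. poly (cpoly d) z \<noteq> 0 \<and> (z = 1 \<or> b)}" by blast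
      ultimately show ?thesis unfolding \<sigma>_def by (simp only:)
    qed
    have W0: "W \<noteq> 0" unfolding W_def using nz finZ by auto
    then have \<sigma>0: "\<sigma> \<noteq> 0" using sgW by (metis sgn_zero_iff)
    have "W = of_real (cmod W) * sgn W" using W0 by (simp add: sgn_eq)
    then have normW: "of_real (cmod W) = inverse \<sigma> * W" using \<sigma>0 unfolding sgW by (simp add: field_simps)
    have Zq: "(\<Prod>z\<in>?Z. z - a) = (-1) ^ degree (q r) * poly (cpoly (q r)) a" for a
    proof -
      have "poly (cpoly (q r)) a = (\<Prod>z\<in>?Z. a - z)" by (subst dec) (simp add: poly_prod)
      moreover have "(\<Prod>z\<in>?Z. z - a) = (\<Prod>z\<in>?Z. (-1) * (a - z))" by (rule prod.cong) auto
      moreover have "(\<Prod>z\<in>?Z. (-1) * (a - z)) = (\<Prod>z\<in>?Z. -1) * (\<Prod>z\<in>?Z. a - z)" by (rule prod.distrib)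
      moreover have "(\<Prod>z\<in>?Z. -1 :: complex) = (-1) ^ degree (q r)" unfolding prod_constant cardZ ..
      ultimately show ?thesis by (simp only:)
    qed
    have "W = (\<Prod>z\<in>?Z. l) * (\<Prod>z\<in>?Z. \<Prod>a\<leftarrow>as. z - a)" unfolding W_def gz by (rule prod.distrib)
    also have "\<dots> = l ^ degree (q r) * (\<Prod>a\<leftarrow>as. (-1) ^ degree (q r) * poly (cpoly (q r)) a)"
      unfolding prod_prod_list_swap Zq by (simp add: cardZ)
    finally have W: "W = l ^ degree (q r) * (\<Prod>a\<leftarrow>as. (-1) ^ degree (q r) * e a r)"
      unfolding poly_quotient_root[OF dq r1] e_def .
    have l0: "l \<noteq> 0" using cg by (simp add: l_def)
    have pw: "l ^ degree (q r) = (1 / l ^ D) * l ^ r" using l0 deg by (simp add: power_add[of l D "degree (q r)", folded deg])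
    have pm: "(-1 :: complex) ^ degree (q r) = (1 / (-1) ^ D) * (-1) ^ r"
      by (simp add: power_add[of "-1 :: complex" D "degree (q r)", folded deg])
    have "inverse \<sigma> * W = E r"
      unfolding E_def by (subst W) (simp only: pw pm mult.assoc)
    then have "of_real (cmod W) = E r" unfolding normW .
    moreover have "real (idx UNIV (ring.span {g, q r})) = cmod W"
      unfolding W_def by (rule idx_eq_norm_prod_roots[OF lq sf]) (use nz in blast)
    ultimately show ?thesis by (metis of_real_of_nat_eq)
  qed
  ultimately show ?thesis by blast
qed

section \<open>Saturation, and modules killed by a polynomial\<close>

context zt_module begin

text \<open>For \<open>D\<close> contained in \<open>S\<close> this is the preimage of the torsion
  subgroup of S/D, whose order is therefore \<open>idx (zsat S D) D\<close>.\<close>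

definition zsat :: "'b set \<Rightarrow> 'b set \<Rightarrow> 'b set" where
  "zsat S D = {v \<in> S. \<exists>n::int. n \<noteq> 0 \<and> [:n:] *s v \<in> D}"

lemma subspace_zsat: assumes S: "subspace S" and D: "subspace D" shows "subspace (zsat S D)"
proof (rule subspaceI)
  show "0 \<in> zsat S D" unfolding zsat_def
    using subspace_0[OF S] subspace_0[OF D] by (intro CollectI conjI exI[of _ 1]) auto
next
  fix x y assume "x \<in> zsat S D" "y \<in> zsat S D"
  then obtain m n where *: "x \<in> S" "y \<in> S" "m \<noteq> 0" "n \<noteq> 0" "[:m:] *s x \<in> D" "[:n:] *s y \<in> D"
    unfolding zsat_def by blast
  have mn: "[:m * n:] = [:n:] * [:m:]" "[:m * n:] = [:m:] * [:n:]" by (simp_all add: mult.commute)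
  have "[:m * n:] *s (x + y) = [:n:] *s ([:m:] *s x) + [:m:] *s ([:n:] *s y)"
    unfolding scale_right_distrib scale_scale mn[symmetric] ..
  moreover have "\<dots> \<in> D" by (intro subspace_add[OF D] subspace_scale[OF D] *)
  ultimately show "x + y \<in> zsat S D" unfolding zsat_def
    using * subspace_add[OF S] by (intro CollectI conjI exI[of _ "m * n"]) auto
next
  fix c x assume "x \<in> zsat S D"
  then obtain n where *: "x \<in> S" "n \<noteq> 0" "[:n:] *s x \<in> D" unfolding zsat_def by blast
  have "[:n:] *s (c *s x) = c *s ([:n:] *s x)" by (rule scale_left_commute)
  moreover have "\<dots> \<in> D" by (intro subspace_scale[OF D] *)
  ultimately show "c *s x \<in> zsat S D" unfolding zsat_def
    using * subspace_scale[OF S] by (intro CollectI conjI exI[of _ n]) auto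
qed

lemma subset_zsat: "D \<subseteq> S \<Longrightarrow> D \<subseteq> zsat S D"
  unfolding zsat_def by (intro subsetI CollectI conjI exI[of _ 1]) (auto simp: one_pCons[symmetric])

lemma scale_diff_cancel: "a *s v - a *s w = a *s (v - w)"
  by (rule scale_right_diff_distrib[symmetric])

text \<open>
  Writing \<open>B/A \<cong> \<int>[t]/I\<close> and \<open>I = gJ\<close> with \<open>g = Gcd I\<close>, the ideal \<open>J\<close> has finite index, and
  multiplication by \<open>q\<close> on the finite module \<open>\<int>[t]/J\<close> has kernel and cokernel of the same order.
\<close>

lemma idx_cyclic_extension:
  assumes N: "subspace N" and A: "subspace A" and NA: "N \<subseteq> A" and f: "f \<noteq> 0" "f *s p \<in> A"
  shows "\<exists>g. g \<noteq> 0 \<and> g dvd f \<and> (\<forall>q. coprime q f \<longrightarrow> (\<forall>v\<in>A + span {p}. q *s v \<in> N \<longrightarrow> v \<in> N) \<longrightarrow>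
    idx (A + span {p}) (N + (*s) q ` (A + span {p})) = idx A (N + (*s) q ` A) * idx UNIV (ring.span {g, q}))"
proof -
  let ?B = "A + span {p}"
  note mulD = dvd_def
  define I where "I = {a. a *s p \<in> A}"
  have I: "ring.subspace I"
  proof (rule ring.subspaceI)
    show "0 \<in> I" unfolding I_def using subspace_0[OF A] by simp
    show "x + y \<in> I" if "x \<in> I" "y \<in> I" for x y
      using that subspace_add[OF A] unfolding I_def mem_Collect_eq scale_left_distrib by blast
    show "c * x \<in> I" if "x \<in> I" for c x
      using that subspace_scale[OF A, of "x *s p" c] unfolding I_def by simp
  qed
  have fI: "f \<in> I" using f(2) by (simp add: I_def)
  define g where "g = Gcd I"
  have gI: "g dvd a" if "a \<in> I" for a unfolding g_def using that by (rule Gcd_dvd)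
  have g0: "g \<noteq> 0" using gI[OF fI] f(1) by auto
  define J where "J = {a. g * a \<in> I}"
  have J: "ring.subspace J"
  proof (rule ring.subspaceI)
    show "0 \<in> J" unfolding J_def using ring.subspace_0[OF I] by simp
    show "x + y \<in> J" if "x \<in> J" "y \<in> J" for x y
      using that ring.subspace_add[OF I] unfolding J_def mem_Collect_eq distrib_left by blast
    show "c * x \<in> J" if "x \<in> J" for c x
      using ring.subspace_scale[OF I, of "g * x" c] that unfolding J_def mem_Collect_eq mult.left_commute[of g c x] by blast
  qed
  have Junit: "is_unit d" if d: "\<And>a. a \<in> J \<Longrightarrow> d dvd a" for d
  proof -
    have "g * d dvd x" if "x \<in> I" for x
    proof -
      obtain a where a: "x = g * a" using gI[OF \<open>x \<in> I\<close>] by (elim dvdE)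
      then have "d dvd a" using that by (intro d) (simp add: J_def)
      then show ?thesis unfolding a by (rule mult_dvd_mono[OF dvd_refl])
    qed
    then have "g * d dvd g * 1" unfolding g_def by (simp add: Gcd_greatest)
    then show ?thesis using g0 by (simp only: dvd_mult_cancel_left) blast
  qed
  \<comment> \<open>Since \<open>J\<close> has no common divisors besides units, the divisor
    supplied by \<open>ideal_generator\<close> is a unit, and \<open>J\<close> contains a nonzero
    constant.\<close>
  have "idx UNIV J \<noteq> 0"
  proof -
    obtain f' where f': "f = g * f'" using gI[OF fI] by (elim dvdE)
    then have "f' \<in> J" "f' \<noteq> 0" using fI f(1) by (auto simp: J_def)
    then obtain h c where h: "c \<noteq> 0" "h \<noteq> 0" "\<And>a. a \<in> J \<Longrightarrow> h dvd a" "[:c:] * h \<in> J"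
      using ideal_generator[OF J] by metis
    have "is_unit h" using h(3) by (rule Junit)
    then obtain k where "1 = h * k" by (elim dvdE)
    then have "[:c:] = k * ([:c:] * h)" by (simp add: mult.commute)
    then have "[:c:] \<in> J" using ring.subspace_scale[OF J h(4)] by metis
    then show ?thesis by (rule idx_ideal_nonzero[OF J _ h(1) Junit])
  qed
  have sA: "sgrp A" and sN: "sgrp N" by (rule subspace_sgrp A N)+
  have B: "subspace ?B" by (rule subspace_set_plus[OF A subspace_span])
  note sB = subspace_sgrp[OF B]
  have AB: "A \<subseteq> ?B" by (rule set_plus_left_subset[OF subspace_sgrp[OF subspace_span]])
  have spanp: "v \<in> span {p} \<longleftrightarrow> (\<exists>k. v = k *s p)" for v by (auto simp: span_singleton)
  have kpB: "k *s p \<in> ?B" for k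
    using set_plus_right_subset[OF sA, of "span {p}"] spanp by blast
  have memB: "\<exists>k. v - k *s p \<in> A" if "v \<in> ?B" for v
  proof -
    obtain b where b: "b \<in> span {p}" "v - b \<in> A" using iffD1[OF mem_set_plus_iff \<open>v \<in> ?B\<close>] by blast
    moreover obtain k where "b = k *s p" using b(1) unfolding spanp by blast
    ultimately show ?thesis by blast
  qed
  have "idx ?B (N + (*s) q ` ?B) = idx A (N + (*s) q ` A) * idx UNIV (ring.span {g, q})"
    if q: "coprime q f" and inj: "\<And>v. v \<in> ?B \<Longrightarrow> q *s v \<in> N \<Longrightarrow> v \<in> N" for q
  proof -
    have cqg: "coprime q g" using q gI[OF fI] by (metis coprime_divisors dvd_refl)
    have gq: "g dvd a" if "g dvd q * a" for a using that cqg by (simp add: coprime_dvd_mult_right_iff coprime_commute)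
    define Rq where "Rq = range ((*) q)"
    have Rq: "ring.subspace Rq" unfolding Rq_def by (rule ring.subspace_scale_image) simp
    define J' where "J' = {a. q * a \<in> J}"
    have J': "ring.subspace J'"
    proof (rule ring.subspaceI)
      show "0 \<in> J'" unfolding J'_def using ring.subspace_0[OF J] by simp
      show "x + y \<in> J'" if "x \<in> J'" "y \<in> J'" for x y
        using that ring.subspace_add[OF J] unfolding J'_def mem_Collect_eq distrib_left by blast
      show "c * x \<in> J'" if "x \<in> J'" for c x
        using ring.subspace_scale[OF J, of "q * x" c] that unfolding J'_def mem_Collect_eq mult.left_commute[of q c x] by blast
    qed
    have JJ': "J \<subseteq> J'" unfolding J'_def using ring.subspace_scale[OF J] by blast
    have IRq: "ring.subspace (I + Rq)" and JRq: "ring.subspace (J + Rq)"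
      by (rule ring.subspace_set_plus I J Rq)+
    have qim: "subspace ((*s) q ` S)" if "subspace S" for S using that by (rule subspace_scale_image)
    have AqB: "subspace (A + (*s) q ` ?B)" by (rule subspace_set_plus[OF A qim[OF B]])
    note sg = ring.subspace_sgrp[OF I] ring.subspace_sgrp[OF J] ring.subspace_sgrp[OF J'] ring.subspace_sgrp[OF IRq]
      ring.subspace_sgrp[OF JRq] ring.subspace_sgrp[OF Rq] subspace_sgrp[OF AqB]
    have snake: "idx ?B (N + (*s) q ` ?B) * idx {v \<in> ?B. q *s v \<in> A} A = idx A (N + (*s) q ` A) * idx ?B (A + (*s) q ` ?B)"
    proof (rule idx_snake[OF sN sA sB NA AB])
      show "q *s (u - v) = q *s u - q *s v" for u v by (rule scale_right_diff_distrib)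
      show "(*s) q ` N \<subseteq> N" "(*s) q ` A \<subseteq> A" "(*s) q ` ?B \<subseteq> ?B"
        using subspace_scale[OF N] subspace_scale[OF A] subspace_scale[OF B] by blast+
      show "v \<in> N" if "v \<in> ?B" "q *s v \<in> N" for v using inj that by blast
    qed
    \<comment> \<open>\<open>J'\<close> modulo \<open>J\<close> is the kernel of \<open>q\<close> on
      the ring modulo \<open>J\<close>; multiplication by \<open>g\<close> identifies it with the
      kernel of \<open>q\<close> on \<open>?B\<close> modulo \<open>A\<close>. Surjectivity cancels
      \<open>g\<close> from \<open>q * k\<close>, which is possible as \<open>q\<close> and
      \<open>g\<close> are coprime.\<close>
    have 1: "idx J' J = idx {v \<in> ?B. q *s v \<in> A} A"
    proof (rule idx_eqI[OF sg(2) sA, of _ "\<lambda>a. (g * a) *s p"])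
      show "(g * a) *s p \<in> {v \<in> ?B. q *s v \<in> A}" if "a \<in> J'" for a
      proof -
        have "g * (q * a) \<in> I" using that by (simp add: J'_def J_def)
        moreover have "g * (q * a) = q * (g * a)" by (rule mult.left_commute)
        ultimately have "q * (g * a) \<in> I" by (simp only:)
        then have "q *s ((g * a) *s p) \<in> A" unfolding I_def scale_scale by simp
        then show ?thesis using kpB by blast
      qed
      show "((g * a) *s p - (g * b) *s p \<in> A) = (a - b \<in> J)" for a b
        unfolding J_def I_def mem_Collect_eq right_diff_distrib scale_left_diff_distrib ..
      show "\<exists>a\<in>J'. y - (g * a) *s p \<in> A" if y: "y \<in> {v \<in> ?B. q *s v \<in> A}" for y
      proof -
        obtain k where k: "y - k *s p \<in> A" using memB y by blast
        have "q *s y - q *s (y - k *s p) = (q * k) *s p" by (simp add: scale_right_diff_distrib)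
        then have "(q * k) *s p \<in> A" using subspace_diff[OF A _ subspace_scale[OF A k, of q], of "q *s y"] y by simp
        then have qk: "q * k \<in> I" by (simp add: I_def)
        have "g dvd k" by (rule gq[OF gI[OF qk]])
        then obtain a where a: "k = g * a" by (elim dvdE)
        have "g * (q * a) \<in> I" using qk unfolding a by (simp only: mult.left_commute)
        then have "a \<in> J'" by (simp add: J'_def J_def)
        then show ?thesis using k unfolding a by blast
      qed
    qed
    have 2: "idx UNIV (I + Rq) = idx ?B (A + (*s) q ` ?B)"
    proof (rule idx_eqI[OF sg(4) sg(7), of _ "\<lambda>k. k *s p"])
      show "k *s p \<in> ?B" for k by (rule kpB)
      show "(k *s p - l *s p \<in> A + (*s) q ` ?B) = (k - l \<in> I + Rq)" for k l
      proof
        assume "k *s p - l *s p \<in> A + (*s) q ` ?B"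
        from iffD1[OF mem_set_plus_iff this] obtain v where v: "v \<in> ?B" "k *s p - l *s p - q *s v \<in> A" by blast
        obtain m where m: "v - m *s p \<in> A" using memB[OF v(1)] by blast
        have "(k - l - q * m) *s p = (k *s p - l *s p - q *s v) + q *s (v - m *s p)"
          by (simp add: scale_left_diff_distrib scale_right_diff_distrib)
        also have "\<dots> \<in> A" by (intro subspace_add[OF A] v subspace_scale[OF A] m)
        finally have "k - l - q * m \<in> I" by (simp add: I_def)
        then show "k - l \<in> I + Rq" unfolding mem_set_plus_iff Rq_def by blast
      next
        assume "k - l \<in> I + Rq"
        then obtain m where m: "k - l - q * m \<in> I" unfolding mem_set_plus_iff Rq_def by blast
        then have "(k - l - q * m) *s p \<in> A" by (simp add: I_def)
        moreover have "(k - l - q * m) *s p = k *s p - l *s p - q *s (m *s p)"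
          by (simp add: scale_left_diff_distrib)
        ultimately have "k *s p - l *s p - q *s (m *s p) \<in> A" by (simp only:)
        then show "k *s p - l *s p \<in> A + (*s) q ` ?B" using kpB by (intro iffD2[OF mem_set_plus_iff]) blast
      qed
      show "\<exists>a\<in>UNIV. y - a *s p \<in> A + (*s) q ` ?B" if "y \<in> ?B" for y
        using memB[OF that] set_plus_left_subset[OF subspace_sgrp[OF qim[OF B]], of A] by blast
    qed
    have gqspan: "v \<in> ring.span {g, q} \<longleftrightarrow> (\<exists>x y. v = x * g + y * q)" for v by (rule ring_span_pair)
    \<comment> \<open>Multiplication by \<open>g\<close> carries the cokernel of \<open>q\<close>
      modulo \<open>J\<close> onto the part of the cokernel modulo \<open>I\<close> that comes from
      the ideal of \<open>g\<close> and \<open>q\<close>.\<close>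
    have 3: "idx UNIV (J + Rq) = idx (ring.span {g, q}) (I + Rq)"
    proof (rule idx_eqI[OF sg(5) sg(4), of _ "\<lambda>a. g * a"])
      show "g * a \<in> ring.span {g, q}" for a unfolding gqspan by (intro exI[of _ a] exI[of _ 0]) simp
      show "(g * a - g * b \<in> I + Rq) = (a - b \<in> J + Rq)" for a b
      proof
        assume "g * a - g * b \<in> I + Rq"
        then obtain y where y: "g * a - g * b - q * y \<in> I" unfolding mem_set_plus_iff Rq_def by blast
        have "q * y = g * (a - b) - (g * a - g * b - q * y)" by (simp add: right_diff_distrib)
        moreover have "g dvd \<dots>" by (intro dvd_diff dvd_triv_left gI y)
        ultimately have "g dvd q * y" by (simp only:)
        then have "g dvd y" by (rule gq)
        then obtain y' where y': "y = g * y'" by (elim dvdE)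
        have "g * a - g * b - q * y = g * (a - b - q * y')" unfolding y' by (simp add: right_diff_distrib mult.left_commute)
        then have "a - b - q * y' \<in> J" using y by (simp add: J_def)
        then show "a - b \<in> J + Rq" unfolding mem_set_plus_iff Rq_def by blast
      next
        assume "a - b \<in> J + Rq"
        then obtain y where "a - b - q * y \<in> J" unfolding mem_set_plus_iff Rq_def by blast
        moreover have "g * (a - b - q * y) = g * a - g * b - q * (g * y)" by (simp add: right_diff_distrib mult.left_commute)
        ultimately have "g * a - g * b - q * (g * y) \<in> I" by (simp add: J_def)
        then show "g * a - g * b \<in> I + Rq" unfolding mem_set_plus_iff Rq_def by blast
      qed
      show "\<exists>a\<in>UNIV. y - g * a \<in> I + Rq" if "y \<in> ring.span {g, q}" for y
      proof -
        obtain u v where "y = u * g + v * q" using \<open>y \<in> ring.span {g, q}\<close> unfolding gqspan by blast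
        then have "y - g * u = q * v" by (simp add: mult.commute)
        then have "y - g * u \<in> Rq" unfolding Rq_def by blast
        then show ?thesis using set_plus_right_subset[OF sg(1), of Rq] by blast
      qed
    qed
    have "I + Rq \<subseteq> ring.span {g, q}"
    proof (rule set_plus_subset_sgrp[OF ring.subspace_sgrp[OF ring.subspace_span]])
      show "I \<subseteq> ring.span {g, q}"
      proof
        fix a assume "a \<in> I"
        then have "g dvd a" by (rule gI)
        then obtain k where "a = g * k" by (elim dvdE)
        then show "a \<in> ring.span {g, q}" unfolding gqspan by (intro exI[of _ k] exI[of _ 0]) simp
      qed
      show "Rq \<subseteq> ring.span {g, q}"
      proof
        fix a assume "a \<in> Rq"
        then obtain k where "a = q * k" unfolding Rq_def by blast
        then show "a \<in> ring.span {g, q}" unfolding gqspan by (intro exI[of _ 0] exI[of _ k]) simp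
      qed
    qed
    then have 4: "idx UNIV (I + Rq) = idx UNIV (ring.span {g, q}) * idx (ring.span {g, q}) (I + Rq)"
      by (intro idx_tower sgrp_UNIV sg ring.subspace_sgrp ring.subspace_span) auto
    have 5: "idx UNIV J' = idx (J + Rq) J"
    proof (rule idx_eqI[OF sg(3) sg(2), of _ "\<lambda>a. q * a"])
      show "q * a \<in> J + Rq" for a using set_plus_right_subset[OF sg(2), of Rq] unfolding Rq_def by blast
      show "(q * a - q * b \<in> J) = (a - b \<in> J')" for a b unfolding J'_def mem_Collect_eq right_diff_distrib ..
      show "\<exists>a\<in>UNIV. y - q * a \<in> J" if "y \<in> J + Rq" for y
        using that unfolding mem_set_plus_iff Rq_def by blast
    qed
    \<comment> \<open>Two chains from \<open>J\<close> to the whole ring share a factor by 5. The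
      index of \<open>J\<close> is finite, so this factor cancels: kernel and cokernel of
      \<open>q\<close> modulo \<open>J\<close> have the same nonzero order, which then cancels from
      \<open>snake\<close>.\<close>
    have "idx UNIV J = idx UNIV (J + Rq) * idx (J + Rq) J"
      using set_plus_left_subset[OF sg(6), of J] by (intro idx_tower sgrp_UNIV sg) auto
    moreover have "idx UNIV J = idx UNIV J' * idx J' J"
      by (rule idx_tower[OF sgrp_UNIV sg(3) sg(2) JJ']) simp
    ultimately have "idx J' J \<noteq> 0" "idx J' J = idx UNIV (J + Rq)"
      using \<open>idx UNIV J \<noteq> 0\<close> unfolding 5 by auto
    then show ?thesis using snake unfolding 1[symmetric] 2[symmetric] 4 3[symmetric] by simp
  qed
  then show ?thesis using g0 gI[OF fI] by (intro exI[of _ g]) blast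
qed

text \<open>Each further generator multiplies the index by one factor. The list \<open>gs\<close> is
  chosen before \<open>q\<close>, and this uniformity is what allows the index to be followed as
  \<open>r\<close> varies.\<close>

lemma idx_finitely_generated:
  assumes N: "subspace N" and f: "f \<noteq> 0" and "finite C" "\<And>c. c \<in> C \<Longrightarrow> f *s c \<in> N"
  shows "\<exists>gs. (\<forall>g\<in>set gs. g \<noteq> 0 \<and> g dvd f) \<and> (\<forall>q. coprime q f \<longrightarrow> (\<forall>v\<in>N + span C. q *s v \<in> N \<longrightarrow> v \<in> N) \<longrightarrow>
    idx (N + span C) (N + (*s) q ` (N + span C)) = (\<Prod>g\<leftarrow>gs. idx UNIV (ring.span {g, q})))"
  using assms(3,4)
proof (induction C rule: finite_induct)
  case empty
  have "N + span {} = N" by (auto elim!: set_plus_elim intro: set_plus_intro[of _ N 0 "{0}", simplified])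
  moreover have "N + (*s) q ` N = N" for q
  proof
    show "N + (*s) q ` N \<subseteq> N" using subspace_scale[OF N] by (intro set_plus_subset_sgrp subspace_sgrp[OF N]) auto
    show "N \<subseteq> N + (*s) q ` N" by (rule set_plus_left_subset[OF subspace_sgrp[OF subspace_scale_image[OF N]]])
  qed
  ultimately show ?case using idx_self[OF subspace_sgrp[OF N]] by (intro exI[of _ "[]"]) simp
next
  case (insert c C)
  let ?A = "N + span C"
  have A: "subspace ?A" by (rule subspace_set_plus[OF N subspace_span])
  have NA: "N \<subseteq> ?A" by (rule set_plus_left_subset[OF subspace_sgrp[OF subspace_span]])
  have eq: "N + span (insert c C) = ?A + span {c}"
  proof -
    have "span (insert c C) = span C + span {c}"
    proof
      show "span (insert c C) \<subseteq> span C + span {c}"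
        by (rule subsetI) (auto simp: span_insert_iff mem_set_plus_iff span_singleton)
      show "span C + span {c} \<subseteq> span (insert c C)"
        by (rule set_plus_subset_sgrp[OF subspace_sgrp[OF subspace_span] span_mono span_mono]) auto
    qed
    then show ?thesis by (simp only: add.assoc)
  qed
  have AB: "?A \<subseteq> ?A + span {c}" by (rule set_plus_left_subset[OF subspace_sgrp[OF subspace_span]])
  obtain gs where gs: "\<forall>g\<in>set gs. g \<noteq> 0 \<and> g dvd f"
    "\<forall>q. coprime q f \<longrightarrow> (\<forall>v\<in>?A. q *s v \<in> N \<longrightarrow> v \<in> N) \<longrightarrow> idx ?A (N + (*s) q ` ?A) = (\<Prod>g\<leftarrow>gs. idx UNIV (ring.span {g, q}))"
    using insert.IH insert.prems by auto
  have "f *s c \<in> ?A" using insert.prems NA by blast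
  then obtain g where g: "g \<noteq> 0" "g dvd f" "\<forall>q. coprime q f \<longrightarrow> (\<forall>v\<in>?A + span {c}. q *s v \<in> N \<longrightarrow> v \<in> N) \<longrightarrow>
    idx (?A + span {c}) (N + (*s) q ` (?A + span {c})) = idx ?A (N + (*s) q ` ?A) * idx UNIV (ring.span {g, q})"
    using idx_cyclic_extension[OF N A NA f] by blast
  show ?case unfolding eq
  proof (intro exI[of _ "g # gs"] conjI allI impI)
    show "\<forall>g\<in>set (g # gs). g \<noteq> 0 \<and> g dvd f" using g(1,2) gs(1) by simp
    fix q assume q: "coprime q f" and inj: "\<forall>v\<in>?A + span {c}. q *s v \<in> N \<longrightarrow> v \<in> N"
    have "\<forall>v\<in>?A. q *s v \<in> N \<longrightarrow> v \<in> N" using inj AB by blast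
    then have 1: "idx ?A (N + (*s) q ` ?A) = (\<Prod>g\<leftarrow>gs. idx UNIV (ring.span {g, q}))" using gs(2) q by blast
    have "idx (?A + span {c}) (N + (*s) q ` (?A + span {c})) = idx ?A (N + (*s) q ` ?A) * idx UNIV (ring.span {g, q})"
      using g(3) q inj by blast
    then show "idx (?A + span {c}) (N + (*s) q ` (?A + span {c})) = (\<Prod>g\<leftarrow>g # gs. idx UNIV (ring.span {g, q}))"
      unfolding 1 by simp
  qed
qed

end

lemma cyclic_mod:
  fixes r s p :: nat
  assumes f: "\<And>r. r \<ge> 1 \<Longrightarrow> f (r + p) = f r" and "r \<ge> 1" "s \<ge> 1" "r mod p = s mod p"
  shows "f r = f s"
proof -
  have le: "f r = f s" if "r \<le> s" "r \<ge> 1" "r mod p = s mod p" for r s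
  proof -
    have "p dvd s - r" using mod_eq_dvd_iff_nat[OF that(1), of p] that(3) by simp
    then obtain k where "s - r = p * k" by (elim dvdE)
    then have "s = r + p * k" using that(1) by simp
    then show ?thesis using cyclic_multiple[of f p r k] f that(2) by simp
  qed
  show ?thesis
  proof (cases "r \<le> s")
    case True
    then show ?thesis by (rule le[OF _ assms(2,4)])
  next
    case False
    then have "s \<le> r" by simp
    then show ?thesis by (rule le[OF _ assms(3) assms(4)[symmetric], symmetric])
  qed
qed

text \<open>
  On a residue class modulo a suitable period the greatest common divisor \<open>d\<close> of \<open>f\<close> and \<open>t\<^sup>r - 1\<close>
  is constant, and the cofactor \<open>(t\<^sup>r - 1)/d\<close> is coprime to \<open>f\<close> since \<open>t\<^sup>r - 1\<close> is squarefree.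
\<close>

lemma t_pow_minus_1_class:
  assumes f: "f \<noteq> 0"
  shows "\<exists>N\<ge>1. \<forall>c. \<exists>d f' q b. lead_coeff d = 1 \<and> f = d * f' \<and> (\<forall>r\<ge>1. r mod N = c \<longrightarrow>
    t_pow_minus_1 r = d * q r \<and> coprime (q r) f \<and> (even r \<longleftrightarrow> b))"
proof -
  obtain p where p: "p \<ge> 1" "\<And>r. r \<ge> 1 \<Longrightarrow> gcd f (t_pow_minus_1 (r + p)) = gcd f (t_pow_minus_1 r)"
    using cyclic_seq_gcd[OF f] unfolding cyclic_seq_def by blast
  \<comment> \<open>Doubling the period also fixes the parity of \<open>r\<close>, on which the root
    -1 of \<open>t ^ r - 1\<close> depends.\<close>
  define N where "N = 2 * p"
  have "\<exists>d f' q b. lead_coeff d = 1 \<and> f = d * f' \<and> (\<forall>r\<ge>1. r mod N = c \<longrightarrow>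
    t_pow_minus_1 r = d * q r \<and> coprime (q r) f \<and> (even r \<longleftrightarrow> b))" for c
  proof (cases "\<exists>s\<ge>1. s mod N = c")
    case False
    \<comment> \<open>No positive index lies in this class, so \<open>d = 1\<close> serves
      vacuously.\<close>
    then show ?thesis by (intro exI[of _ 1] exI[of _ f]) auto
  next
    case True
    then obtain s where s: "s \<ge> 1" "s mod N = c" by blast
    define e where "e = gcd f (t_pow_minus_1 s)"
    obtain k where k: "t_pow_minus_1 s = e * k" unfolding e_def using gcd_dvd2 by (metis dvdE)
    \<comment> \<open>\<open>e\<close> divides a monic polynomial, so its leading coefficient is 1
      or -1; multiplying by it makes the divisor monic.\<close>
    have "lead_coeff e * lead_coeff k = 1"
      using lead_coeff_t_pow_minus_1[OF s(1)] unfolding k lead_coeff_mult .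
    then have u: "lead_coeff e * lead_coeff e = 1" by (metis zmult_eq_1_iff mult_minus1 minus_mult_minus mult_1)
    define d where "d = [:lead_coeff e:] * e"
    have d1: "lead_coeff d = 1" unfolding d_def lead_coeff_mult using u by simp
    have "[:lead_coeff e:] * d = [:lead_coeff e * lead_coeff e:] * e" unfolding d_def by simp
    then have e_d: "e = [:lead_coeff e:] * d" unfolding u by (simp add: one_pCons[symmetric])
    have de1: "d dvd e" using dvd_triv_right[of d "[:lead_coeff e:]"] unfolding e_d[symmetric] .
    have de2: "e dvd d" unfolding d_def by (rule dvd_triv_right)
    note de = de1 de2
    have "d dvd f" using de(1) unfolding e_def by (meson dvd_trans gcd_dvd1)
    then obtain f' where f': "f = d * f'" by (elim dvdE)
    have d0: "d \<noteq> 0" using d1 by auto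
    define q where "q r = t_pow_minus_1 r div d" for r
    have "t_pow_minus_1 r = d * q r \<and> coprime (q r) f \<and> (even r \<longleftrightarrow> even c)" if r: "r \<ge> 1" "r mod N = c" for r
    proof -
      have "r mod p = s mod p" using r(2) s(2) unfolding N_def by (metis mod_mult_self2_is_0 mod_mod_cancel dvd_triv_right)
      then have er: "e = gcd f (t_pow_minus_1 r)"
        unfolding e_def using cyclic_mod[of "\<lambda>r. gcd f (t_pow_minus_1 r)" p r s] p(2) r(1) s(1) by simp
      have "d dvd t_pow_minus_1 r" using de(1) unfolding er by (meson dvd_trans gcd_dvd2)
      then have dq: "t_pow_minus_1 r = d * q r" unfolding q_def by (simp only: dvd_mult_div_cancel)
      have cdq: "coprime d (q r)" by (rule t_pow_minus_1_squarefree[OF dq r(1)])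
      \<comment> \<open>For a common factor \<open>x\<close> of the cofactors, \<open>d * x\<close>
        divides \<open>f\<close> and \<open>t ^ r - 1\<close>, hence their gcd, which is associated
        to \<open>d\<close>.\<close>
      have "coprime f' (q r)"
      proof (rule coprimeI)
        fix x assume "x dvd f'" "x dvd q r"
        then have "d * x dvd d * f'" and "d * x dvd d * q r" by (simp_all only: mult_dvd_mono dvd_refl)
        then have "d * x dvd f" "d * x dvd t_pow_minus_1 r" unfolding dq f'[symmetric] by blast+
        then have "d * x dvd e" unfolding er by (rule gcd_greatest)
        then have "d * x dvd d * 1" using de(2) by (metis dvd_trans mult_1_right)
        then show "is_unit x" using d0 by (simp only: dvd_mult_cancel_left) blast
      qed
      then have "coprime (q r) f" using cdq unfolding f' by (simp add: coprime_commute)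
      moreover have "even r \<longleftrightarrow> even c" using r(2) unfolding N_def by (metis dvd_mod_iff dvd_triv_left)
      ultimately show ?thesis using dq by blast
    qed
    then show ?thesis using d1 f' by blast
  qed
  then show ?thesis using p(1) by (intro exI[of _ N]) (simp add: N_def)
qed

context zt_module begin

text \<open>The product of multipliers for the single generators serves for all of them, because
  scalars commute.\<close>

lemma common_annihilator:
  assumes "finite C" "\<And>c. c \<in> C \<Longrightarrow> \<exists>g. g \<noteq> 0 \<and> g *s c \<in> N" and N: "subspace N"
  shows "\<exists>f. f \<noteq> 0 \<and> (\<forall>v\<in>span C. f *s v \<in> N)"
proof -
  have "\<exists>f. f \<noteq> 0 \<and> (\<forall>c\<in>C. f *s c \<in> N)"
    using assms(1,2)
  proof (induction C rule: finite_induct)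
    case empty show ?case by (intro exI[of _ 1]) auto
  next
    case (insert c C)
    then obtain f where f: "f \<noteq> 0" "\<forall>c\<in>C. f *s c \<in> N" by auto
    obtain g where g: "g \<noteq> 0" "g *s c \<in> N" using insert.prems by blast
    have "(f * g) *s x \<in> N" if "x \<in> insert c C" for x
    proof (cases "x = c")
      case True
      then show ?thesis using subspace_scale[OF N g(2), of f] by simp
    next
      case False
      then have "f *s x \<in> N" using f(2) that by blast
      from subspace_scale[OF N this, of g] show ?thesis by (simp add: mult.commute)
    qed
    then show ?case using f(1) g(1) by (intro exI[of _ "f * g"]) auto
  qed
  then obtain f where f: "f \<noteq> 0" "\<forall>c\<in>C. f *s c \<in> N" by blast
  have "span C \<subseteq> {v. f *s v \<in> N}"
  proof (rule span_minimal)
    show "C \<subseteq> {v. f *s v \<in> N}" using f(2) by blast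
    show "subspace {v. f *s v \<in> N}"
    proof (rule subspaceI)
      show "0 \<in> {v. f *s v \<in> N}" using subspace_0[OF N] by simp
      show "x + y \<in> {v. f *s v \<in> N}" if "x \<in> {v. f *s v \<in> N}" "y \<in> {v. f *s v \<in> N}" for x y
        using that subspace_add[OF N] unfolding mem_Collect_eq scale_right_distrib by blast
      show "k *s x \<in> {v. f *s v \<in> N}" if "x \<in> {v. f *s v \<in> N}" for k x
        using that subspace_scale[OF N, of "f *s x" k] unfolding mem_Collect_eq scale_left_commute[of f k x] by blast
    qed
  qed
  then show ?thesis using f(1) by blast
qed

text \<open>On a residue class write \<open>t ^ r - 1 = d * q r\<close>. Replacing
  \<open>t ^ r - 1\<close> by \<open>d\<close> does not change the saturation, so the index is a
  constant times the index of N + q(P) in P, where P is N + d(T). The latter is a product of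
  resultants, since \<open>q r\<close> acts injectively on T/N.\<close>

lemma lin_rec_idx_torsion:
  assumes N: "subspace N" and T: "subspace T" and NT: "N \<subseteq> T" and C: "finite C" "T = span C"
    and pure: "\<And>n v. n \<noteq> 0 \<Longrightarrow> v \<in> T \<Longrightarrow> [:n:] *s v \<in> N \<Longrightarrow> v \<in> N"
    and f: "f \<noteq> 0" "\<And>v. v \<in> T \<Longrightarrow> f *s v \<in> N"
  shows "cyclic_seq (\<lambda>r. zsat T (N + (*s) (t_pow_minus_1 r) ` T))" (is ?A)
    and "lin_rec (\<lambda>r. of_nat (idx (zsat T (N + (*s) (t_pow_minus_1 r) ` T)) (N + (*s) (t_pow_minus_1 r) ` T)))" (is ?B)
proof -
  let ?D = "\<lambda>a. N + (*s) a ` T"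
  have sD: "subspace (?D a)" for a by (rule subspace_set_plus[OF N subspace_scale_image[OF T]])
  have DT: "?D a \<subseteq> T" for a
    using NT subspace_scale[OF T] by (intro set_plus_subset_sgrp subspace_sgrp[OF T]) auto
  obtain M where M: "M \<ge> 1" and cl: "\<And>c. \<exists>d f' q b. lead_coeff d = 1 \<and> f = d * f' \<and> (\<forall>r\<ge>1. r mod M = c \<longrightarrow>
    t_pow_minus_1 r = d * q r \<and> coprime (q r) f \<and> (even r \<longleftrightarrow> b))"
    using t_pow_minus_1_class[OF f(1)] by blast
  have sat: "zsat T (?D (t_pow_minus_1 r)) = zsat T (?D d)"
    if dq: "t_pow_minus_1 r = d * q" "coprime q f" "f = d * f'" for r d q f'
  proof
    have "?D (t_pow_minus_1 r) \<subseteq> ?D d"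
    proof (rule set_plus_mono2[OF subset_refl], rule subsetI)
      fix x assume "x \<in> (*s) (t_pow_minus_1 r) ` T"
      then obtain w where w: "w \<in> T" "x = d *s (q *s w)" unfolding dq(1) by auto
      then show "x \<in> (*s) d ` T" using subspace_scale[OF T w(1)] by blast
    qed
    then show "zsat T (?D (t_pow_minus_1 r)) \<subseteq> zsat T (?D d)" unfolding zsat_def by blast
    show "zsat T (?D d) \<subseteq> zsat T (?D (t_pow_minus_1 r))"
    proof
      fix v assume v: "v \<in> zsat T (?D d)"
      then obtain n where n: "n \<noteq> 0" "v \<in> T" "[:n:] *s v \<in> ?D d" unfolding zsat_def by blast
      from iffD1[OF mem_set_plus_iff n(3)] obtain w where w: "w \<in> T" "[:n:] *s v - d *s w \<in> N" by blast
      have f'0: "f' \<noteq> 0" using f(1) dq(3) by auto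
      have "coprime f' q" using dq(2) unfolding dq(3) by (simp add: coprime_commute)
      then obtain c x y where c: "c \<noteq> 0" "[:c:] = x * f' + y * q" using int_poly_bezout[OF _ f'0] by metis
      have "[:c * n:] *s v = [:c:] *s ([:n:] *s v - d *s w) + ([:c:] * d) *s w"
      proof -
        have "[:c * n:] = [:c:] * [:n:]" by simp
        then show ?thesis by (simp only: scale_right_diff_distrib scale_scale diff_add_cancel)
      qed
      also have "[:c:] * d = x * f + t_pow_minus_1 r * y"
        unfolding c(2) dq(1) dq(3) by (simp only: distrib_left distrib_right mult.assoc mult.commute mult.left_commute)
      also have "(x * f + t_pow_minus_1 r * y) *s w = x *s (f *s w) + t_pow_minus_1 r *s (y *s w)"
        by (simp only: scale_left_distrib scale_scale)
      finally have "[:c * n:] *s v - t_pow_minus_1 r *s (y *s w) = [:c:] *s ([:n:] *s v - d *s w) + x *s (f *s w)"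
        by (simp only: add.assoc[symmetric] add_diff_cancel_right')
      also have "\<dots> \<in> N" by (intro subspace_add[OF N] subspace_scale[OF N] w f)
      finally have "[:c * n:] *s v \<in> ?D (t_pow_minus_1 r)"
        using subspace_scale[OF T w(1)] by (intro iffD2[OF mem_set_plus_iff]) blast
      then show "v \<in> zsat T (?D (t_pow_minus_1 r))"
        unfolding zsat_def using n(1,2) c(1) by (intro CollectI conjI exI[of _ "c * n"]) auto
    qed
  qed
  show ?A unfolding cyclic_seq_def
  proof (intro exI[of _ M] conjI M allI impI)
    fix r :: nat assume r: "r \<ge> 1"
    obtain d f' q b where d: "f = d * f'" "\<forall>s\<ge>1. s mod M = r mod M \<longrightarrow>
      t_pow_minus_1 s = d * q s \<and> coprime (q s) f \<and> (even s \<longleftrightarrow> b)" using cl[of "r mod M"] by blast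
    have "zsat T (?D (t_pow_minus_1 s)) = zsat T (?D d)" if "s \<ge> 1" "s mod M = r mod M" for s
      using sat[of s d "q s" f'] d that by blast
    from this[of r] this[of "r + M"] r
    show "zsat T (?D (t_pow_minus_1 (r + M))) = zsat T (?D (t_pow_minus_1 r))" by simp
  qed
  show ?B
  proof (rule lin_rec_glue[OF M])
    fix c
    obtain d f' q b where d1: "lead_coeff d = 1" and ff: "f = d * f'" and
      d: "\<forall>r\<ge>1. r mod M = c \<longrightarrow> t_pow_minus_1 r = d * q r \<and> coprime (q r) f \<and> (even r \<longleftrightarrow> b)" using cl[of c] by blast
    let ?P = "?D d"
    \<comment> \<open>\<open>?P\<close> does not depend on \<open>r\<close> within the class, so the
      list \<open>gs\<close> below serves the whole class.\<close>
    obtain C' where C': "finite C'" "?P = span C'" using subspace_of_span_finite[OF C(1) sD, of d] DT C(2) by blast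
    have PT: "?P \<subseteq> T" by (rule DT)
    have C'T: "f *s x \<in> N" if "x \<in> C'" for x using f(2) PT C'(2) span_base[OF that] by blast
    have NP: "N \<subseteq> ?P" by (rule set_plus_left_subset[OF subspace_sgrp[OF subspace_scale_image[OF T]]])
    have "N + span C' = ?P"
    proof
      show "N + span C' \<subseteq> ?P" using NP C'(2) by (intro set_plus_subset_sgrp subspace_sgrp[OF sD]) auto
      show "?P \<subseteq> N + span C'" unfolding C'(2) by (rule set_plus_right_subset[OF subspace_sgrp[OF N]])
    qed
    then obtain gs where gs: "\<forall>g\<in>set gs. g \<noteq> 0 \<and> g dvd f" "\<forall>q. coprime q f \<longrightarrow> (\<forall>v\<in>?P. q *s v \<in> N \<longrightarrow> v \<in> N) \<longrightarrow>
        idx ?P (N + (*s) q ` ?P) = (\<Prod>g\<leftarrow>gs. idx UNIV (ring.span {g, q}))"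
      using idx_finitely_generated[OF N f(1) C'(1) C'T] by auto
    have "\<exists>E. lin_rec E \<and> (\<forall>r\<in>{r. r \<ge> 1 \<and> r mod M = c}. of_nat (idx UNIV (ring.span {g, q r})) = E r)" if "g \<in> set gs" for g
    proof (rule lin_rec_idx_class[OF _ d1])
      show "g \<noteq> 0" using gs(1) that by blast
      fix r assume "r \<in> {r. r \<ge> 1 \<and> r mod M = c}"
      then have r: "r \<ge> 1" "r mod M = c" by auto
      have cf: "coprime (q r) f" using d r by blast
      have gf: "g dvd f" using gs(1) that by blast
      have "coprime (q r) g" by (rule coprime_divisors[OF dvd_refl gf cf])
      then show "r \<ge> 1 \<and> t_pow_minus_1 r = d * q r \<and> coprime (q r) g \<and> (even r \<longleftrightarrow> b)" using d r by blast
    qed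
    then obtain E where E: "\<And>g. g \<in> set gs \<Longrightarrow> lin_rec (E g)"
        "\<And>g r. g \<in> set gs \<Longrightarrow> r \<ge> 1 \<Longrightarrow> r mod M = c \<Longrightarrow> of_nat (idx UNIV (ring.span {g, q r})) = E g r"
      by (metis (mono_tags, lifting) mem_Collect_eq)
    define F where "F = (\<lambda>r. of_nat (idx (zsat T ?P) ?P) * (\<Prod>g\<leftarrow>gs. E g r))"
    have "lin_rec F" unfolding F_def by (intro lin_rec_cmult lin_rec_prod_list E)
    moreover have "of_nat (idx (zsat T (?D (t_pow_minus_1 r))) (?D (t_pow_minus_1 r))) = F r" if r: "r \<ge> 1" "r mod M = c" for r
    proof -
      have dq: "t_pow_minus_1 r = d * q r" and cop: "coprime (q r) f" using d r by auto
      have "?D (t_pow_minus_1 r) = N + (*s) (q r) ` ?P"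
      proof
        show "?D (t_pow_minus_1 r) \<subseteq> N + (*s) (q r) ` ?P"
        proof (rule set_plus_mono2[OF subset_refl], rule subsetI)
          fix x assume "x \<in> (*s) (t_pow_minus_1 r) ` T"
          then obtain w where w: "w \<in> T" "x = q r *s (d *s w)" unfolding dq by (auto simp: mult.commute)
          have "d *s w \<in> ?P"
            by (rule subsetD[OF set_plus_right_subset[OF subspace_sgrp[OF N]] imageI[OF w(1)]])
          then show "x \<in> (*s) (q r) ` ?P" using w(2) by blast
        qed
        show "N + (*s) (q r) ` ?P \<subseteq> ?D (t_pow_minus_1 r)"
        proof (rule set_plus_subset_sgrp[OF subspace_sgrp[OF sD]])
          show "N \<subseteq> ?D (t_pow_minus_1 r)" by (rule set_plus_left_subset[OF subspace_sgrp[OF subspace_scale_image[OF T]]])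
          show "(*s) (q r) ` ?P \<subseteq> ?D (t_pow_minus_1 r)"
          proof
            fix x assume "x \<in> (*s) (q r) ` ?P"
            then obtain y where y: "y \<in> ?P" "x = q r *s y" by blast
            from iffD1[OF mem_set_plus_iff y(1)] obtain w where w: "w \<in> T" "y - d *s w \<in> N" by blast
            have "x - t_pow_minus_1 r *s w = q r *s (y - d *s w)"
              unfolding y(2) dq by (simp add: scale_right_diff_distrib mult.commute)
            also have "\<dots> \<in> N" by (rule subspace_scale[OF N w(2)])
            finally show "x \<in> ?D (t_pow_minus_1 r)" using w(1) by (intro iffD2[OF mem_set_plus_iff]) blast
          qed
        qed
      qed
      note eq = this
      \<comment> \<open>Together with \<open>f\<close>, the polynomial \<open>q r\<close> generates
        a nonzero integer; that integer sends \<open>v\<close> into \<open>N\<close> and is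
        cancelled by purity.\<close>
      have "v \<in> N" if v: "v \<in> ?P" "q r *s v \<in> N" for v
      proof -
        have vT: "v \<in> T" using v(1) PT by blast
        obtain c x y where c: "c \<noteq> 0" "[:c:] = x * f + y * q r"
          using int_poly_bezout[of f "q r"] cop f(1) by (metis coprime_commute)
        have "[:c:] *s v = x *s (f *s v) + y *s (q r *s v)" unfolding c(2) by (simp only: scale_left_distrib scale_scale)
        also have "\<dots> \<in> N" by (intro subspace_add[OF N] subspace_scale[OF N] v f vT)
        finally show ?thesis using pure[OF c(1) vT] by blast
      qed
      then have 1: "idx ?P (N + (*s) (q r) ` ?P) = (\<Prod>g\<leftarrow>gs. idx UNIV (ring.span {g, q r}))" using gs(2) cop by blast
      have "?D (t_pow_minus_1 r) \<subseteq> ?P"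
        unfolding eq using NP subspace_scale[OF sD] by (intro set_plus_subset_sgrp subspace_sgrp[OF sD]) auto
      then have "idx (zsat T ?P) (?D (t_pow_minus_1 r)) = idx (zsat T ?P) ?P * idx ?P (?D (t_pow_minus_1 r))"
        by (intro idx_tower subspace_sgrp subspace_zsat T sD subset_zsat DT)
      moreover have "zsat T (?D (t_pow_minus_1 r)) = zsat T ?P" by (rule sat[OF dq cop ff])
      ultimately have "idx (zsat T (?D (t_pow_minus_1 r))) (?D (t_pow_minus_1 r)) = idx (zsat T ?P) ?P * (\<Prod>g\<leftarrow>gs. idx UNIV (ring.span {g, q r}))"
        using 1 eq by simp
      moreover have "(\<Prod>g\<leftarrow>gs. of_nat (idx UNIV (ring.span {g, q r}))) = (\<Prod>g\<leftarrow>gs. E g r)"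
        by (rule arg_cong[of _ _ prod_list], rule map_cong[OF refl]) (rule E(2)[OF _ r])
      moreover have "of_nat (\<Prod>g\<leftarrow>gs. idx UNIV (ring.span {g, q r})) = (\<Prod>g\<leftarrow>gs. complex_of_nat (idx UNIV (ring.span {g, q r})))"
        by (induction gs) auto
      ultimately show ?thesis unfolding F_def by (simp only: of_nat_mult)
    qed
    ultimately show "\<exists>E. lin_rec E \<and> (\<forall>r\<ge>1. r mod M = c \<longrightarrow>
        of_nat (idx (zsat T (?D (t_pow_minus_1 r))) (?D (t_pow_minus_1 r))) = E r)" by blast
  qed
qed

end

section \<open>Modules with torsion-free additive group\<close>

context zt_module begin

text \<open>A family of generators that is maximal among those independent modulo \<open>N\<close>.\<close>

lemma independent_family:
  assumes N: "subspace N" and "finite C"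
  shows "\<exists>B g. finite B \<and> B \<subseteq> C \<and> g \<noteq> 0 \<and> (\<forall>v\<in>span C. \<exists>a. g *s v - (\<Sum>b\<in>B. a b *s b) \<in> N) \<and>
    (\<forall>a. (\<Sum>b\<in>B. a b *s b) \<in> N \<longrightarrow> (\<forall>b\<in>B. a b = 0))"
proof -
  define indep where "indep B \<longleftrightarrow> (\<forall>a. (\<Sum>b\<in>B. a b *s b) \<in> N \<longrightarrow> (\<forall>b\<in>B. a b = 0))" for B
  have "indep {}" by (simp add: indep_def)
  then have "\<exists>B. (B \<subseteq> C \<and> indep B) \<and> (\<forall>B'. B' \<subseteq> C \<and> indep B' \<longrightarrow> card B' \<le> card B)"
    using card_mono[OF assms(2)]
    by (intro ex_has_greatest_nat[of "\<lambda>B. B \<subseteq> C \<and> indep B" "{}" card "Suc (card C)"]) (auto simp: less_Suc_eq_le)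
  then obtain B where B: "B \<subseteq> C" "indep B" and max: "\<And>B'. B' \<subseteq> C \<Longrightarrow> indep B' \<Longrightarrow> card B' \<le> card B" by blast
  have fB: "finite B" using B(1) assms(2) by (rule finite_subset)
  define V where "V = {w. \<exists>a. w - (\<Sum>b\<in>B. a b *s b) \<in> N}"
  have V: "subspace V"
  proof (rule subspaceI)
    show "0 \<in> V" unfolding V_def using subspace_0[OF N] by (intro CollectI exI[of _ "\<lambda>_. 0"]) simp
  next
    fix x y assume "x \<in> V" "y \<in> V"
    then obtain a a' where a: "x - (\<Sum>b\<in>B. a b *s b) \<in> N" "y - (\<Sum>b\<in>B. a' b *s b) \<in> N" unfolding V_def by blast
    have "x + y - (\<Sum>b\<in>B. (a b + a' b) *s b) = (x - (\<Sum>b\<in>B. a b *s b)) + (y - (\<Sum>b\<in>B. a' b *s b))"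
      by (simp add: scale_left_distrib sum.distrib)
    then have "x + y - (\<Sum>b\<in>B. (a b + a' b) *s b) \<in> N" using subspace_add[OF N a] by (simp only:)
    then show "x + y \<in> V" unfolding V_def by (intro CollectI exI[of _ "\<lambda>b. a b + a' b"])
  next
    fix c x assume "x \<in> V"
    then obtain a where a: "x - (\<Sum>b\<in>B. a b *s b) \<in> N" unfolding V_def by blast
    have "c *s x - (\<Sum>b\<in>B. (c * a b) *s b) = c *s (x - (\<Sum>b\<in>B. a b *s b))"
      by (simp add: scale_right_diff_distrib scale_sum_right)
    then have "c *s x - (\<Sum>b\<in>B. (c * a b) *s b) \<in> N" using subspace_scale[OF N a] by (simp only:)
    then show "c *s x \<in> V" unfolding V_def by (intro CollectI exI[of _ "\<lambda>b. c * a b"])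
  qed
  have "\<exists>g. g \<noteq> 0 \<and> g *s c \<in> V" if c: "c \<in> C" for c
  proof (cases "c \<in> B")
    case True
    have "(\<Sum>b\<in>B. (if b = c then 1 else 0) *s b) = (\<Sum>b\<in>B. if b = c then c else 0)"
      by (rule sum.cong) auto
    also have "\<dots> = c" using True fB by simp
    finally have "c \<in> V" unfolding V_def using subspace_0[OF N]
      by (intro CollectI exI[of _ "\<lambda>b. if b = c then 1 else 0"]) simp
    then show ?thesis by (intro exI[of _ 1]) simp
  next
    case False
    \<comment> \<open>By maximality \<open>insert c B\<close> is dependent. Since \<open>B\<close>
      is not, the coefficient of \<open>c\<close> in a relation is nonzero and supplies the
      multiplier.\<close>
    then have "card (insert c B) > card B" using fB by simp
    then have "\<not> indep (insert c B)" using max[of "insert c B"] B(1) c by (meson insert_subset not_le)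
    then obtain a where a: "(\<Sum>b\<in>insert c B. a b *s b) \<in> N" "\<not> (\<forall>b\<in>insert c B. a b = 0)" unfolding indep_def by blast
    have s: "(\<Sum>b\<in>insert c B. a b *s b) = a c *s c + (\<Sum>b\<in>B. a b *s b)" using fB False by (rule sum.insert)
    have "a c \<noteq> 0"
    proof
      assume "a c = 0"
      then have "(\<Sum>b\<in>B. a b *s b) \<in> N" using a(1) unfolding s by simp
      then have "\<forall>b\<in>B. a b = 0" using B(2) unfolding indep_def by blast
      then show False using a(2) \<open>a c = 0\<close> by blast
    qed
    moreover have "a c *s c - (\<Sum>b\<in>B. (- a b) *s b) \<in> N" using a(1) unfolding s by (simp add: sum_negf)
    then have "a c *s c \<in> V" unfolding V_def by (intro CollectI exI[of _ "\<lambda>b. - a b"])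
    ultimately show ?thesis by blast
  qed
  from common_annihilator[OF assms(2) this V]
  obtain g where g: "g \<noteq> 0" "\<forall>v\<in>span C. g *s v \<in> V" by blast
  have "\<forall>v\<in>span C. \<exists>a. g *s v - (\<Sum>b\<in>B. a b *s b) \<in> N" using g(2) unfolding V_def by blast
  then show ?thesis using fB B g(1) unfolding indep_def by blast
qed

end

text \<open>A nonzero integer is coprime to the monic \<open>t ^ r - 1\<close>; so the ring modulo
  \<open>t ^ r - 1\<close> is torsion-free as a group.\<close>

lemma t_pow_minus_1_dvd_cancel:
  assumes "[:n:] * c = t_pow_minus_1 r * e" "n \<noteq> 0" "r \<ge> 1" shows "t_pow_minus_1 r dvd c"
proof -
  have "t_pow_minus_1 r dvd [:n:] * c" unfolding assms(1) by (rule dvd_triv_left)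
  moreover have "coprime (t_pow_minus_1 r) [:n:]" using coprime_const_t_pow_minus_1[OF assms(2,3)] by (rule coprime_imp_coprime) auto
  ultimately show ?thesis by (simp only: coprime_dvd_mult_right_iff)
qed

text \<open>
  \<open>M = W/N\<close> is a finitely generated module whose additive group is torsion-free; \<open>T\<close> is the
  preimage of its torsion submodule.
\<close>

locale pure_quotient = zt_module +
  fixes N W C T
  assumes N: "subspace N" and C: "finite C" and W: "W = span C" and NW: "N \<subseteq> W"
    and pure: "\<And>n v. n \<noteq> 0 \<Longrightarrow> v \<in> W \<Longrightarrow> [:n:] *s v \<in> N \<Longrightarrow> v \<in> N"
  defines "T \<equiv> {v \<in> W. \<exists>g. g \<noteq> 0 \<and> g *s v \<in> N}"
begin

lemma sW: "subspace W" unfolding W by (rule subspace_span)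

lemma sT: "subspace T"
proof (rule subspaceI)
  show "0 \<in> T" unfolding T_def using subspace_0[OF sW] subspace_0[OF N] by (intro CollectI conjI exI[of _ 1]) auto
next
  fix x y assume "x \<in> T" "y \<in> T"
  then obtain g h where *: "x \<in> W" "y \<in> W" "g \<noteq> 0" "h \<noteq> 0" "g *s x \<in> N" "h *s y \<in> N" unfolding T_def by blast
  have "(g * h) *s (x + y) = h *s (g *s x) + g *s (h *s y)" by (simp add: scale_right_distrib mult.commute)
  also have "\<dots> \<in> N" by (intro subspace_add[OF N] subspace_scale[OF N] *)
  finally show "x + y \<in> T" unfolding T_def using * subspace_add[OF sW *(1,2)] by (intro CollectI conjI exI[of _ "g * h"]) auto
next
  fix c x assume "x \<in> T"
  then obtain g where *: "x \<in> W" "g \<noteq> 0" "g *s x \<in> N" unfolding T_def by blast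
  have "g *s (c *s x) = c *s (g *s x)" by (rule scale_left_commute)
  also have "\<dots> \<in> N" by (rule subspace_scale[OF N *(3)])
  finally show "c *s x \<in> T" unfolding T_def using * subspace_scale[OF sW *(1)] by (intro CollectI conjI exI[of _ g]) auto
qed

lemma NT: "N \<subseteq> T" unfolding T_def using NW by (intro subsetI CollectI conjI exI[of _ 1]) auto

lemma TW: "T \<subseteq> W" unfolding T_def by blast

text \<open>A multiplier for \<open>g *s v\<close> composes with \<open>g\<close>, and
  \<open>int poly\<close> has no zero divisors. Hence W/T is torsion-free as a module.\<close>

lemma T_cancel: "v \<in> W \<Longrightarrow> g \<noteq> 0 \<Longrightarrow> g *s v \<in> T \<Longrightarrow> v \<in> T"
proof -
  assume v: "v \<in> W" "g \<noteq> 0" "g *s v \<in> T"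
  then obtain h where h: "h \<noteq> 0" "h *s (g *s v) \<in> N" unfolding T_def by blast
  then have "(h * g) *s v \<in> N" by simp
  then show ?thesis unfolding T_def using v h(1) by (intro CollectI conjI exI[of _ "h * g"]) auto
qed

abbreviation "D r \<equiv> N + (*s) (t_pow_minus_1 r) ` W"
abbreviation "L r \<equiv> zsat W (D r)"
abbreviation "DT r \<equiv> N + (*s) (t_pow_minus_1 r) ` T"
abbreviation "LT r \<equiv> zsat T (DT r)"

lemma sD: "subspace (D r)" by (rule subspace_set_plus[OF N subspace_scale_image[OF sW]])
lemma sDT: "subspace (DT r)" by (rule subspace_set_plus[OF N subspace_scale_image[OF sT]])
lemma sL: "subspace (L r)" by (rule subspace_zsat[OF sW sD])
lemma sLT: "subspace (LT r)" by (rule subspace_zsat[OF sT sDT])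

lemma DW: "D r \<subseteq> W"
  using NW subspace_scale[OF sW] by (intro set_plus_subset_sgrp subspace_sgrp[OF sW]) auto

lemma DL: "D r \<subseteq> L r" by (rule subset_zsat[OF DW])

lemma ND: "N \<subseteq> D r" by (rule set_plus_left_subset[OF subspace_sgrp[OF subspace_scale_image[OF sW]]])

lemma scale_mem_D: "w \<in> W \<Longrightarrow> t_pow_minus_1 r *s w \<in> D r"
  using set_plus_right_subset[OF subspace_sgrp[OF N]] by blast

lemma mem_D: "v \<in> D r \<Longrightarrow> \<exists>w\<in>W. v - t_pow_minus_1 r *s w \<in> N"
  using iffD1[OF mem_set_plus_iff] by blast

lemma mem_DI: "w \<in> W \<Longrightarrow> v - t_pow_minus_1 r *s w \<in> N \<Longrightarrow> v \<in> D r"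
  by (rule iffD2[OF mem_set_plus_iff]) blast

text \<open>If \<open>t ^ r - 1\<close> sends \<open>w\<close> into \<open>T\<close>, then
  \<open>w\<close> lies in \<open>T\<close>, because W/T is torsion-free. So T/N modulo
  \<open>t ^ r - 1\<close> embeds into W/N modulo \<open>t ^ r - 1\<close>.\<close>

lemma T_Int_D: assumes "r \<ge> 1" shows "T \<inter> D r = DT r"
proof
  show "DT r \<subseteq> T \<inter> D r"
    using NT TW subspace_scale[OF sT] by (intro Int_greatest set_plus_subset_sgrp[OF subspace_sgrp[OF sT]] set_plus_mono2) auto
  show "T \<inter> D r \<subseteq> DT r"
  proof
    fix v assume v: "v \<in> T \<inter> D r"
    then obtain w where w: "w \<in> W" "v - t_pow_minus_1 r *s w \<in> N" using mem_D by blast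
    have "t_pow_minus_1 r *s w = v - (v - t_pow_minus_1 r *s w)" by simp
    also have "\<dots> \<in> T"
      by (rule subspace_diff[OF sT]) (use v w(2) NT in blast)+
    finally have "w \<in> T" by (rule T_cancel[OF w(1) t_pow_minus_1_nonzero[OF assms]])
    then show "v \<in> DT r" using w(2) by (intro iffD2[OF mem_set_plus_iff]) blast
  qed
qed

lemma mem_LT: assumes "r \<ge> 1" shows "v \<in> LT r \<longleftrightarrow> v \<in> T \<and> v \<in> L r"
proof -
  have "[:n:] *s v \<in> D r \<longleftrightarrow> [:n:] *s v \<in> DT r" if "v \<in> T" for n
    using T_Int_D[OF assms] subspace_scale[OF sT that] by blast
  then show ?thesis using TW unfolding zsat_def by blast
qed

text \<open>The torsion of the quotient of \<open>W\<close> by \<open>D r\<close> is cut along the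
  image of \<open>T\<close>. The first factor belongs to the torsion module T/N and is covered by
  \<open>lin_rec_idx_torsion\<close>; the second will turn out to be periodic.\<close>

lemma idx_split:
  assumes r: "r \<ge> 1"
  shows "idx (L r) (D r) = idx (LT r) (DT r) * idx (L r) (LT r + D r)"
proof -
  note sg = subspace_sgrp[OF sL] subspace_sgrp[OF sD] subspace_sgrp[OF sLT]
  have "idx (L r) (D r) = idx (L r) (LT r + D r) * idx (LT r + D r) (D r)"
  proof (rule idx_tower[OF sg(1) sgrp_set_plus[OF sg(3,2)] sg(2)])
    show "D r \<subseteq> LT r + D r" by (rule set_plus_right_subset[OF sg(3)])
    show "LT r + D r \<subseteq> L r" 
      by (rule set_plus_subset_sgrp[OF sg(1) _ DL]) (use mem_LT[OF r] in blast)
  qed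
  also have "idx (LT r + D r) (D r) = idx (LT r) (LT r \<inter> D r)" by (rule idx_set_plus[OF sg(3,2)])
  also have "LT r \<inter> D r = DT r" using T_Int_D[OF r] mem_LT[OF r] DL by blast
  finally show ?thesis by (simp add: mult.commute)
qed

text \<open>After multiplication by a fixed \<open>g\<close>, elements of \<open>W\<close> lie
  modulo \<open>N\<close> in a free module, and a free module modulo \<open>t ^ r - 1\<close> has no
  additive torsion. So \<open>g\<close> kills the torsion of W modulo \<open>D r\<close> for all
  positive \<open>r\<close> at once.\<close>

lemma uniform_multiple_poly:
  "\<exists>g. g \<noteq> 0 \<and> (\<forall>r\<ge>1. \<forall>v\<in>L r. g *s v \<in> D r)"
proof -
  obtain B g where B: "finite B" "B \<subseteq> C" and g: "g \<noteq> 0" "\<forall>v\<in>span C. \<exists>a. g *s v - (\<Sum>b\<in>B. a b *s b) \<in> N"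
    and ind: "\<forall>a. (\<Sum>b\<in>B. a b *s b) \<in> N \<longrightarrow> (\<forall>b\<in>B. a b = 0)"
    using independent_family[OF N C] by blast
  have "g *s v \<in> D r" if r: "r \<ge> 1" and v: "v \<in> L r" for r v
  proof -
    obtain n where n: "n \<noteq> 0" "v \<in> W" "[:n:] *s v \<in> D r" using v unfolding zsat_def by blast
    obtain w where w: "w \<in> W" "[:n:] *s v - t_pow_minus_1 r *s w \<in> N" using mem_D[OF n(3)] by blast
    obtain a where a: "g *s v - (\<Sum>b\<in>B. a b *s b) \<in> N" using g(2) n(2) W by blast
    obtain e where e: "g *s w - (\<Sum>b\<in>B. e b *s b) \<in> N" using g(2) w(1) W by blast
    have "(\<Sum>b\<in>B. ([:n:] * a b - t_pow_minus_1 r * e b) *s b) =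
        [:n:] *s (\<Sum>b\<in>B. a b *s b) - t_pow_minus_1 r *s (\<Sum>b\<in>B. e b *s b)"
      by (simp only: scale_left_diff_distrib sum_subtractf scale_sum_right scale_scale)
    also have "\<dots> = g *s ([:n:] *s v - t_pow_minus_1 r *s w) - [:n:] *s (g *s v - (\<Sum>b\<in>B. a b *s b))
        + t_pow_minus_1 r *s (g *s w - (\<Sum>b\<in>B. e b *s b))"
      by (simp only: scale_right_diff_distrib scale_left_commute[of g "[:n:]"] scale_left_commute[of g "t_pow_minus_1 r"]) simp
    also have "\<dots> \<in> N" by (intro subspace_add[OF N] subspace_diff[OF N] subspace_scale[OF N] w a e)
    finally have "\<forall>b\<in>B. [:n:] * a b - t_pow_minus_1 r * e b = 0"
      using ind[rule_format, of "\<lambda>b. [:n:] * a b - t_pow_minus_1 r * e b"] by blast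
    then have "t_pow_minus_1 r dvd a b" if "b \<in> B" for b
      using t_pow_minus_1_dvd_cancel[OF _ n(1) r, of "a b" "e b"] that by simp
    then have "\<forall>b\<in>B. \<exists>c. a b = t_pow_minus_1 r * c" unfolding dvd_def by blast
    then obtain c where c: "\<forall>b\<in>B. a b = t_pow_minus_1 r * c b" by metis
    have "(\<Sum>b\<in>B. a b *s b) = t_pow_minus_1 r *s (\<Sum>b\<in>B. c b *s b)"
      unfolding scale_sum_right scale_scale by (rule sum.cong) (use c in auto)
    then have "g *s v - t_pow_minus_1 r *s (\<Sum>b\<in>B. c b *s b) \<in> N" using a by (simp only:)
    moreover have "(\<Sum>b\<in>B. c b *s b) \<in> W"
      unfolding W using B(2) by (intro span_sum span_scale span_base) blast
    ultimately show ?thesis by (intro mem_DI)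
  qed
  then show ?thesis using g(1) by blast
qed

text \<open>By \<open>uniform_multiple_poly\<close>, \<open>g *s v\<close> is congruent modulo
  \<open>N\<close> to \<open>t ^ r - 1\<close> times some \<open>w\<close>, and some nonzero integer
  sends \<open>w\<close> into \<open>?Q\<close>. The saturation of \<open>?Q\<close> is finitely
  generated, so one integer \<open>n\<close> serves for all \<open>r\<close> and \<open>v\<close>;
  cancelling \<open>g\<close> modulo \<open>T\<close> leaves the claim.\<close>

lemma uniform_multiple_int:
  "\<exists>n::int. n > 0 \<and> (\<forall>r\<ge>1. \<forall>v\<in>L r. \<exists>w\<in>W. [:n:] *s v - t_pow_minus_1 r *s w \<in> T)"
proof -
  obtain g where g: "g \<noteq> 0" "\<forall>r\<ge>1. \<forall>v\<in>L r. g *s v \<in> D r" using uniform_multiple_poly by blast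
  let ?Q = "T + (*s) g ` W"
  have Q: "subspace ?Q" by (rule subspace_set_plus[OF sT subspace_scale_image[OF sW]])
  have QW: "?Q \<subseteq> W" using TW subspace_scale[OF sW] by (intro set_plus_subset_sgrp subspace_sgrp[OF sW]) auto
  have X: "subspace (zsat W ?Q)" by (rule subspace_zsat[OF sW Q])
  obtain C' where C': "finite C'" "zsat W ?Q = span C'"
    using subspace_of_span_finite[OF C X] unfolding zsat_def W by blast
  have "\<exists>n. n > 0 \<and> (\<forall>c\<in>C'. [:n:] *s c \<in> ?Q)"
  proof -
    have mem: "c \<in> zsat W ?Q" if "c \<in> C'" for c using C'(2) span_base[OF that] by simp
    show ?thesis using C'(1) mem
    proof (induction C' rule: finite_induct)
      case empty then show ?case by (intro exI[of _ 1]) auto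
    next
      case (insert c C')
      then obtain n where n: "n > 0" "\<forall>c\<in>C'. [:n:] *s c \<in> ?Q" by blast
      have "c \<in> zsat W ?Q" using insert.prems by blast
      then obtain m where m: "m \<noteq> 0" "[:m:] *s c \<in> ?Q" unfolding zsat_def by blast
      have c1: "[:n * \<bar>m\<bar>:] = [:\<bar>m\<bar>:] * [:n:]" by (simp add: mult.commute)
      have c2: "[:n * \<bar>m\<bar>:] = [:n * sgn m:] * [:m:]" by (simp add: abs_sgn ac_simps)
      have eq: "[:n * \<bar>m\<bar>:] *s x = [:\<bar>m\<bar>:] *s ([:n:] *s x)" for x unfolding c1 scale_scale ..
      have eq2: "[:n * \<bar>m\<bar>:] *s x = [:n * sgn m:] *s ([:m:] *s x)" for x unfolding c2 scale_scale ..
      have "[:n * \<bar>m\<bar>:] *s x \<in> ?Q" if "x \<in> insert c C'" for x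
      proof (cases "x = c")
        case True show ?thesis unfolding True eq2 by (rule subspace_scale[OF Q m(2)])
      next
        case False show ?thesis unfolding eq by (rule subspace_scale[OF Q]) (use that n(2) False in blast)
      qed
      then show ?case using n(1) m(1) by (intro exI[of _ "n * \<bar>m\<bar>"]) auto
    qed
  qed
  then obtain n where n: "n > 0" "\<forall>c\<in>C'. [:n:] *s c \<in> ?Q" by blast
  have nX: "[:n:] *s w \<in> ?Q" if "w \<in> zsat W ?Q" for w
  proof -
    have "subspace {v. [:n:] *s v \<in> ?Q}"
    proof (rule subspaceI)
      show "0 \<in> {v. [:n:] *s v \<in> ?Q}" using subspace_0[OF Q] by simp
      show "x + y \<in> {v. [:n:] *s v \<in> ?Q}" if "x \<in> {v. [:n:] *s v \<in> ?Q}" "y \<in> {v. [:n:] *s v \<in> ?Q}" for x y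
        using that subspace_add[OF Q] unfolding mem_Collect_eq scale_right_distrib by blast
      show "k *s x \<in> {v. [:n:] *s v \<in> ?Q}" if "x \<in> {v. [:n:] *s v \<in> ?Q}" for k x
        using that subspace_scale[OF Q, of "[:n:] *s x" k] unfolding mem_Collect_eq scale_left_commute[of "[:n:]" k x] by blast
    qed
    moreover have "C' \<subseteq> {v. [:n:] *s v \<in> ?Q}" using n(2) by blast
    ultimately have "span C' \<subseteq> {v. [:n:] *s v \<in> ?Q}" by (intro span_minimal)
    then show ?thesis using that C'(2) by blast
  qed
  have "\<exists>w\<in>W. [:n:] *s v - t_pow_minus_1 r *s w \<in> T" if r: "r \<ge> 1" and v: "v \<in> L r" for r v
  proof -
    let ?x = "t_pow_minus_1 r"
    have vW: "v \<in> W" using v unfolding zsat_def by blast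
    obtain w where w: "w \<in> W" "g *s v - ?x *s w \<in> N" using mem_D g(2) r v by blast
    obtain m where m: "m \<noteq> 0" "[:m:] *s v \<in> D r" using v unfolding zsat_def by blast
    obtain y where y: "y \<in> W" "[:m:] *s v - ?x *s y \<in> N" using mem_D[OF m(2)] by blast
    have "?x *s ([:m:] *s w - g *s y) = g *s ([:m:] *s v - ?x *s y) - [:m:] *s (g *s v - ?x *s w)"
      by (simp only: scale_right_diff_distrib scale_left_commute[of g "[:m:]"] scale_left_commute[of g ?x] scale_left_commute[of ?x "[:m:]"]) simp
    also have "\<dots> \<in> N" by (intro subspace_diff[OF N] subspace_scale[OF N] y w)
    finally have "?x *s ([:m:] *s w - g *s y) \<in> T" using NT by blast
    then have "[:m:] *s w - g *s y \<in> T"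
      by (rule T_cancel[rotated 2]) (intro subspace_diff[OF sW] subspace_scale[OF sW] w y t_pow_minus_1_nonzero[OF r])+
    then have "[:m:] *s w \<in> ?Q" using y(1) by (intro iffD2[OF mem_set_plus_iff]) blast
    then have "w \<in> zsat W ?Q" unfolding zsat_def using w(1) m(1) by blast
    from iffD1[OF mem_set_plus_iff nX[OF this]] obtain y' where y': "y' \<in> W" "[:n:] *s w - g *s y' \<in> T" by blast
    have "g *s ([:n:] *s v - ?x *s y') = [:n:] *s (g *s v - ?x *s w) + ?x *s ([:n:] *s w - g *s y')"
      by (simp only: scale_right_diff_distrib scale_left_commute[of g "[:n:]"] scale_left_commute[of g ?x] scale_left_commute[of ?x "[:n:]"]) simp
    also have "\<dots> \<in> T" using w(2) y'(2) NT by (intro subspace_add[OF sT] subspace_scale[OF sT]) auto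
    finally have "[:n:] *s v - ?x *s y' \<in> T"
      by (rule T_cancel[rotated 2]) (intro subspace_diff[OF sW] subspace_scale[OF sW] vW y' g(1))+
    then show ?thesis using y'(1) by blast
  qed
  then show ?thesis using n(1) by blast
qed

end

context pure_quotient begin

text \<open>
  An element \<open>v\<close> of \<open>L r\<close> with \<open>nv \<equiv> (t\<^sup>r - 1)w\<close> modulo \<open>T\<close> corresponds to \<open>w\<close> modulo \<open>nW + T\<close>.
\<close>

lemma idx_L_eq:
  assumes n: "n \<noteq> 0" and r: "r \<ge> 1" and un: "\<forall>v\<in>L r. \<exists>w\<in>W. [:n:] *s v - t_pow_minus_1 r *s w \<in> T"
  shows "idx (L r) (LT r + D r) =
    idx {w \<in> W. t_pow_minus_1 r *s w \<in> LT r + (*s) [:n:] ` W} (T + (*s) [:n:] ` W)"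
proof -
  let ?x = "t_pow_minus_1 r" and ?n = "[:n:]"
  let ?Z = "{w \<in> W. ?x *s w \<in> LT r + (*s) ?n ` W}"
  let ?Q = "T + (*s) ?n ` W"
  have n0: "?n \<noteq> 0" using n by simp
  have x0: "?x \<noteq> 0" by (rule t_pow_minus_1_nonzero[OF r])
  have sLD: "sgrp (LT r + D r)" by (rule sgrp_set_plus[OF subspace_sgrp[OF sLT] subspace_sgrp[OF sD]])
  have sQ: "subspace ?Q" by (rule subspace_set_plus[OF sT subspace_scale_image[OF sW]])
  have LW: "L r \<subseteq> W" unfolding zsat_def by blast
  have D0: "N \<subseteq> D r" by (rule ND)
  \<comment> \<open>\<open>\<phi>\<close> is merely a choice. It is additive modulo \<open>T\<close>
    because \<open>t ^ r - 1\<close> can be cancelled there, and \<open>idx_eqI\<close> asks for no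
    more.\<close>
  obtain \<phi> where \<phi>: "\<And>v. v \<in> L r \<Longrightarrow> \<phi> v \<in> W" "\<And>v. v \<in> L r \<Longrightarrow> ?n *s v - ?x *s \<phi> v \<in> T"
    using un by metis
  have zLT: "?n *s v - ?x *s w \<in> LT r" if v: "v \<in> L r" and w: "w \<in> W" and z: "?n *s v - ?x *s w \<in> T" for v w
  proof -
    have "?n *s v \<in> L r" by (rule subspace_scale[OF sL v])
    moreover have "?x *s w \<in> L r" using scale_mem_D[OF w] DL by blast
    ultimately have "?n *s v - ?x *s w \<in> L r" by (rule subspace_diff[OF sL])
    then show ?thesis using z mem_LT[OF r] by blast
  qed
  have key: "w \<in> ?Q \<longleftrightarrow> v \<in> LT r + D r" if v: "v \<in> L r" and w: "w \<in> W" and z: "?n *s v - ?x *s w \<in> T" for v w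
  proof
    assume "w \<in> ?Q"
    from iffD1[OF mem_set_plus_iff this] obtain u where u: "u \<in> W" "w - ?n *s u \<in> T" by blast
    have "?n *s (v - ?x *s u) = (?n *s v - ?x *s w) + ?x *s (w - ?n *s u)"
      by (simp only: scale_right_diff_distrib scale_left_commute[of ?x ?n]) simp
    also have "\<dots> \<in> T" by (intro subspace_add[OF sT] z subspace_scale[OF sT] u)
    finally have nvu: "?n *s (v - ?x *s u) \<in> T" .
    have vu: "v - ?x *s u \<in> W" using v LW by (intro subspace_diff[OF sW] subspace_scale[OF sW] u) blast
    have "v - ?x *s u \<in> T" by (rule T_cancel[OF vu n0 nvu])
    moreover have xu: "?x *s u \<in> D r" by (rule scale_mem_D[OF u(1)])
    moreover from this have "v - ?x *s u \<in> L r" using v DL by (intro subspace_diff[OF sL]) auto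
    ultimately have "v - ?x *s u \<in> LT r" using mem_LT[OF r] by blast
    then show "v \<in> LT r + D r" using xu by (intro iffD2[OF mem_set_plus_iff]) blast
  next
    assume "v \<in> LT r + D r"
    from iffD1[OF mem_set_plus_iff this] obtain e where e: "e \<in> D r" "v - e \<in> LT r" by blast
    obtain u where u: "u \<in> W" "e - ?x *s u \<in> N" using mem_D[OF e(1)] by blast
    have ve: "v - e \<in> T" using e(2) unfolding zsat_def by blast
    have eu: "e - ?x *s u \<in> T" using u(2) NT by blast
    have "?x *s (w - ?n *s u) = ?n *s (v - e) + ?n *s (e - ?x *s u) - (?n *s v - ?x *s w)"
      by (simp only: scale_right_diff_distrib scale_left_commute[of ?x ?n]) simp
    also have "\<dots> \<in> T" by (rule subspace_diff[OF sT subspace_add[OF sT subspace_scale[OF sT ve] subspace_scale[OF sT eu]] z])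
    finally have "?x *s (w - ?n *s u) \<in> T" .
    then have "w - ?n *s u \<in> T"
      by (rule T_cancel[OF subspace_diff[OF sW w subspace_scale[OF sW u(1)]] x0])
    then show "w \<in> ?Q" using u(1) by (intro iffD2[OF mem_set_plus_iff]) blast
  qed
  show ?thesis
  proof (rule idx_eqI[OF sLD subspace_sgrp[OF sQ], of _ \<phi>])
    show "\<phi> v \<in> ?Z" if v: "v \<in> L r" for v
    proof -
      have vW: "v \<in> W" using v LW by blast
      have "?x *s \<phi> v - ?n *s v = - (?n *s v - ?x *s \<phi> v)" by simp
      also have "\<dots> \<in> LT r" by (rule subspace_neg[OF sLT zLT[OF v \<phi>[OF v]]])
      finally have "?x *s \<phi> v \<in> LT r + (*s) ?n ` W" using vW by (intro iffD2[OF mem_set_plus_iff]) blast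
      then show ?thesis using \<phi>(1)[OF v] by blast
    qed
    show "(\<phi> v - \<phi> v' \<in> ?Q) = (v - v' \<in> LT r + D r)" if v: "v \<in> L r" and v': "v' \<in> L r" for v v'
    proof (rule key)
      show "v - v' \<in> L r" by (rule subspace_diff[OF sL v v'])
      show "\<phi> v - \<phi> v' \<in> W" by (rule subspace_diff[OF sW \<phi>(1)[OF v] \<phi>(1)[OF v']])
      have "?n *s (v - v') - ?x *s (\<phi> v - \<phi> v') = (?n *s v - ?x *s \<phi> v) - (?n *s v' - ?x *s \<phi> v')"
        by (simp only: scale_right_diff_distrib) simp
      then show "?n *s (v - v') - ?x *s (\<phi> v - \<phi> v') \<in> T"
        using subspace_diff[OF sT \<phi>(2)[OF v] \<phi>(2)[OF v']] by (simp only:)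
    qed
    show "\<exists>v\<in>L r. w - \<phi> v \<in> ?Q" if w: "w \<in> ?Z" for w
    proof -
      have wW: "w \<in> W" and "?x *s w \<in> LT r + (*s) ?n ` W" using w by blast+
      from iffD1[OF mem_set_plus_iff this(2)] obtain v where v: "v \<in> W" "?x *s w - ?n *s v \<in> LT r" by blast
      then obtain m where m: "m \<noteq> 0" "[:m:] *s (?x *s w - ?n *s v) \<in> DT r" unfolding zsat_def by blast
      have "[:m:] *s (?x *s w - ?n *s v) \<in> D r" using m(2) T_Int_D[OF r] by blast
      then have "[:m:] *s (?x *s w) - [:m:] *s (?x *s w - ?n *s v) \<in> D r"
        by (rule subspace_diff[OF sD subspace_scale[OF sD scale_mem_D[OF wW]]])
      moreover have "[:m:] *s (?x *s w) - [:m:] *s (?x *s w - ?n *s v) = [:m * n:] *s v"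
      proof -
        have "[:m * n:] = [:m:] * ?n" by simp
        then show ?thesis by (simp only: scale_right_diff_distrib scale_scale) simp
      qed
      ultimately have "[:m * n:] *s v \<in> D r" by (simp only:)
      then have vL: "v \<in> L r" unfolding zsat_def using v(1) m(1) n by (intro CollectI conjI exI[of _ "m * n"]) auto
      have xT: "?x *s w - ?n *s v \<in> T" using v(2) unfolding zsat_def by blast
      have "?x *s (w - \<phi> v) = (?x *s w - ?n *s v) + (?n *s v - ?x *s \<phi> v)"
        by (simp only: scale_right_diff_distrib) simp
      also have "\<dots> \<in> T" by (rule subspace_add[OF sT xT \<phi>(2)[OF vL]])
      finally have "w - \<phi> v \<in> T" by (rule T_cancel[OF subspace_diff[OF sW wW \<phi>(1)[OF vL]] x0])
      then have "w - \<phi> v \<in> ?Q"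
        by (rule subsetD[OF set_plus_left_subset[OF subspace_sgrp[OF subspace_scale_image[OF sW]]]])
      then show ?thesis using vL by blast
    qed
  qed
qed

text \<open>By \<open>idx_L_eq\<close> the index is that of \<open>Q\<close> in \<open>Z r\<close>.
  All \<open>Z r\<close> lie in the module \<open>H\<close> of elements sent into \<open>Q\<close>
  by some \<open>t ^ s - 1\<close>. As \<open>H\<close> is finitely generated and \<open>n\<close>
  kills it modulo \<open>Q\<close>, the quotient of \<open>H\<close> by \<open>Q\<close> is finite;
  so only a fixed finite set of representatives has to be tested, and each test is periodic in
  \<open>r\<close>.\<close>

lemma cyclic_seq_idx_L:
  assumes LTc: "cyclic_seq LT"
  shows "cyclic_seq (\<lambda>r. idx (L r) (LT r + D r))"
proof -
  obtain n :: int where n: "n > 0" and un: "\<forall>r\<ge>1. \<forall>v\<in>L r. \<exists>w\<in>W. [:n:] *s v - t_pow_minus_1 r *s w \<in> T"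
    using uniform_multiple_int by (elim exE conjE)
  define nW where "nW = (*s) [:n:] ` W"
  define Q where "Q = T + nW"
  define Z where "Z r = {w \<in> W. t_pow_minus_1 r *s w \<in> LT r + nW}" for r
  have snW: "subspace nW" unfolding nW_def by (rule subspace_scale_image[OF sW])
  have sQ: "subspace Q" unfolding Q_def by (rule subspace_set_plus[OF sT snW])
  have LTT: "LT r \<subseteq> T" for r unfolding zsat_def by blast
  have nWW: "nW \<subseteq> W" unfolding nW_def using subspace_scale[OF sW] by blast
  have QW: "Q \<subseteq> W" unfolding Q_def by (rule set_plus_subset_sgrp[OF subspace_sgrp[OF sW] TW nWW])
  have sLn: "subspace (LT r + nW)" for r by (rule subspace_set_plus[OF sLT snW])
  have LnQ: "LT r + nW \<subseteq> Q" for r unfolding Q_def by (rule set_plus_mono2[OF LTT subset_refl])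
  define H where "H = {w \<in> W. \<exists>s\<ge>1. t_pow_minus_1 s *s w \<in> Q}"
  have mult: "t_pow_minus_1 (s * k) *s w \<in> Q" if "t_pow_minus_1 s *s w \<in> Q" for s k w
  proof -
    obtain m where "t_pow_minus_1 (s * k) = t_pow_minus_1 s * m" using t_pow_minus_1_dvd_mult[of s k] by (elim dvdE)
    then have "t_pow_minus_1 (s * k) *s w = m *s (t_pow_minus_1 s *s w)" by (simp add: mult.commute)
    then show ?thesis using subspace_scale[OF sQ that] by (simp only:)
  qed
  have sH: "subspace H"
  proof (rule subspaceI)
    show "0 \<in> H" unfolding H_def using subspace_0[OF sW] subspace_0[OF sQ] by auto
  next
    fix x y assume "x \<in> H" "y \<in> H"
    then obtain s k where *: "x \<in> W" "y \<in> W" "s \<ge> 1" "k \<ge> 1" "t_pow_minus_1 s *s x \<in> Q" "t_pow_minus_1 k *s y \<in> Q"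
      unfolding H_def by blast
    have "t_pow_minus_1 (s * k) *s x \<in> Q" "t_pow_minus_1 (s * k) *s y \<in> Q"
      using mult[OF *(5), of k] mult[OF *(6), of s] by (simp_all only: mult.commute[of k s])
    then have "t_pow_minus_1 (s * k) *s (x + y) \<in> Q" unfolding scale_right_distrib by (rule subspace_add[OF sQ])
    moreover have "s * k \<ge> 1" using *(3,4) by simp
    ultimately show "x + y \<in> H" unfolding H_def using subspace_add[OF sW *(1,2)] by blast
  next
    fix c x assume "x \<in> H"
    then obtain s where *: "x \<in> W" "s \<ge> 1" "t_pow_minus_1 s *s x \<in> Q" unfolding H_def by blast
    have "t_pow_minus_1 s *s (c *s x) \<in> Q"
      unfolding scale_left_commute[of "t_pow_minus_1 s" c x] by (rule subspace_scale[OF sQ *(3)])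
    then show "c *s x \<in> H" unfolding H_def using * subspace_scale[OF sW *(1)] by blast
  qed
  have "H \<subseteq> span C" unfolding H_def W by blast
  from subspace_of_span_finite[OF C sH this] obtain C' where C': "finite C'" "H = span C'" by blast
  have memH: "c \<in> H" if "c \<in> C'" for c using C'(2) span_base[OF that] by simp
  \<comment> \<open>One exponent for all generators: the product of the single exponents, since
    \<open>t ^ s - 1\<close> divides \<open>t ^ (s * k) - 1\<close>.\<close>
  have "\<exists>s\<ge>1. \<forall>c\<in>C'. t_pow_minus_1 s *s c \<in> Q" using C'(1) memH
  proof (induction C' rule: finite_induct)
    case empty show ?case by auto
  next
    case (insert c C')
    then obtain s where s: "s \<ge> 1" "\<forall>c\<in>C'. t_pow_minus_1 s *s c \<in> Q" by blast
    have "c \<in> H" using insert.prems by blast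
    then obtain k where k: "k \<ge> 1" "t_pow_minus_1 k *s c \<in> Q" unfolding H_def by blast
    have "t_pow_minus_1 (s * k) *s x \<in> Q" if "x \<in> insert c C'" for x
    proof (cases "x = c")
      case True show ?thesis unfolding True using mult[OF k(2), of s] by (simp only: mult.commute[of k s])
    next
      case False then show ?thesis using that s(2) by (intro mult) blast
    qed
    moreover have "s * k \<ge> 1" using s(1) k(1) by simp
    ultimately show ?case by blast
  qed
  then obtain s where s: "s \<ge> 1" "\<And>c. c \<in> C' \<Longrightarrow> t_pow_minus_1 s *s c \<in> Q" by blast
  have nQ: "[:n:] *s c \<in> Q" if "c \<in> C'" for c
  proof -
    have "c \<in> W" using memH[OF that] unfolding H_def by blast
    then have "[:n:] *s c \<in> nW" unfolding nW_def by (rule imageI)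
    then show ?thesis unfolding Q_def by (rule subsetD[OF set_plus_right_subset[OF subspace_sgrp[OF sT]]])
  qed
  obtain F0 where F0: "finite F0" "\<forall>v\<in>H. \<exists>f\<in>F0. v - f \<in> Q"
    using finite_span_mod_subspace[OF sQ C'(1) n lead_coeff_t_pow_minus_1[OF s(1)] s(2) nQ] C'(2) by blast
  define F where "F = F0 \<inter> W"
  \<comment> \<open>The representatives that belong to \<open>Z r\<close>. Their set is periodic
    because \<open>LT r\<close> is, so the index computed from it is periodic too.\<close>
  define S where "S r = {f \<in> F. t_pow_minus_1 r *s f \<in> LT r + nW}" for r
  have "cyclic_seq S" unfolding S_def
  proof (rule cyclic_seq_Collect)
    show "finite F" using F0(1) by (simp add: F_def)
    have "cyclic_seq (\<lambda>r. LT r + nW)" by (rule cyclic_seq_comp[OF LTc, where h = "\<lambda>V. V + nW"])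
    then show "cyclic_seq (\<lambda>r. t_pow_minus_1 r *s f \<in> LT r + nW)" for f
      by (rule cyclic_seq_mem_cyclic[of "\<lambda>r. LT r + nW", OF sLn])
  qed
  then have cS: "cyclic_seq (\<lambda>r. idx (S r + Q) Q)" by (rule cyclic_seq_comp[where h = "\<lambda>V. idx (V + Q) Q"])
  have ZS: "Z r = S r + Q" if r: "r \<ge> 1" for r
  proof -
    let ?x = "t_pow_minus_1 r"
    have QZ: "?x *s q \<in> LT r + nW" if q: "q \<in> Q" for q
    proof -
      have "q \<in> T + nW" using q unfolding Q_def .
      then obtain u where u: "u \<in> nW" "q - u \<in> T" by (auto simp only: mem_set_plus_iff)
      have "?x *s (q - u) \<in> DT r"
        by (rule subsetD[OF set_plus_right_subset[OF subspace_sgrp[OF N]] imageI[OF u(2)]])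
      moreover have "DT r \<subseteq> LT r" by (rule subset_zsat) (use T_Int_D[OF r] in blast)
      ultimately have "?x *s (q - u) \<in> LT r" by (rule subsetD[rotated])
      moreover have "?x *s q - ?x *s u = ?x *s (q - u)" by (rule scale_diff_cancel)
      ultimately have "?x *s q - ?x *s u \<in> LT r" by (simp only:)
      then show ?thesis by (rule iffD2[OF mem_set_plus_iff, OF bexI]) (rule subspace_scale[OF snW u(1)])
    qed
    show ?thesis
    proof
      show "S r + Q \<subseteq> Z r"
      proof
        fix w assume "w \<in> S r + Q"
        then obtain f q where fq: "w = f + q" "f \<in> S r" "q \<in> Q" by (auto elim: set_plus_elim)
        have "?x *s w \<in> LT r + nW" unfolding fq(1) scale_right_distrib
          using fq(2) QZ[OF fq(3)] unfolding S_def by (intro subspace_add[OF sLn]) blast+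
        moreover have "w \<in> W" unfolding fq(1) using fq(2,3) QW unfolding S_def F_def by (intro subspace_add[OF sW]) blast+
        ultimately show "w \<in> Z r" unfolding Z_def by blast
      qed
      show "Z r \<subseteq> S r + Q"
      proof
        fix w assume w: "w \<in> Z r"
        then have wW: "w \<in> W" and xw: "?x *s w \<in> LT r + nW" unfolding Z_def by blast+
        have "w \<in> H" unfolding H_def using wW xw LnQ r by blast
        then obtain f where f: "f \<in> F0" "w - f \<in> Q" using F0(2) by blast
        have "f = w - (w - f)" by simp
        also have "\<dots> \<in> W" by (rule subspace_diff[OF sW wW subsetD[OF QW f(2)]])
        finally have fW: "f \<in> W" .
        have "?x *s f = ?x *s w - ?x *s (w - f)" by (simp only: scale_right_diff_distrib) simp
        also have "\<dots> \<in> LT r + nW" by (rule subspace_diff[OF sLn xw QZ[OF f(2)]])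
        finally have "f \<in> S r" unfolding S_def F_def using f(1) fW by blast
        then have "f + (w - f) \<in> S r + Q" using f(2) by (rule set_plus_intro)
        then show "w \<in> S r + Q" by simp
      qed
    qed
  qed
  have eq: "idx (L r) (LT r + D r) = idx (S r + Q) Q" if r: "r \<ge> 1" for r
  proof -
    have "idx (L r) (LT r + D r) = idx (Z r) Q"
      unfolding Z_def Q_def nW_def by (rule idx_L_eq[OF _ r]) (use n un r in auto)
    then show ?thesis unfolding ZS[OF r] .
  qed
  from cS obtain p where p: "p \<ge> 1" "\<forall>r\<ge>1. idx (S (r + p) + Q) Q = idx (S r + Q) Q"
    unfolding cyclic_seq_def by (elim exE conjE)
  have "idx (L (r + p)) (LT (r + p) + D (r + p)) = idx (L r) (LT r + D r)" if r: "r \<ge> 1" for r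
    using eq[OF r] eq[of "r + p"] p(2) r by simp
  then show ?thesis unfolding cyclic_seq_def by (intro exI[of _ p] conjI p(1) allI impI)
qed

text \<open>Periodicity of \<open>LT\<close> is used twice over: it comes from the torsion module
  T/N, and it is what makes the factor of W/T periodic.\<close>

theorem lin_rec_idx: "lin_rec (\<lambda>r. of_nat (idx (L r) (D r)))"
proof -
  obtain CT where CT: "finite CT" "T = span CT" using subspace_of_span_finite[OF C sT] TW W by blast
  have "\<exists>g. g \<noteq> 0 \<and> g *s c \<in> N" if "c \<in> CT" for c using CT(2) span_base[OF that] unfolding T_def by blast
  from common_annihilator[OF CT(1) this N] obtain f where f: "f \<noteq> 0" "\<forall>v\<in>T. f *s v \<in> N" unfolding CT(2)[symmetric] by blast
  have pT: "v \<in> N" if "n \<noteq> 0" "v \<in> T" "[:n:] *s v \<in> N" for n v using pure[OF that(1) _ that(3)] that(2) TW by blast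
  have fT: "f *s v \<in> N" if "v \<in> T" for v using f(2) that by blast
  note tors = lin_rec_idx_torsion[OF N sT NT CT pT f(1) fT]
  have "cyclic_seq LT" by (rule tors(1))
  then have "cyclic_seq (\<lambda>r. idx (L r) (LT r + D r))" by (rule cyclic_seq_idx_L)
  then have "\<exists>p\<ge>1. \<forall>r\<ge>1. idx (L (r + p)) (LT (r + p) + D (r + p)) = idx (L r) (LT r + D r)"
    unfolding cyclic_seq_def .
  then obtain p where p: "p \<ge> 1" "\<forall>r\<ge>1. idx (L (r + p)) (LT (r + p) + D (r + p)) = idx (L r) (LT r + D r)"
    by (elim exE conjE)
  have 2: "lin_rec (\<lambda>r. of_nat (idx (L r) (LT r + D r)))"
    by (rule lin_rec_periodic[OF p(1)]) (simp only: p(2)[rule_format])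
  have 3: "lin_rec (\<lambda>r. of_nat (idx (LT r) (DT r)) * of_nat (idx (L r) (LT r + D r)))"
    by (rule lin_rec_mult[OF tors(2) 2])
  show ?thesis
  proof (rule lin_rec_cong[OF _ 3])
    fix r :: nat assume "r \<ge> 1"
    then show "complex_of_nat (idx (LT r) (DT r)) * of_nat (idx (L r) (LT r + D r)) = of_nat (idx (L r) (D r))"
      by (simp only: idx_split of_nat_mult)
  qed
qed

end

section \<open>From an abelian group with an endomorphism to polynomial modules\<close>

lemma funpow_hom:
  assumes "group A" "\<tau> \<in> hom A A" shows "\<tau> ^^ j \<in> hom A A"
proof (induction j)
  case 0 then show ?case by (simp add: hom_def)
next
  case (Suc j)
  have "\<tau> \<circ> \<tau> ^^ j \<in> hom A A" by (rule hom_compose[OF Suc assms(2)])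
  then show ?case by (simp only: funpow.simps)
qed

context zt_module begin

text \<open>
  \<open>\<theta>\<close> maps \<open>W\<close> to \<open>A\<close> such that \<open>t\<close> acts by \<open>\<tau>\<close>; it is onto only up to powers of \<open>\<tau>\<close>. Since
  \<open>\<tau>\<^sup>r\<close> acts trivially on \<open>A/(\<tau>\<^sup>r - 1)A\<close>, the induced map to this quotient is still onto.
\<close>

lemma card_torsion_eq_idx:
  fixes A :: "('c, 'd) monoid_scheme" and \<tau> :: "'c \<Rightarrow> 'c" and \<theta> :: "'b \<Rightarrow> 'c" and r :: nat
  assumes A: "comm_group A" and sW: "subspace W"
    and \<theta>c: "\<And>v. v \<in> W \<Longrightarrow> \<theta> v \<in> carrier A"
    and \<theta>a: "\<And>u v. u \<in> W \<Longrightarrow> v \<in> W \<Longrightarrow> \<theta> (u + v) = \<theta> u \<otimes>\<^bsub>A\<^esub> \<theta> v"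
    and \<tau>: "\<tau> \<in> hom A A"
    and \<theta>t: "\<And>v. v \<in> W \<Longrightarrow> \<theta> (monom 1 1 *s v) = \<tau> (\<theta> v)"
    and sur: "\<And>Y. Y \<in> carrier A \<Longrightarrow> \<exists>j. \<exists>v\<in>W. (\<tau> ^^ j) Y = \<theta> v"
    and r: "r \<ge> 1"
  defines "N \<equiv> {v \<in> W. \<theta> v = \<one>\<^bsub>A\<^esub>}"
  defines "D \<equiv> N + (*s) (t_pow_minus_1 r) ` W"
  defines "H \<equiv> (\<lambda>Y. (\<tau> ^^ r) Y \<otimes>\<^bsub>A\<^esub> inv\<^bsub>A\<^esub> Y) ` carrier A"
  shows "card (torsion_subgroup (A Mod H)) = idx (zsat W D) D"
proof -
  interpret A: comm_group A by (rule A)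
  have \<tau>j: "\<tau> ^^ j \<in> hom A A" for j by (rule funpow_hom[OF A.is_group \<tau>])
  have gh: "group_hom A A (\<tau> ^^ j)" for j
    using \<tau>j by (intro group_hom.intro group_hom_axioms.intro A.is_group)
  have \<tau>c: "(\<tau> ^^ j) Y \<in> carrier A" if "Y \<in> carrier A" for j Y using hom_in_carrier[OF \<tau>j that] .
  have \<tau>m: "(\<tau> ^^ j) (Y \<otimes>\<^bsub>A\<^esub> Z) = (\<tau> ^^ j) Y \<otimes>\<^bsub>A\<^esub> (\<tau> ^^ j) Z" if "Y \<in> carrier A" "Z \<in> carrier A" for j Y Z
    using hom_mult[OF \<tau>j that] .
  have \<tau>i: "(\<tau> ^^ j) (inv\<^bsub>A\<^esub> Y) = inv\<^bsub>A\<^esub> (\<tau> ^^ j) Y" if "Y \<in> carrier A" for j Y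
    using group_hom.hom_inv[OF gh that] .
  have \<tau>\<tau>: "(\<tau> ^^ i) ((\<tau> ^^ j) Y) = (\<tau> ^^ (i + j)) Y" for i j Y by (simp add: funpow_add)
  have W0: "0 \<in> W" by (rule subspace_0[OF sW])
  have \<theta>0: "\<theta> 0 = \<one>\<^bsub>A\<^esub>"
  proof -
    have "\<theta> 0 \<otimes>\<^bsub>A\<^esub> \<theta> 0 = \<theta> 0 \<otimes>\<^bsub>A\<^esub> \<one>\<^bsub>A\<^esub>" using \<theta>a[OF W0 W0] \<theta>c[OF W0] by simp
    then show ?thesis using \<theta>c[OF W0] by (simp only: A.l_cancel A.one_closed)
  qed
  have \<theta>d: "\<theta> (u - v) = \<theta> u \<otimes>\<^bsub>A\<^esub> inv\<^bsub>A\<^esub> \<theta> v" if u: "u \<in> W" and v: "v \<in> W" for u v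
  proof -
    have uv: "u - v \<in> W" by (rule subspace_diff[OF sW u v])
    have "\<theta> u = \<theta> (u - v) \<otimes>\<^bsub>A\<^esub> \<theta> v" using \<theta>a[OF uv v] by simp
    then show ?thesis using \<theta>c[OF uv] \<theta>c[OF v] by (simp add: A.m_assoc)
  qed
  have \<theta>mon: "\<theta> (monom 1 j *s v) = (\<tau> ^^ j) (\<theta> v)" if v: "v \<in> W" for j v
  proof (induction j)
    case 0 then show ?case by simp
  next
    case (Suc j)
    have "monom 1 (Suc j) *s v = monom 1 1 *s (monom 1 j *s v)" by (simp add: mult_monom)
    then have "\<theta> (monom 1 (Suc j) *s v) = \<tau> (\<theta> (monom 1 j *s v))"
      using \<theta>t[OF subspace_scale[OF sW v]] by (simp only:)
    then show ?case using Suc by simp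
  qed
  have xr: "t_pow_minus_1 s *s v = monom 1 s *s v - v" for s v by (simp add: scale_left_diff_distrib)
  have \<theta>x: "\<theta> (t_pow_minus_1 s *s v) = (\<tau> ^^ s) (\<theta> v) \<otimes>\<^bsub>A\<^esub> inv\<^bsub>A\<^esub> \<theta> v" if v: "v \<in> W" for s v
    unfolding xr using \<theta>d[OF subspace_scale[OF sW v] v] \<theta>mon[OF v] by (simp only:)
  have sN: "subspace N"
  proof (rule subspaceI)
    show "0 \<in> N" unfolding N_def using W0 \<theta>0 by simp
    show "x + y \<in> N" if "x \<in> N" "y \<in> N" for x y
      using that \<theta>a[of x y] subspace_add[OF sW, of x y] unfolding N_def by simp
  next
    fix c x assume "x \<in> N"
    then have x: "x \<in> W" "\<theta> x = \<one>\<^bsub>A\<^esub>" unfolding N_def by simp_all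
    \<comment> \<open>\<open>\<theta>\<close> is only known to be additive and to turn
      \<open>t\<close> into \<open>\<tau>\<close>. Integer constants are treated first; Horner's
      rule then reaches every scalar.\<close>
    have smul: "\<theta> ([:n:] *s y) = \<one>\<^bsub>A\<^esub>" if y: "y \<in> W" "\<theta> y = \<one>\<^bsub>A\<^esub>" for n y
    proof (induction n rule: int_induct[where k = 0])
      case base show ?case using \<theta>0 by simp
    next
      case (step1 i)
      have "[:i + 1:] = [:i:] + 1" by (simp add: one_pCons)
      then have "[:i + 1:] *s y = [:i:] *s y + y" by (simp only: scale_left_distrib scale_one)
      then show ?case using \<theta>a[OF subspace_scale[OF sW y(1)] y(1)] step1 y(2) by simp
    next
      case (step2 i)
      have "[:i - 1:] = [:i:] - 1" by (simp add: one_pCons)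
      then have "[:i - 1:] *s y = [:i:] *s y - y" by (simp only: scale_left_diff_distrib scale_one)
      then show ?case using \<theta>d[OF subspace_scale[OF sW y(1)] y(1)] step2 y(2) by simp
    qed
    have "\<theta> (c *s x) = \<one>\<^bsub>A\<^esub>"
    proof (induction c rule: pCons_induct)
      case 0 show ?case using \<theta>0 by simp
    next
      case (pCons a p)
      have px: "p *s x \<in> W" by (rule subspace_scale[OF sW x(1)])
      have "pCons a p = [:a:] + monom 1 1 * p" by (simp add: monom_altdef)
      then have "pCons a p *s x = [:a:] *s x + monom 1 1 *s (p *s x)" by (simp only: scale_left_distrib scale_scale)
      then have "\<theta> (pCons a p *s x) = \<theta> ([:a:] *s x) \<otimes>\<^bsub>A\<^esub> \<theta> (monom 1 1 *s (p *s x))"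
        using \<theta>a[OF subspace_scale[OF sW x(1)] subspace_scale[OF sW px]] by (simp only:)
      also have "\<dots> = \<one>\<^bsub>A\<^esub>" using smul[OF x] \<theta>t[OF px] pCons group_hom.hom_one[OF gh[of 1]] by simp
      finally show ?case .
    qed
    then show "c *s x \<in> N" unfolding N_def using subspace_scale[OF sW x(1)] by simp
  qed
  have sD: "subspace D" unfolding D_def by (rule subspace_set_plus[OF sN subspace_scale_image[OF sW]])
  define \<eta> where "\<eta> s Y = (\<tau> ^^ s) Y \<otimes>\<^bsub>A\<^esub> inv\<^bsub>A\<^esub> Y" for s Y
  have \<eta>h: "\<eta> s \<in> hom A A" for s
    unfolding \<eta>_def by (rule homI) (auto simp: \<tau>c \<tau>m A.inv_mult A.m_ac)
  have H: "H = \<eta> r ` carrier A" unfolding H_def \<eta>_def ..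
  have "group_hom A A (\<eta> r)" using \<eta>h by (intro group_hom.intro group_hom_axioms.intro A.is_group)
  then have Hs: "subgroup H A" unfolding H by (rule group_hom.img_is_subgroup)
  then have Hn: "H \<lhd> A" by (rule A.subgroup_imp_normal)
  interpret B: group "A Mod H" by (rule normal.factorgroup_is_group[OF Hn])
  \<comment> \<open>Telescoping: \<open>\<tau> ^^ (k * r)\<close> acts trivially modulo
    \<open>H\<close>.\<close>
  have \<eta>k: "\<eta> (k * r) Y \<in> H" if Y: "Y \<in> carrier A" for k Y
  proof (induction k)
    case 0
    have "\<eta> (0 * r) Y = \<one>\<^bsub>A\<^esub>" using Y by (simp add: \<eta>_def)
    then show ?case using subgroup.one_closed[OF Hs] by simp
  next
    case (Suc k)
    let ?Z = "(\<tau> ^^ (k * r)) Y"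
    have "\<eta> (Suc k * r) Y = \<eta> r ?Z \<otimes>\<^bsub>A\<^esub> \<eta> (k * r) Y"
      using Y \<tau>c[OF Y, of "k * r"] \<tau>c[OF \<tau>c[OF Y, of "k * r"], of r] by (simp add: \<eta>_def \<tau>\<tau> A.m_assoc A.inv_solve_left)
    moreover have "\<eta> r ?Z \<in> H" unfolding H using \<tau>c[OF Y] by blast
    ultimately show ?case using Suc subgroup.m_closed[OF Hs] by simp
  qed
  \<comment> \<open>The power of \<open>\<tau>\<close> must be one that is trivial modulo
    \<open>H\<close>; since \<open>r\<close> is positive, \<open>j\<close> can be raised to its
    multiple \<open>j * r\<close>.\<close>
  have sur': "\<exists>k. \<exists>v\<in>W. (\<tau> ^^ (k * r)) Y = \<theta> v" if Y: "Y \<in> carrier A" for Y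
  proof -
    obtain j v where v: "v \<in> W" "(\<tau> ^^ j) Y = \<theta> v" using sur[OF Y] by blast
    have "j \<le> j * r" using r by simp
    then have "(\<tau> ^^ (j * r)) Y = (\<tau> ^^ (j * r - j)) (\<theta> v)" unfolding v(2)[symmetric] \<tau>\<tau> by simp
    also have "\<dots> = \<theta> (monom 1 (j * r - j) *s v)" using \<theta>mon[OF v(1)] by simp
    finally show ?thesis using subspace_scale[OF sW v(1)] by blast
  qed
  define \<phi> where "\<phi> v = H #>\<^bsub>A\<^esub> \<theta> v" for v
  have carB: "carrier (A Mod H) = (\<lambda>Y. H #>\<^bsub>A\<^esub> Y) ` carrier A" by (auto simp: FactGroup_def RCOSETS_def)
  have mulB: "(H #>\<^bsub>A\<^esub> Y) \<otimes>\<^bsub>A Mod H\<^esub> (H #>\<^bsub>A\<^esub> Z) = H #>\<^bsub>A\<^esub> (Y \<otimes>\<^bsub>A\<^esub> Z)" if "Y \<in> carrier A" "Z \<in> carrier A" for Y Z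
    using normal.rcos_sum[OF Hn that] by (simp add: FactGroup_def)
  have oneB: "\<one>\<^bsub>A Mod H\<^esub> = H" by (simp add: FactGroup_def)
  have \<phi>c: "\<phi> v \<in> carrier (A Mod H)" if "v \<in> W" for v unfolding carB \<phi>_def using \<theta>c[OF that] by (rule imageI)
  have \<phi>a: "\<phi> (u + v) = \<phi> u \<otimes>\<^bsub>A Mod H\<^esub> \<phi> v" if "u \<in> W" "v \<in> W" for u v
    unfolding \<phi>_def mulB[OF \<theta>c[OF that(1)] \<theta>c[OF that(2)]] \<theta>a[OF that] ..
  have cos1: "H #>\<^bsub>A\<^esub> Y = H \<longleftrightarrow> Y \<in> H" if "Y \<in> carrier A" for Y
    using A.coset_join1[OF _ that Hs] A.coset_join2[OF that Hs] by blast
  have \<phi>1: "\<phi> v = \<one>\<^bsub>A Mod H\<^esub> \<longleftrightarrow> v \<in> D" if v: "v \<in> W" for v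
  proof -
    have "\<theta> v \<in> H \<longleftrightarrow> v \<in> D"
    proof
      assume "v \<in> D"
      then obtain w where w: "w \<in> W" "v - t_pow_minus_1 r *s w \<in> N" unfolding D_def by (auto simp only: mem_set_plus_iff)
      have "\<theta> (v - t_pow_minus_1 r *s w) = \<one>\<^bsub>A\<^esub>" using w(2) unfolding N_def by simp
      then have "\<theta> v \<otimes>\<^bsub>A\<^esub> inv\<^bsub>A\<^esub> \<eta> r (\<theta> w) = \<one>\<^bsub>A\<^esub>"
        unfolding \<theta>d[OF v subspace_scale[OF sW w(1)]] \<theta>x[OF w(1)] \<eta>_def .
      then have "\<theta> v = \<eta> r (\<theta> w)"
        using \<theta>c[OF v] hom_in_carrier[OF \<eta>h \<theta>c[OF w(1)]] by (metis A.inv_closed A.inv_inv A.inv_equality)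
      then show "\<theta> v \<in> H" unfolding H using \<theta>c[OF w(1)] by blast
    next
      assume "\<theta> v \<in> H"
      then obtain Y where Y: "Y \<in> carrier A" "\<theta> v = \<eta> r Y" unfolding H by blast
      \<comment> \<open>\<open>Y\<close> need not be in the image of \<open>\<theta>\<close>, but
        \<open>\<tau> ^^ (k * r)\<close> moves it there. This multiplies \<open>v\<close> by
        \<open>t ^ (k * r)\<close>, which differs from 1 by a multiple of \<open>t ^ r - 1\<close>
        and so does not affect membership in \<open>D\<close>.\<close>
      obtain k u where u: "u \<in> W" "(\<tau> ^^ (k * r)) Y = \<theta> u" using sur'[OF Y(1)] by blast
      let ?j = "k * r"
      have com: "(\<tau> ^^ ?j) ((\<tau> ^^ r) Y) = (\<tau> ^^ r) (\<theta> u)" unfolding u(2)[symmetric] \<tau>\<tau> by (simp only: add.commute)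
      have "\<theta> (monom 1 ?j *s v) = (\<tau> ^^ ?j) (\<eta> r Y)" unfolding \<theta>mon[OF v] Y(2) ..
      also have "\<dots> = (\<tau> ^^ r) (\<theta> u) \<otimes>\<^bsub>A\<^esub> inv\<^bsub>A\<^esub> \<theta> u"
        unfolding \<eta>_def \<tau>m[OF \<tau>c[OF Y(1)] A.inv_closed[OF Y(1)]] \<tau>i[OF Y(1)] com u(2) ..
      also have "\<dots> = \<theta> (t_pow_minus_1 r *s u)" unfolding \<theta>x[OF u(1)] ..
      finally have e: "\<theta> (monom 1 ?j *s v) = \<theta> (t_pow_minus_1 r *s u)" .
      have jv: "monom 1 ?j *s v \<in> W" and ru: "t_pow_minus_1 r *s u \<in> W" by (rule subspace_scale[OF sW v] subspace_scale[OF sW u(1)])+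
      have "\<theta> (monom 1 ?j *s v - t_pow_minus_1 r *s u) = \<one>\<^bsub>A\<^esub>"
        unfolding \<theta>d[OF jv ru] e using \<theta>c[OF ru] by (rule A.r_inv)
      then have nu: "monom 1 ?j *s v - t_pow_minus_1 r *s u \<in> N" unfolding N_def using subspace_diff[OF sW jv ru] by blast
      have "t_pow_minus_1 r dvd t_pow_minus_1 ?j" using t_pow_minus_1_dvd_mult[of r k] by (simp only: mult.commute)
      then obtain m where m: "t_pow_minus_1 ?j = t_pow_minus_1 r * m" by (elim dvdE)
      have "t_pow_minus_1 ?j *s v = t_pow_minus_1 r *s (m *s v)" unfolding m by (simp only: scale_scale)
      then have "v - t_pow_minus_1 r *s (u - m *s v) = monom 1 ?j *s v - t_pow_minus_1 r *s u"
        unfolding xr[of ?j] scale_right_diff_distrib by (simp add: algebra_simps)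
      then have "v - t_pow_minus_1 r *s (u - m *s v) \<in> N" using nu by (simp only:)
      moreover have "u - m *s v \<in> W" by (intro subspace_diff[OF sW] subspace_scale[OF sW] u v)
      ultimately show "v \<in> D" unfolding D_def by (intro iffD2[OF mem_set_plus_iff]) blast
    qed
    then show ?thesis unfolding oneB \<phi>_def cos1[OF \<theta>c[OF v]] .
  qed
  have \<phi>n: "\<phi> ([:int n:] *s v) = \<phi> v [^]\<^bsub>A Mod H\<^esub> n" if v: "v \<in> W" for n v
  proof (induction n)
    case 0
    have "\<phi> 0 = \<one>\<^bsub>A Mod H\<^esub>" using \<phi>1[OF W0] subspace_0[OF sD] by blast
    then show ?case by simp
  next
    case (Suc n)
    have "[:int (Suc n):] = [:int n:] + 1" by (simp add: one_pCons)
    then have "[:int (Suc n):] *s v = [:int n:] *s v + v" by (simp only: scale_left_distrib scale_one)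
    then show ?case using \<phi>a[OF subspace_scale[OF sW v] v] Suc by simp
  qed
  have "torsion_subgroup (A Mod H) = \<phi> ` zsat W D"
  proof
    show "torsion_subgroup (A Mod H) \<subseteq> \<phi> ` zsat W D"
    proof
      fix b assume "b \<in> torsion_subgroup (A Mod H)"
      then obtain n :: nat where b: "b \<in> carrier (A Mod H)" "n > 0" "b [^]\<^bsub>A Mod H\<^esub> n = \<one>\<^bsub>A Mod H\<^esub>"
        unfolding torsion_subgroup_def by blast
      obtain Y where Y: "Y \<in> carrier A" "b = H #>\<^bsub>A\<^esub> Y" using b(1) unfolding carB by blast
      \<comment> \<open>Applying \<open>\<tau> ^^ (k * r)\<close> to \<open>Y\<close> stays within
        the same coset of \<open>H\<close>, so that coset has a representative in the image of
        \<open>\<theta>\<close>.\<close>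
      obtain k v where v: "v \<in> W" "(\<tau> ^^ (k * r)) Y = \<theta> v" using sur'[OF Y(1)] by blast
      have "\<phi> v = H #>\<^bsub>A\<^esub> (\<eta> (k * r) Y \<otimes>\<^bsub>A\<^esub> Y)"
        unfolding \<phi>_def v(2)[symmetric] \<eta>_def using Y(1) \<tau>c[OF Y(1)] by (simp add: A.m_assoc)
      also have "\<dots> = (H #>\<^bsub>A\<^esub> \<eta> (k * r) Y) \<otimes>\<^bsub>A Mod H\<^esub> (H #>\<^bsub>A\<^esub> Y)"
        using mulB[OF hom_in_carrier[OF \<eta>h Y(1)] Y(1)] by simp
      also have "H #>\<^bsub>A\<^esub> \<eta> (k * r) Y = \<one>\<^bsub>A Mod H\<^esub>"
        unfolding oneB cos1[OF hom_in_carrier[OF \<eta>h Y(1)]] by (rule \<eta>k[OF Y(1)])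
      also have "\<one>\<^bsub>A Mod H\<^esub> \<otimes>\<^bsub>A Mod H\<^esub> (H #>\<^bsub>A\<^esub> Y) = b" unfolding Y(2)[symmetric] by (rule B.l_one[OF b(1)])
      finally have bv: "b = \<phi> v" by simp
      have "\<phi> ([:int n:] *s v) = \<one>\<^bsub>A Mod H\<^esub>" unfolding \<phi>n[OF v(1)] using b(3) bv by simp
      then have "[:int n:] *s v \<in> D" using \<phi>1[OF subspace_scale[OF sW v(1)]] by blast
      moreover have "int n \<noteq> 0" using b(2) by simp
      ultimately have "v \<in> zsat W D" unfolding zsat_def using v(1) by blast
      then show "b \<in> \<phi> ` zsat W D" unfolding bv by (rule imageI)
    qed
    show "\<phi> ` zsat W D \<subseteq> torsion_subgroup (A Mod H)"
    proof
      fix b assume "b \<in> \<phi> ` zsat W D"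
      then obtain v n where v: "b = \<phi> v" "v \<in> W" "n \<noteq> 0" "[:n:] *s v \<in> D" unfolding zsat_def by blast
      have "[:\<bar>n\<bar>:] *s v = [:sgn n:] *s ([:n:] *s v)" by (simp add: abs_sgn mult.commute)
      then have "[:\<bar>n\<bar>:] *s v \<in> D" using subspace_scale[OF sD v(4), of "[:sgn n:]"] by (simp only:)
      then have "[:int (nat \<bar>n\<bar>):] *s v \<in> D" by simp
      then have "\<phi> v [^]\<^bsub>A Mod H\<^esub> nat \<bar>n\<bar> = \<one>\<^bsub>A Mod H\<^esub>"
        using \<phi>1[OF subspace_scale[OF sW v(2)]] \<phi>n[OF v(2)] by metis
      moreover have "nat \<bar>n\<bar> > 0" using v(3) by simp
      ultimately show "b \<in> torsion_subgroup (A Mod H)" unfolding torsion_subgroup_def v(1) using \<phi>c[OF v(2)] by blast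
    qed
  qed
  moreover have "card (\<phi> ` zsat W D) = card (coset D ` zsat W D)"
  proof (rule card_image_eq_if_same_kernel)
    fix u v assume "u \<in> zsat W D" "v \<in> zsat W D"
    then have uv: "u \<in> W" "v \<in> W" unfolding zsat_def by blast+
    have d: "u - v \<in> W" by (rule subspace_diff[OF sW uv])
    have "u - v + v = u" by simp
    then have \<phi>uv: "\<phi> u = \<phi> (u - v) \<otimes>\<^bsub>A Mod H\<^esub> \<phi> v" using \<phi>a[OF d uv(2)] by (simp only:)
    have "\<phi> u = \<phi> v \<longleftrightarrow> \<phi> (u - v) = \<one>\<^bsub>A Mod H\<^esub>"
    proof
      assume "\<phi> u = \<phi> v"
      then have "\<phi> (u - v) \<otimes>\<^bsub>A Mod H\<^esub> \<phi> v = \<one>\<^bsub>A Mod H\<^esub> \<otimes>\<^bsub>A Mod H\<^esub> \<phi> v"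
        unfolding B.l_one[OF \<phi>c[OF uv(2)]] \<phi>uv[symmetric] .
      then show "\<phi> (u - v) = \<one>\<^bsub>A Mod H\<^esub>" by (rule B.r_cancel[OF _ \<phi>c[OF d] B.one_closed \<phi>c[OF uv(2)]])
    next
      assume e: "\<phi> (u - v) = \<one>\<^bsub>A Mod H\<^esub>"
      show "\<phi> u = \<phi> v" unfolding \<phi>uv e by (rule B.l_one[OF \<phi>c[OF uv(2)]])
    qed
    also have "\<dots> \<longleftrightarrow> coset D u = coset D v" unfolding \<phi>1[OF d] coset_eq_iff[OF subspace_sgrp[OF sD]] ..
    finally show "\<phi> u = \<phi> v \<longleftrightarrow> coset D u = coset D v" .
  qed
  ultimately show ?thesis unfolding idx_def by simp
qed

end

section \<open>Laurent polynomials and their cyclic modules\<close>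

text \<open>The embedding of \<open>int poly\<close>, written as an evaluation so that its ring laws
  are inherited from \<open>poly\<close>.\<close>

definition laurent_of :: "int poly \<Rightarrow> laurent" where
  "laurent_of p = poly (map_poly of_int p) laurent_t"

lemma laurent_of_add: "laurent_of (p + q) = laurent_of p + laurent_of q"
proof -
  have "map_poly of_int (p + q) = (map_poly of_int p + map_poly of_int q :: laurent poly)"
    by (rule poly_eqI) (simp add: coeff_map_poly)
  then show ?thesis by (simp add: laurent_of_def)
qed

lemma laurent_of_mult: "laurent_of (p * q) = laurent_of p * laurent_of q"
proof -
  have "map_poly of_int (p * q) = (map_poly of_int p * map_poly of_int q :: laurent poly)"
    by (rule poly_eqI) (simp add: coeff_map_poly coeff_mult)
  then show ?thesis by (simp add: laurent_of_def)
qed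

lemma laurent_of_0: "laurent_of 0 = 0" by (simp add: laurent_of_def)

lemma laurent_of_diff: "laurent_of (p - q) = laurent_of p - laurent_of q"
  using laurent_of_add[of "p - q" q] by simp

lemma laurent_of_sum: "laurent_of (sum f A) = (\<Sum>x\<in>A. laurent_of (f x))"
  by (induction A rule: infinite_finite_induct) (simp_all add: laurent_of_0 laurent_of_add)

lemma laurent_t_power: "laurent_t ^ n = Poly_Mapping.single (int n) 1"
  by (induction n) (simp_all add: laurent_t_def mult_single)

lemma of_int_laurent: "(of_int c :: laurent) = Poly_Mapping.single 0 c"
proof -
  have "Poly_Mapping.single 0 (of_int c :: int) = (of_int c :: laurent)" by (rule single_of_int)
  then show ?thesis by (simp only: of_int_eq_id id_apply)
qed

lemma laurent_of_monom: "laurent_of (monom c n) = Poly_Mapping.single (int n) c"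
  by (simp add: laurent_of_def map_poly_monom poly_monom of_int_laurent laurent_t_power mult_single)

lemma laurent_of_eq_sum: "laurent_of p = (\<Sum>i\<le>degree p. Poly_Mapping.single (int i) (coeff p i))"
proof -
  have "laurent_of p = laurent_of (\<Sum>i\<le>degree p. monom (coeff p i) i)" by (simp only: poly_as_sum_of_monoms)
  then show ?thesis by (simp only: laurent_of_sum laurent_of_monom)
qed

lemma lookup_laurent_of: "Poly_Mapping.lookup (laurent_of p) (int j) = coeff p j"
proof -
  have "Poly_Mapping.lookup (laurent_of p) (int j) = (\<Sum>i\<le>degree p. if i = j then coeff p i else 0)"
    unfolding laurent_of_eq_sum lookup_sum by (rule sum.cong) (auto simp: lookup_single when_def)
  also have "\<dots> = coeff p j" by (simp add: coeff_eq_0)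
  finally show ?thesis .
qed

lemma laurent_of_inject: "laurent_of p = laurent_of q \<longleftrightarrow> p = q"
proof
  assume e: "laurent_of p = laurent_of q"
  have "coeff p j = coeff q j" for j using lookup_laurent_of[of p j] lookup_laurent_of[of q j] unfolding e by simp
  then show "p = q" by (rule poly_eqI)
qed simp

lemma laurent_sum_single: "(\<Sum>k\<in>Poly_Mapping.keys a. Poly_Mapping.single k (Poly_Mapping.lookup a k)) = a"
proof (rule poly_mapping_eqI)
  fix i
  have "Poly_Mapping.lookup (\<Sum>k\<in>Poly_Mapping.keys a. Poly_Mapping.single k (Poly_Mapping.lookup a k)) i
      = (\<Sum>k\<in>Poly_Mapping.keys a. if k = i then Poly_Mapping.lookup a k else 0)"
    unfolding lookup_sum by (rule sum.cong) (auto simp: lookup_single when_def)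
  also have "\<dots> = Poly_Mapping.lookup a i" by (simp add: in_keys_iff)
  finally show "Poly_Mapping.lookup (\<Sum>k\<in>Poly_Mapping.keys a. Poly_Mapping.single k (Poly_Mapping.lookup a k)) i = Poly_Mapping.lookup a i" .
qed

lemma laurent_shift: "\<exists>j v. laurent_t ^ j * a = laurent_of v"
proof -
  let ?K = "Poly_Mapping.keys a"
  \<comment> \<open>The sum of the absolute values bounds every exponent and also covers the empty
    support, where a maximum would be unspecified.\<close>
  define j where "j = nat (\<Sum>k\<in>?K. \<bar>k\<bar>)"
  define v where "v = (\<Sum>k\<in>?K. monom (Poly_Mapping.lookup a k) (nat (k + int j)))"
  have kj: "int (nat (k + int j)) = int j + k" if "k \<in> ?K" for k
  proof -
    have "\<bar>k\<bar> \<le> (\<Sum>k\<in>?K. \<bar>k\<bar>)" by (rule member_le_sum[OF that]) auto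
    then show ?thesis by (simp add: j_def)
  qed
  have "laurent_of v = (\<Sum>k\<in>?K. Poly_Mapping.single (int j + k) (Poly_Mapping.lookup a k))"
    unfolding v_def laurent_of_sum laurent_of_monom by (rule sum.cong[OF refl]) (simp only: kj)
  also have "\<dots> = laurent_t ^ j * (\<Sum>k\<in>?K. Poly_Mapping.single k (Poly_Mapping.lookup a k))"
    unfolding laurent_t_power sum_distrib_left by (simp add: mult_single)
  finally have "laurent_t ^ j * a = laurent_of v" unfolding laurent_sum_single by simp
  then show ?thesis by blast
qed

lemma laurent_of_X: "laurent_of ([:0, 1:] ^ n) = laurent_t ^ n"
proof -
  have "[:0, 1:] ^ n = monom (1::int) n" by (simp add: monom_altdef)
  then show ?thesis by (simp add: laurent_of_monom laurent_t_power)
qed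

lemma laurent_t_unit: "Poly_Mapping.single (- int n) 1 * laurent_t ^ n = 1"
  by (simp add: laurent_t_power mult_single)

text \<open>As \<open>q\<close> does not vanish at 0, each factor \<open>t\<close> on the left must
  divide the cofactor and can be cancelled.\<close>

lemma dvd_X_power_cancel:
  fixes q v :: "int poly"
  assumes "poly q 0 \<noteq> 0" shows "q dvd [:0, 1:] ^ n * v \<Longrightarrow> q dvd v"
proof (induction n)
  case (Suc n)
  then obtain k where k: "[:0, 1:] ^ Suc n * v = q * k" by (elim dvdE)
  have "poly (q * k) 0 = 0" unfolding k[symmetric] by simp
  then have "poly k 0 = 0" using assms by simp
  then have "[:-0, 1:] dvd k" by (simp only: poly_eq_0_iff_dvd)
  then obtain k' where k': "k = [:0, 1:] * k'" by (auto elim: dvdE)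
  have eq: "[:0, 1:] * ([:0, 1:] ^ n * v) = [:0, 1:] * (q * k')" using k unfolding k' power_Suc by (simp only: mult.assoc mult.left_commute)
  have nz: "[:0, 1 :: int:] \<noteq> 0" by simp
  have "[:0, 1:] ^ n * v = q * k'" by (rule iffD1[OF mult_left_cancel[OF nz] eq])
  then have "q dvd [:0, 1:] ^ n * v" by simp
  then show ?case by (rule Suc.IH)
qed simp

text \<open>A principal Laurent ideal contracts to a principal ideal of \<open>int poly\<close>: up
  to a power of the unit \<open>t\<close>, a nonzero \<open>p\<close> is a polynomial
  \<open>q\<close> with nonzero constant term, and such a \<open>q\<close> divides \<open>v\<close>
  as soon as it divides some \<open>t ^ n * v\<close>.\<close>

lemma laurent_associate: "\<exists>q. \<forall>v. p dvd laurent_of v \<longleftrightarrow> q dvd v"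
proof (cases "p = 0")
  case True
  have "laurent_of v = 0 \<longleftrightarrow> v = 0" for v using laurent_of_inject[of v 0] unfolding laurent_of_0 .
  then show ?thesis using True by (intro exI[of _ 0]) simp
next
  case False
  obtain j v0 where v0: "laurent_t ^ j * p = laurent_of v0" using laurent_shift by blast
  have "v0 \<noteq> 0"
  proof
    assume "v0 = 0"
    then have "laurent_t ^ j * p = 0" using v0 laurent_of_0 by simp
    then have "Poly_Mapping.single (- int j) 1 * laurent_t ^ j * p = 0" by (simp only: mult.assoc mult_zero_right)
    then show False using False unfolding laurent_t_unit by simp
  qed
  then obtain q where q: "v0 = [:-0, 1:] ^ order 0 v0 * q" "\<not> [:-0, 1:] dvd q" using order_decomp by blast
  define m where "m = order 0 v0"
  have q0: "poly q 0 \<noteq> 0" using q(2) by (simp only: poly_eq_0_iff_dvd not_False_eq_True)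
  have v0q: "laurent_t ^ j * p = laurent_t ^ m * laurent_of q"
    unfolding v0 using q(1) unfolding m_def[symmetric] by (simp add: laurent_of_mult laurent_of_X)
  have "p dvd laurent_of v \<longleftrightarrow> q dvd v" for v
  proof
    assume "q dvd v"
    then obtain w where w: "v = q * w" by (elim dvdE)
    have "laurent_of q = Poly_Mapping.single (- int m) 1 * laurent_t ^ m * laurent_of q" unfolding laurent_t_unit by simp
    also have "\<dots> = Poly_Mapping.single (- int m) 1 * (laurent_t ^ j * p)" unfolding v0q by (simp only: mult.assoc)
    finally have "p dvd laurent_of q" by (metis dvd_triv_right mult.assoc)
    then show "p dvd laurent_of v" unfolding w laurent_of_mult by (rule dvd_mult2)
  next
    assume "p dvd laurent_of v"
    then obtain s where s: "laurent_of v = p * s" by (elim dvdE)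
    obtain i w where w: "laurent_t ^ i * s = laurent_of w" using laurent_shift by blast
    have "laurent_t ^ (i + j) * laurent_of v = (laurent_t ^ j * p) * (laurent_t ^ i * s)"
      unfolding s power_add by (simp only: ac_simps)
    also have "\<dots> = laurent_t ^ m * laurent_of q * laurent_of w" unfolding v0q w ..
    finally have "laurent_of ([:0, 1:] ^ (i + j) * v) = laurent_of ([:0, 1:] ^ m * q * w)"
      by (simp only: laurent_of_mult laurent_of_X)
    then have "[:0, 1:] ^ (i + j) * v = [:0, 1:] ^ m * q * w" by (simp only: laurent_of_inject)
    then have "q dvd [:0, 1:] ^ (i + j) * v" by simp
    then show "q dvd v" by (rule dvd_X_power_cancel[OF q0])
  qed
  then show ?thesis by blast
qed

lemma cring_laurent_ring: "cring laurent_ring"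
proof (rule cringI)
  show "abelian_group laurent_ring"
  proof (rule abelian_groupI)
    show "\<exists>y\<in>carrier laurent_ring. y \<oplus>\<^bsub>laurent_ring\<^esub> x = \<zero>\<^bsub>laurent_ring\<^esub>" for x
      by (rule bexI[of _ "- x"]) (simp_all add: laurent_ring_def)
  qed (simp_all add: laurent_ring_def algebra_simps)
  show "Group.comm_monoid laurent_ring"
    by (rule comm_monoidI) (simp_all add: laurent_ring_def algebra_simps)
qed (simp add: laurent_ring_def algebra_simps)

definition lcoset :: "laurent \<Rightarrow> laurent \<Rightarrow> laurent set" where
  "lcoset p a = (PIdl\<^bsub>laurent_ring\<^esub> p) +>\<^bsub>laurent_ring\<^esub> a"

lemma lideal: "ideal (PIdl\<^bsub>laurent_ring\<^esub> p) laurent_ring"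
  by (rule cring.cgenideal_ideal[OF cring_laurent_ring]) (simp add: laurent_ring_def)

lemma laurent_minus: "a \<ominus>\<^bsub>laurent_ring\<^esub> b = a - b"
proof -
  interpret R: cring laurent_ring by (rule cring_laurent_ring)
  have "\<ominus>\<^bsub>laurent_ring\<^esub> b = - b" by (rule R.minus_equality) (simp_all add: laurent_ring_def)
  then show ?thesis by (simp add: a_minus_def laurent_ring_def)
qed

lemma lcoset_eq_iff: "lcoset p a = lcoset p b \<longleftrightarrow> p dvd a - b"
proof -
  interpret R: cring laurent_ring by (rule cring_laurent_ring)
  have "lcoset p a = lcoset p b \<longleftrightarrow> a \<ominus>\<^bsub>laurent_ring\<^esub> b \<in> PIdl\<^bsub>laurent_ring\<^esub> p"
    unfolding lcoset_def by (rule R.quotient_eq_iff_same_a_r_cos[OF lideal, symmetric]) (simp_all add: laurent_ring_def)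
  also have "\<dots> \<longleftrightarrow> p dvd a - b" unfolding laurent_minus
    by (auto simp: cgenideal_def laurent_ring_def dvd_def mult.commute)
  finally show ?thesis .
qed

lemma cyclic_module_carrier: "carrier (cyclic_module laurent_ring p) = range (lcoset p)"
  by (auto simp: cyclic_module_def Let_def FactRing_def A_RCOSETS_def RCOSETS_def lcoset_def a_r_coset_def laurent_ring_def)

lemma cyclic_module_add: "lcoset p a \<oplus>\<^bsub>cyclic_module laurent_ring p\<^esub> lcoset p b = lcoset p (a + b)"
  using ideal.a_rcos_sum[OF lideal, of a b p]
  by (simp add: cyclic_module_def Let_def FactRing_def lcoset_def laurent_ring_def)

lemma cyclic_module_smult: "c \<odot>\<^bsub>cyclic_module laurent_ring p\<^esub> lcoset p b = lcoset p (c * b)"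
  using ideal.rcoset_mult_add[OF lideal, of c b p]
  by (simp add: cyclic_module_def Let_def FactRing_def lcoset_def laurent_ring_def)

section \<open>Conjugation on the abelianized kernel\<close>

locale augmented = group G for G :: "('a, 'b) monoid_scheme" (structure) +
  fixes \<chi> :: "'a \<Rightarrow> int" and x :: 'a
  assumes \<chi>_hom: "\<chi> \<in> hom G integer_group" and x: "x \<in> carrier G" and \<chi>_x: "\<chi> x = 1"
begin

definition K where "K = G\<lparr>carrier := kernel G integer_group \<chi>\<rparr>"
definition Dv where "Dv = derived K (carrier K)"
definition A where "A = K Mod Dv"
definition cl where "cl k = Dv #> k"
definition cj where "cj z k = z \<otimes> k \<otimes> inv z"
text \<open>Conjugation acts on the whole coset, exactly as in \<open>kernel_abelianization\<close>,
  so that no representative has to be chosen; \<open>tau_cl\<close> returns to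
  representatives.\<close>

definition tau where "tau i Y = (x [^] (i :: int)) <# Y #> inv (x [^] i)"

lemma \<chi>_mult: "a \<in> carrier G \<Longrightarrow> b \<in> carrier G \<Longrightarrow> \<chi> (a \<otimes> b) = \<chi> a + \<chi> b"
  using hom_mult[OF \<chi>_hom] by simp

lemma \<chi>_one: "\<chi> \<one> = 0"
  using \<chi>_mult[of \<one> \<one>] by simp

lemma \<chi>_inv: assumes a: "a \<in> carrier G" shows "\<chi> (inv a) = - \<chi> a"
proof -
  have "\<chi> (a \<otimes> inv a) = \<chi> a + \<chi> (inv a)" by (rule \<chi>_mult[OF a inv_closed[OF a]])
  then show ?thesis using \<chi>_one by (simp add: r_inv[OF a])
qed

lemma \<chi>_pow: "\<chi> (x [^] (i :: int)) = i"
proof -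
  have n: "\<chi> (x [^] (n :: nat)) = int n" for n
    by (induction n) (simp_all add: \<chi>_one \<chi>_mult x \<chi>_x)
  show ?thesis
  proof (cases i)
    case (nonneg k)
    show ?thesis unfolding nonneg int_pow_int by (rule n)
  next
    case (neg k)
    show ?thesis unfolding neg int_pow_neg[OF x] int_pow_int \<chi>_inv[OF nat_pow_closed[OF x]] n ..
  qed
qed

lemma mem_K: "k \<in> carrier K \<longleftrightarrow> k \<in> carrier G \<and> \<chi> k = 0"
  by (simp add: K_def kernel_def)

lemma carrier_K: "carrier K = kernel G integer_group \<chi>" by (simp add: K_def)

lemma subgroup_K: "subgroup (carrier K) G"
proof -
  have "group_hom G integer_group \<chi>"
    by (intro group_hom.intro group_hom_axioms.intro is_group group_integer_group \<chi>_hom)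
  then show ?thesis unfolding carrier_K by (rule group_hom.subgroup_kernel)
qed

lemma K_eq: "G\<lparr>carrier := carrier K\<rparr> = K"
  by (subst carrier_K) (rule K_def[symmetric])

lemma group_K: "group K"
  using subgroup_imp_group[OF subgroup_K] unfolding K_eq .

lemma K_ops: "monoid.mult K = monoid.mult G" "one K = one G" by (simp_all add: K_def)

lemma inv_K: "k \<in> carrier K \<Longrightarrow> inv\<^bsub>K\<^esub> k = inv k"
  using m_inv_consistent[OF subgroup_K, of k] unfolding K_eq .

lemma r_coset_K: "H #>\<^bsub>K\<^esub> k = H #> k" by (simp add: r_coset_def K_def)

lemma Dv_normal: "Dv \<lhd> K" unfolding Dv_def by (rule group.derived_self_is_normal[OF group_K])

lemma comm_group_A: "comm_group A" unfolding A_def Dv_def by (rule group.derived_quot_is_comm_group[OF group_K])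

lemma carrier_A: "carrier A = cl ` carrier K"
  by (auto simp: A_def FactGroup_def RCOSETS_def cl_def r_coset_K)

lemma cl_closed: "k \<in> carrier K \<Longrightarrow> cl k \<in> carrier A" unfolding carrier_A by (rule imageI)

lemma cl_mult: assumes "k \<in> carrier K" "l \<in> carrier K" shows "cl k \<otimes>\<^bsub>A\<^esub> cl l = cl (k \<otimes> l)"
  using normal.rcos_sum[OF Dv_normal assms] by (simp add: A_def FactGroup_def cl_def r_coset_K K_ops)

lemma K_mult: "k \<in> carrier K \<Longrightarrow> l \<in> carrier K \<Longrightarrow> k \<otimes> l \<in> carrier K"
  by (rule subgroup.m_closed[OF subgroup_K])

lemma K_inv: "k \<in> carrier K \<Longrightarrow> inv k \<in> carrier K" by (rule subgroup.m_inv_closed[OF subgroup_K])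

lemma K_one: "\<one> \<in> carrier K" by (rule subgroup.one_closed[OF subgroup_K])

lemma K_G: "k \<in> carrier K \<Longrightarrow> k \<in> carrier G" by (simp add: mem_K)

lemma cl_one: "cl \<one> = \<one>\<^bsub>A\<^esub>"
proof -
  interpret A: comm_group A by (rule comm_group_A)
  have "cl \<one> \<otimes>\<^bsub>A\<^esub> cl \<one> = cl \<one> \<otimes>\<^bsub>A\<^esub> \<one>\<^bsub>A\<^esub>"
    using cl_mult[OF K_one K_one] cl_closed[OF K_one] by (simp only: r_one[OF one_closed] A.r_one)
  then show ?thesis using cl_closed[OF K_one] by (simp only: A.l_cancel A.one_closed)
qed

lemma cl_inv: assumes k: "k \<in> carrier K" shows "inv\<^bsub>A\<^esub> cl k = cl (inv k)"
proof -
  interpret A: comm_group A by (rule comm_group_A)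
  have "cl (inv k) \<otimes>\<^bsub>A\<^esub> cl k = \<one>\<^bsub>A\<^esub>"
    unfolding cl_mult[OF K_inv[OF k] k] l_inv[OF K_G[OF k]] by (rule cl_one)
  then show ?thesis using cl_closed[OF k] cl_closed[OF K_inv[OF k]] by (intro A.inv_equality)
qed

lemma cj_K: assumes z: "z \<in> carrier G" and k: "k \<in> carrier K" shows "cj z k \<in> carrier K"
  using z k \<chi>_inv[OF z] by (simp add: mem_K cj_def \<chi>_mult)

lemma cj_mult: assumes "z \<in> carrier G" "k \<in> carrier G" "l \<in> carrier G" shows "cj z (k \<otimes> l) = cj z k \<otimes> cj z l"
proof -
  have "inv z \<otimes> (z \<otimes> y) = y" if "y \<in> carrier G" for y
    using assms that by (simp add: m_assoc[symmetric])
  then show ?thesis using assms by (simp add: cj_def m_assoc)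
qed

lemma cj_inv: assumes "z \<in> carrier G" "k \<in> carrier G" shows "cj z (inv k) = inv (cj z k)"
  using assms by (simp add: cj_def inv_mult_group m_assoc)

lemma cj_cj: assumes "y \<in> carrier G" "z \<in> carrier G" "k \<in> carrier G" shows "cj y (cj z k) = cj (y \<otimes> z) k"
  using assms by (simp add: cj_def inv_mult_group m_assoc)

lemma cj_one: "k \<in> carrier G \<Longrightarrow> cj \<one> k = k" by (simp add: cj_def)

lemma Dv_K: "d \<in> Dv \<Longrightarrow> d \<in> carrier K"
  using subgroup.mem_carrier[OF normal_imp_subgroup[OF Dv_normal]] .

text \<open>The derived subgroup of a normal subgroup is normal in the whole group, because
  conjugation by \<open>z\<close> carries commutators of the kernel to commutators of the
  kernel.\<close>

lemma cj_Dv: assumes z: "z \<in> carrier G" and d: "d \<in> Dv" shows "cj z d \<in> Dv"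
proof -
  note Ds = normal_imp_subgroup[OF Dv_normal]
  have "d \<in> generate K (derived_set K (carrier K))" using d unfolding Dv_def derived_def .
  \<comment> \<open>Membership in \<open>carrier K\<close> is carried along because distributing
    \<open>cj z\<close> over products and inverses requires it.\<close>
  then have "d \<in> carrier K \<and> cj z d \<in> Dv"
  proof (induction rule: generate.induct)
    case one
    have "cj z \<one> = \<one>" using z by (simp add: cj_def)
    then show ?case using K_one subgroup.one_closed[OF Ds] by (simp add: K_ops)
  next
    case (incl h)
    then obtain a b where ab: "a \<in> carrier K" "b \<in> carrier K" "h = a \<otimes> b \<otimes> inv a \<otimes> inv b"
      by (auto simp: K_ops inv_K)
    have c: "cj z a \<in> carrier K" "cj z b \<in> carrier K" using cj_K[OF z] ab by blast+
    have G: "a \<in> carrier G" "b \<in> carrier G" using ab K_G by blast+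
    have "cj z h = cj z a \<otimes> cj z b \<otimes> inv (cj z a) \<otimes> inv (cj z b)"
      unfolding ab(3) using z G by (simp add: cj_mult cj_inv)
    also have "\<dots> = cj z a \<otimes>\<^bsub>K\<^esub> cj z b \<otimes>\<^bsub>K\<^esub> inv\<^bsub>K\<^esub> (cj z a) \<otimes>\<^bsub>K\<^esub> inv\<^bsub>K\<^esub> (cj z b)"
      using c by (simp add: K_ops inv_K)
    also have "\<dots> \<in> Dv" unfolding Dv_def derived_def using c by (intro generate.incl) blast
    finally show ?case using ab K_mult K_inv by simp
  next
    case (inv h)
    then obtain a b where ab: "a \<in> carrier K" "b \<in> carrier K" "h = a \<otimes> b \<otimes> inv a \<otimes> inv b"
      by (auto simp: K_ops inv_K)
    have c: "cj z a \<in> carrier K" "cj z b \<in> carrier K" using cj_K[OF z] ab by blast+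
    have G: "a \<in> carrier G" "b \<in> carrier G" using ab K_G by blast+
    have hK: "h \<in> carrier K" using ab K_mult K_inv by simp
    have "cj z h = cj z a \<otimes> cj z b \<otimes> inv (cj z a) \<otimes> inv (cj z b)"
      unfolding ab(3) using z G by (simp add: cj_mult cj_inv)
    also have "\<dots> = cj z a \<otimes>\<^bsub>K\<^esub> cj z b \<otimes>\<^bsub>K\<^esub> inv\<^bsub>K\<^esub> (cj z a) \<otimes>\<^bsub>K\<^esub> inv\<^bsub>K\<^esub> (cj z b)"
      using c by (simp add: K_ops inv_K)
    also have "\<dots> \<in> Dv" unfolding Dv_def derived_def using c by (intro generate.incl) blast
    finally have "cj z h \<in> Dv" .
    then have "inv\<^bsub>K\<^esub> cj z h \<in> Dv" by (rule subgroup.m_inv_closed[OF Ds])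
    then have "inv (cj z h) \<in> Dv" using inv_K[OF cj_K[OF z hK]] by simp
    then show ?case using cj_inv[OF z K_G[OF hK]] K_inv[OF hK] inv_K[OF hK] by simp
  next
    case (eng h1 h2)
    have "cj z (h1 \<otimes> h2) \<in> Dv"
      using eng cj_mult[OF z, of h1 h2] K_G subgroup.m_closed[OF Ds, of "cj z h1" "cj z h2"] by (simp add: K_ops)
    then show ?case using eng K_mult by (simp add: K_ops)
  qed
  then show ?thesis by blast
qed

text \<open>Conjugation distributes over the coset, and it maps \<open>Dv\<close> onto itself:
  \<open>cj_Dv\<close> is applied to \<open>z\<close> for one inclusion and to its inverse for the
  other.\<close>

lemma tau_cl: assumes k: "k \<in> carrier K" shows "tau i (cl k) = cl (cj (x [^] i) k)"
proof -
  define z where "z = x [^] i"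
  have z: "z \<in> carrier G" unfolding z_def using x by simp
  note kG = K_G[OF k]
  have "tau i (cl k) = (\<lambda>d. z \<otimes> (d \<otimes> k) \<otimes> inv z) ` Dv"
    unfolding tau_def cl_def z_def[symmetric] by (auto simp: l_coset_def r_coset_def)
  also have "\<dots> = (\<lambda>d. cj z d \<otimes> cj z k) ` Dv"
    by (rule image_cong[OF refl]) (use cj_mult[OF z _ kG] Dv_K K_G in \<open>auto simp: cj_def\<close>)
  also have "\<dots> = (\<lambda>d. d \<otimes> cj z k) ` (cj z ` Dv)" by (simp only: image_image)
  also have "cj z ` Dv = Dv"
  proof
    show "cj z ` Dv \<subseteq> Dv" using cj_Dv[OF z] by blast
    show "Dv \<subseteq> cj z ` Dv"
    proof
      fix d assume d: "d \<in> Dv"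
      have dG: "d \<in> carrier G" using d Dv_K K_G by blast
      have "d = cj z (cj (inv z) d)" using cj_cj[OF z inv_closed[OF z] dG] r_inv[OF z] cj_one[OF dG] by simp
      then show "d \<in> cj z ` Dv" using cj_Dv[OF inv_closed[OF z] d] by blast
    qed
  qed
  also have "(\<lambda>d. d \<otimes> cj z k) ` Dv = cl (cj z k)" by (auto simp: cl_def r_coset_def)
  finally show ?thesis unfolding z_def .
qed

lemma tau_closed: "Y \<in> carrier A \<Longrightarrow> tau i Y \<in> carrier A"
  unfolding carrier_A using tau_cl cj_K[OF int_pow_closed[OF x]] by auto

lemma tau_hom: "tau i \<in> hom A A"
proof (rule homI)
  show "tau i Y \<in> carrier A" if "Y \<in> carrier A" for Y using tau_closed that .
  fix Y Z assume "Y \<in> carrier A" "Z \<in> carrier A"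
  then obtain k l where kl: "k \<in> carrier K" "l \<in> carrier K" "Y = cl k" "Z = cl l" unfolding carrier_A by blast
  have z: "x [^] i \<in> carrier G" by (rule int_pow_closed[OF x])
  show "tau i (Y \<otimes>\<^bsub>A\<^esub> Z) = tau i Y \<otimes>\<^bsub>A\<^esub> tau i Z"
    unfolding kl(3,4) cl_mult[OF kl(1,2)] tau_cl[OF kl(1)] tau_cl[OF kl(2)] tau_cl[OF K_mult[OF kl(1,2)]]
      cl_mult[OF cj_K[OF z kl(1)] cj_K[OF z kl(2)]] cj_mult[OF z K_G[OF kl(1)] K_G[OF kl(2)]] ..
qed

lemma tau_tau: assumes "Y \<in> carrier A" shows "tau i (tau j Y) = tau (i + j) Y"
proof -
  obtain k where k: "k \<in> carrier K" "Y = cl k" using assms unfolding carrier_A by blast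
  have z: "x [^] i \<in> carrier G" "x [^] j \<in> carrier G" by (rule int_pow_closed[OF x])+
  show ?thesis unfolding k(2) tau_cl[OF k(1)] tau_cl[OF cj_K[OF z(2) k(1)]] cj_cj[OF z K_G[OF k(1)]]
    int_pow_mult[OF x] ..
qed

lemma tau_0: assumes "Y \<in> carrier A" shows "tau 0 Y = Y"
proof -
  obtain k where k: "k \<in> carrier K" "Y = cl k" using assms unfolding carrier_A by blast
  show ?thesis unfolding k(2) tau_cl[OF k(1)] using cj_one[OF K_G[OF k(1)]] by simp
qed

lemma tau_funpow: assumes Y: "Y \<in> carrier A" shows "(tau 1 ^^ j) Y = tau (int j) Y"
proof (induction j)
  case 0 then show ?case by (simp add: tau_0[OF Y])
next
  case (Suc j)
  have "tau 1 (tau (int j) Y) = tau (int (Suc j)) Y" using tau_tau[OF Y, of 1 "int j"] by simp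
  then show ?case using Suc by simp
qed

end

section \<open>Vectors of polynomials and direct sums of cyclic modules\<close>

lemma zt_module_vec: "zt_module (\<lambda>a (v :: nat \<Rightarrow> int poly) i. a * v i)"
  by (unfold_locales; rule ext; simp only: plus_fun_apply distrib_left distrib_right mult.assoc mult_1_left)

interpretation vec: zt_module "\<lambda>a (v :: nat \<Rightarrow> int poly) i. a * v i"
  by (rule zt_module_vec)

text \<open>The free module on \<open>I\<close>, realised inside one fixed type so that its rank can
  vary.\<close>

definition supported :: "nat set \<Rightarrow> (nat \<Rightarrow> int poly) set" where
  "supported I = {v. \<forall>i. i \<notin> I \<longrightarrow> v i = 0}"

lemma vec_subspace_supported: "vec.subspace (supported I)"
  by (rule vec.subspaceI) (auto simp: supported_def)

lemma sum_fun_apply: "(\<Sum>i\<in>I. f i) j = (\<Sum>i\<in>I. f i j)" for f :: "'i \<Rightarrow> 'j \<Rightarrow> 'k :: comm_monoid_add"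
  by (induction I rule: infinite_finite_induct) simp_all

lemma supported_eq_span:
  assumes "finite I"
  shows "supported I = vec.span ((\<lambda>i j. if j = i then 1 else 0) ` I)"
proof
  let ?e = "\<lambda>i j :: nat. if j = i then 1 else 0 :: int poly"
  show "supported I \<subseteq> vec.span (?e ` I)"
  proof
    fix v assume v: "v \<in> supported I"
    have eq: "(\<Sum>i\<in>I. (\<lambda>j. v i * ?e i j)) = v"
    proof
      fix j
      have "(\<Sum>i\<in>I. (\<lambda>j. v i * ?e i j)) j = (\<Sum>i\<in>I. v i * ?e i j)" by (rule sum_fun_apply)
      also have "\<dots> = (\<Sum>i\<in>I. if i = j then v i else 0)" by (rule sum.cong) auto
      also have "\<dots> = v j" using v assms by (auto simp: supported_def)
      finally show "(\<Sum>i\<in>I. (\<lambda>j. v i * ?e i j)) j = v j" .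
    qed
    have "(\<Sum>i\<in>I. (\<lambda>j. v i * ?e i j)) \<in> vec.span (?e ` I)"
    proof (rule vec.span_sum)
      fix i assume "i \<in> I"
      then have "?e i \<in> vec.span (?e ` I)" by (intro vec.span_base) blast
      from vec.span_scale[OF this, of "v i"] show "(\<lambda>j. v i * ?e i j) \<in> vec.span (?e ` I)" .
    qed
    then show "v \<in> vec.span (?e ` I)" unfolding eq .
  qed
  show "vec.span (?e ` I) \<subseteq> supported I"
    by (rule vec.span_minimal[OF _ vec_subspace_supported]) (auto simp: supported_def)
qed

lemma lin_rec_idx_cyclic:
  fixes \<pi> :: "int poly"
  shows "lin_rec (\<lambda>r. of_nat (idx (ring.zsat UNIV (ring.span {\<pi>, t_pow_minus_1 r})) (ring.span {\<pi>, t_pow_minus_1 r})))"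
proof (cases "\<pi> = 0")
  case True
  \<comment> \<open>Without a relation the quotient is the ring modulo \<open>t ^ r - 1\<close>,
    which is torsion-free, and the sequence is constantly 1.\<close>
  show ?thesis
  proof (rule lin_rec_cong[OF _ lin_rec_const[of 1]])
    fix r :: nat assume r: "r \<ge> 1"
    let ?S = "ring.span {\<pi>, t_pow_minus_1 r}"
    have "ring.zsat UNIV ?S = ?S"
    proof
      show "?S \<subseteq> ring.zsat UNIV ?S" by (rule ring.subset_zsat) simp
      show "ring.zsat UNIV ?S \<subseteq> ?S"
      proof
        fix v assume "v \<in> ring.zsat UNIV ?S"
        then obtain n where n: "n \<noteq> 0" "[:n:] * v \<in> ?S" unfolding ring.zsat_def by blast
        then obtain x y where "[:n:] * v = x * \<pi> + y * t_pow_minus_1 r" unfolding ring_span_pair by blast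
        then have "[:n:] * v = t_pow_minus_1 r * y" by (simp only: True mult_zero_right add_0 mult.commute)
        then have "t_pow_minus_1 r dvd v" by (rule t_pow_minus_1_dvd_cancel[OF _ n(1) r])
        then obtain z where "v = t_pow_minus_1 r * z" by (elim dvdE)
        then have "v = 0 * \<pi> + z * t_pow_minus_1 r" by (simp only: mult_zero_left add_0 mult.commute)
        then show "v \<in> ?S" unfolding ring_span_pair by blast
      qed
    qed
    then show "1 = complex_of_nat (idx (ring.zsat UNIV ?S) ?S)"
      using idx_self[OF ring.subspace_sgrp[OF ring.subspace_span]] by simp
  qed
next
  case False
  obtain M where M: "M \<ge> 1" and cl: "\<And>c. \<exists>d f' q b. lead_coeff d = 1 \<and> \<pi> = d * f' \<and> (\<forall>r\<ge>1. r mod M = c \<longrightarrow>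
    t_pow_minus_1 r = d * q r \<and> coprime (q r) \<pi> \<and> (even r \<longleftrightarrow> b))"
    using t_pow_minus_1_class[OF False] by blast
  show ?thesis
  proof (rule lin_rec_glue[OF M])
    fix c
    obtain d f' q b where d1: "lead_coeff d = 1" and ff: "\<pi> = d * f'" and
      d: "\<forall>r\<ge>1. r mod M = c \<longrightarrow> t_pow_minus_1 r = d * q r \<and> coprime (q r) \<pi> \<and> (even r \<longleftrightarrow> b)" using cl[of c] by blast
    have d0: "d \<noteq> 0" and f'0: "f' \<noteq> 0" using ff False by auto
    have cqf: "coprime (q r) f'" if "r \<ge> 1" "r mod M = c" for r
    proof -
      have "coprime (q r) \<pi>" using d that by blast
      then show ?thesis unfolding ff by simp
    qed
    have "\<exists>E. lin_rec E \<and> (\<forall>r\<in>{r. r \<ge> 1 \<and> r mod M = c}. of_nat (idx UNIV (ring.span {f', q r})) = E r)"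
    proof (rule lin_rec_idx_class[OF f'0 d1])
      fix r assume "r \<in> {r. r \<ge> 1 \<and> r mod M = c}"
      then have r: "r \<ge> 1" "r mod M = c" by simp_all
      have "t_pow_minus_1 r = d * q r \<and> coprime (q r) \<pi> \<and> (even r \<longleftrightarrow> b)" using d r by blast
      then show "r \<ge> 1 \<and> t_pow_minus_1 r = d * q r \<and> coprime (q r) f' \<and> (even r \<longleftrightarrow> b)"
        using r(1) cqf[OF r] by blast
    qed
    then obtain E where E: "lin_rec E" "\<And>r. r \<ge> 1 \<Longrightarrow> r mod M = c \<Longrightarrow> of_nat (idx UNIV (ring.span {f', q r})) = E r"
      by blast
    have "idx (ring.zsat UNIV (ring.span {\<pi>, t_pow_minus_1 r})) (ring.span {\<pi>, t_pow_minus_1 r}) = idx UNIV (ring.span {f', q r})"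
      if r: "r \<ge> 1" "r mod M = c" for r
    proof -
      let ?S = "ring.span {\<pi>, t_pow_minus_1 r}"
      have dq: "t_pow_minus_1 r = d * q r" using d r by blast
      have mem: "d * a \<in> ?S \<longleftrightarrow> a \<in> ring.span {f', q r}" for a
      proof -
        have iff: "d * a = x * \<pi> + y * t_pow_minus_1 r \<longleftrightarrow> a = x * f' + y * q r" for x y
        proof -
          have eq: "x * \<pi> + y * t_pow_minus_1 r = d * (x * f' + y * q r)"
            unfolding ff dq by (simp only: distrib_left mult.left_commute)
          show ?thesis unfolding eq by (rule mult_left_cancel[OF d0])
        qed
        show ?thesis by (simp only: ring_span_pair iff mem_Collect_eq)
      qed
      \<comment> \<open>\<open>d\<close> divides \<open>t ^ r - 1\<close> and is therefore coprime
        to nonzero integers, so the saturation stays within the multiples of \<open>d\<close>. The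
        Bezout integer for \<open>f'\<close> and \<open>q r\<close> brings each multiple of
        \<open>d\<close> back into the ideal.\<close>
      have Z: "v \<in> ring.zsat UNIV ?S \<longleftrightarrow> d dvd v" for v
      proof
        assume "v \<in> ring.zsat UNIV ?S"
        then obtain n where n: "n \<noteq> 0" "[:n:] * v \<in> ?S" unfolding ring.zsat_def by blast
        then obtain x y where "[:n:] * v = x * \<pi> + y * t_pow_minus_1 r" unfolding ring_span_pair by blast
        also have "d dvd \<dots>" unfolding ff dq by (intro dvd_add dvd_mult dvd_triv_left)
        finally have "d dvd [:n:] * v" .
        moreover have "coprime d [:n:]"
          by (rule coprime_divisors[OF _ dvd_refl, of d "t_pow_minus_1 r"])
             (simp add: dq, simp add: coprime_const_t_pow_minus_1[OF n(1) r(1)] coprime_commute)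
        ultimately show "d dvd v" by (simp only: coprime_dvd_mult_right_iff)
      next
        assume "d dvd v"
        then obtain a where a: "v = d * a" by (elim dvdE)
        have "coprime f' (q r)" using cqf[OF r] by (simp add: coprime_commute)
        then obtain k x y where k: "k \<noteq> 0" "[:k:] = x * f' + y * q r" by (rule int_poly_bezout[OF _ f'0])
        have "[:k:] * a = (a * x) * f' + (a * y) * q r" unfolding k(2) by (simp only: distrib_left distrib_right mult.assoc mult.commute mult.left_commute)
        then have "[:k:] * a \<in> ring.span {f', q r}" unfolding ring_span_pair by blast
        then have "d * ([:k:] * a) \<in> ?S" unfolding mem .
        then have "[:k:] * v \<in> ?S" unfolding a by (simp only: mult.left_commute)
        then show "v \<in> ring.zsat UNIV ?S" unfolding ring.zsat_def using k(1) by blast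
      qed
      have sg: "sgrp (ring.span A)" for A by (rule ring.subspace_sgrp[OF ring.subspace_span])
      show ?thesis
      proof (rule sym, rule idx_eqI[OF sg sg, of _ "\<lambda>a. d * a"])
        show "d * a \<in> ring.zsat UNIV ?S" for a unfolding Z by (rule dvd_triv_left)
        show "(d * a - d * b \<in> ?S) = (a - b \<in> ring.span {f', q r})" for a b
          unfolding right_diff_distrib[symmetric] by (rule mem)
        show "\<exists>a\<in>UNIV. y - d * a \<in> ?S" if y: "y \<in> ring.zsat UNIV ?S" for y
        proof -
          obtain a where "y = d * a" using y unfolding Z by (elim dvdE)
          then have "y - d * a = 0" by simp
          then have "y - d * a \<in> ?S" by (simp only: ring.span_zero)
          then show ?thesis by blast
        qed
      qed
    qed
    then show "\<exists>E. lin_rec E \<and> (\<forall>r\<ge>1. r mod M = c \<longrightarrow>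
        complex_of_nat (idx (ring.zsat UNIV (ring.span {\<pi>, t_pow_minus_1 r})) (ring.span {\<pi>, t_pow_minus_1 r})) = E r)"
      using E by auto
  qed
qed

text \<open>Both \<open>D r\<close> and its saturation are described coordinate by coordinate, so
  the index is the product of the indices of the cyclic summands.\<close>

lemma lin_rec_idx_sum_of_cyclics:
  fixes \<pi> :: "nat \<Rightarrow> int poly"
  assumes I: "finite I"
  defines "N \<equiv> {v \<in> supported I. \<forall>i\<in>I. \<pi> i dvd v i}"
  defines "D r \<equiv> N + (\<lambda>v i. t_pow_minus_1 r * v i) ` supported I"
  shows "lin_rec (\<lambda>r. of_nat (idx (vec.zsat (supported I) (D r)) (D r)))"
proof -
  let ?W = "supported I"
  let ?S = "\<lambda>r i. ring.span {\<pi> i, t_pow_minus_1 r}"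
  have memD: "v \<in> D r \<longleftrightarrow> v \<in> ?W \<and> (\<forall>i\<in>I. v i \<in> ?S r i)" for v r
  proof
    assume "v \<in> D r"
    from iffD1[OF mem_set_plus_iff this[unfolded D_def]]
    obtain w where w: "w \<in> ?W" "v - (\<lambda>i. t_pow_minus_1 r * w i) \<in> N" by blast
    have "v i = 0" if "i \<notin> I" for i
    proof -
      have "(v - (\<lambda>i. t_pow_minus_1 r * w i)) i = 0" "w i = 0" using w that unfolding N_def supported_def by blast+
      then show ?thesis by simp
    qed
    moreover have "v i \<in> ?S r i" if "i \<in> I" for i
    proof -
      have "\<pi> i dvd (v - (\<lambda>i. t_pow_minus_1 r * w i)) i" using w that unfolding N_def by blast
      then obtain k where "v i - t_pow_minus_1 r * w i = \<pi> i * k" by (auto elim: dvdE)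
      then have "v i = k * \<pi> i + w i * t_pow_minus_1 r" by (simp add: diff_eq_eq mult.commute)
      then show ?thesis unfolding ring_span_pair by blast
    qed
    ultimately show "v \<in> ?W \<and> (\<forall>i\<in>I. v i \<in> ?S r i)" unfolding supported_def by blast
  next
    assume v: "v \<in> ?W \<and> (\<forall>i\<in>I. v i \<in> ?S r i)"
    then have "\<forall>i\<in>I. \<exists>x y. v i = x * \<pi> i + y * t_pow_minus_1 r" unfolding ring_span_pair by blast
    then obtain x y where xy: "\<forall>i\<in>I. v i = x i * \<pi> i + y i * t_pow_minus_1 r" by metis
    let ?w = "\<lambda>i. if i \<in> I then y i else 0"
    have w: "?w \<in> ?W" unfolding supported_def by simp
    have vi: "(v - (\<lambda>i. t_pow_minus_1 r * ?w i)) i = (if i \<in> I then \<pi> i * x i else 0)" for i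
      using xy v by (auto simp: supported_def mult.commute)
    have "v - (\<lambda>i. t_pow_minus_1 r * ?w i) \<in> N" unfolding N_def supported_def mem_Collect_eq vi by simp
    moreover have "(\<lambda>i. t_pow_minus_1 r * ?w i) \<in> (\<lambda>v i. t_pow_minus_1 r * v i) ` ?W" by (rule imageI[OF w])
    ultimately show "v \<in> D r" unfolding D_def by (intro iffD2[OF mem_set_plus_iff]) blast
  qed
  have memZ: "v \<in> vec.zsat ?W (D r) \<longleftrightarrow> v \<in> ?W \<and> (\<forall>i\<in>I. v i \<in> ring.zsat UNIV (?S r i))" for v r
  proof
    assume "v \<in> vec.zsat ?W (D r)"
    then obtain n where n: "v \<in> ?W" "n \<noteq> 0" "(\<lambda>i. [:n:] * v i) \<in> D r" unfolding vec.zsat_def by blast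
    then show "v \<in> ?W \<and> (\<forall>i\<in>I. v i \<in> ring.zsat UNIV (?S r i))" unfolding memD ring.zsat_def by blast
  next
    assume v: "v \<in> ?W \<and> (\<forall>i\<in>I. v i \<in> ring.zsat UNIV (?S r i))"
    then have "\<forall>i\<in>I. \<exists>n. n \<noteq> 0 \<and> [:n:] * v i \<in> ?S r i" unfolding ring.zsat_def by blast
    then obtain n where n: "\<forall>i\<in>I. n i \<noteq> 0 \<and> [:n i:] * v i \<in> ?S r i" by metis
    \<comment> \<open>One integer has to serve all coordinates at once; \<open>I\<close> is finite,
      so the product of the single multipliers does.\<close>
    define m where "m = prod n I"
    have "[:m:] * v i \<in> ?S r i" if i: "i \<in> I" for i
    proof -
      have "m = prod n (I - {i}) * n i" unfolding m_def using prod.remove[OF I i, of n] by (simp add: mult.commute)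
      then have "[:m:] = [:prod n (I - {i}):] * [:n i:]" by simp
      then have eq: "[:m:] * v i = [:prod n (I - {i}):] * ([:n i:] * v i)" by (simp only: mult.assoc)
      show ?thesis unfolding eq by (rule ring.span_scale) (use n i in blast)
    qed
    moreover have "m \<noteq> 0" unfolding m_def using n I by simp
    moreover have "(\<lambda>i. [:m:] * v i) \<in> ?W" using v unfolding supported_def by simp
    ultimately show "v \<in> vec.zsat ?W (D r)" unfolding vec.zsat_def memD using v by blast
  qed
  have sS: "ring.subspace (?S r i)" for r i by (rule ring.subspace_span)
  have sZ: "ring.subspace (ring.zsat UNIV (?S r i))" for r i by (rule ring.subspace_zsat[OF _ sS]) simp
  have sN: "vec.subspace N"
    by (rule vec.subspaceI) (simp_all add: N_def supported_def)
  have sD: "sgrp (D r)" for r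
    unfolding D_def by (rule vec.subspace_sgrp[OF vec.subspace_set_plus[OF sN vec.subspace_scale_image[OF vec_subspace_supported]]])
  have eq: "idx (vec.zsat ?W (D r)) (D r) = (\<Prod>i\<in>I. idx (ring.zsat UNIV (?S r i)) (?S r i))" for r
  proof -
    have Zeq: "vec.zsat ?W (D r) = {v. (\<forall>i\<in>I. v i \<in> ring.zsat UNIV (?S r i)) \<and> (\<forall>i. i \<notin> I \<longrightarrow> v i = 0)}"
      using memZ unfolding supported_def by blast
    have "idx (vec.zsat ?W (D r)) (D r) = card ((\<lambda>v. \<lambda>i\<in>I. coset (?S r i) (v i)) ` vec.zsat ?W (D r))"
      unfolding idx_def
    proof (rule card_image_eq_if_same_kernel)
      fix v w assume v: "v \<in> vec.zsat ?W (D r)" and w: "w \<in> vec.zsat ?W (D r)"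
      have "coset (D r) v = coset (D r) w \<longleftrightarrow> v - w \<in> D r" by (rule coset_eq_iff[OF sD])
      also have "\<dots> \<longleftrightarrow> (\<forall>i\<in>I. v i - w i \<in> ?S r i)"
      proof -
        have "v \<in> ?W" "w \<in> ?W" using v w unfolding memZ by simp_all
        then have "v - w \<in> ?W" by (rule vec.subspace_diff[OF vec_subspace_supported])
        then show ?thesis unfolding memD by simp
      qed
      also have "\<dots> \<longleftrightarrow> (\<forall>i\<in>I. coset (?S r i) (v i) = coset (?S r i) (w i))"
        using coset_eq_iff[OF ring.subspace_sgrp[OF sS]] by blast
      also have "\<dots> \<longleftrightarrow> (\<lambda>i\<in>I. coset (?S r i) (v i)) = (\<lambda>i\<in>I. coset (?S r i) (w i))"
      proof
        assume "\<forall>i\<in>I. coset (?S r i) (v i) = coset (?S r i) (w i)"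
        then show "(\<lambda>i\<in>I. coset (?S r i) (v i)) = (\<lambda>i\<in>I. coset (?S r i) (w i))" by (intro restrict_ext) simp
      next
        assume e: "(\<lambda>i\<in>I. coset (?S r i) (v i)) = (\<lambda>i\<in>I. coset (?S r i) (w i))"
        show "\<forall>i\<in>I. coset (?S r i) (v i) = coset (?S r i) (w i)"
        proof
          fix i assume "i \<in> I"
          then show "coset (?S r i) (v i) = coset (?S r i) (w i)" using fun_cong[OF e, of i] by simp
        qed
      qed
      finally show "coset (D r) v = coset (D r) w \<longleftrightarrow> (\<lambda>i\<in>I. coset (?S r i) (v i)) = (\<lambda>i\<in>I. coset (?S r i) (w i))" .
    qed
    then show ?thesis unfolding Zeq
      using idx_product[of I "\<lambda>i. ring.zsat UNIV (?S r i)" "?S r", OF I ring.subspace_sgrp[OF sZ] ring.subspace_sgrp[OF sS]] by simp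
  qed
  show ?thesis unfolding eq of_nat_prod by (rule lin_rec_prod) (rule lin_rec_idx_cyclic)
qed

section \<open>Torsion numbers of augmented groups\<close>

context augmented begin

abbreviation "M \<equiv> kernel_abelianization G \<chi> x"

lemma M_simps: "carrier M = carrier A" "\<zero>\<^bsub>M\<^esub> = \<one>\<^bsub>A\<^esub>" "(\<oplus>\<^bsub>M\<^esub>) = (\<otimes>\<^bsub>A\<^esub>)"
  "p \<odot>\<^bsub>M\<^esub> Y = finprod A (\<lambda>i. tau i Y [^]\<^bsub>A\<^esub> Poly_Mapping.lookup p i) (Poly_Mapping.keys p)"
  unfolding kernel_abelianization_def Let_def A_def Dv_def K_def tau_def by simp_all

lemma finprod_singleton: assumes "\<And>i. f i \<in> carrier A" shows "finprod A f {j} = f j"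
proof -
  interpret A: comm_group A by (rule comm_group_A)
  show ?thesis using A.finprod_insert[of "{}" j f] assms by simp
qed

lemma smult_t: assumes Y: "Y \<in> carrier A" shows "laurent_t \<odot>\<^bsub>M\<^esub> Y = tau 1 Y"
proof -
  interpret A: comm_group A by (rule comm_group_A)
  have k: "Poly_Mapping.keys laurent_t = {1}" by (simp add: laurent_t_def)
  have "laurent_t \<odot>\<^bsub>M\<^esub> Y = tau 1 Y [^]\<^bsub>A\<^esub> Poly_Mapping.lookup laurent_t 1"
    unfolding M_simps k by (rule finprod_singleton) (rule A.int_pow_closed[OF tau_closed[OF Y]])
  then show ?thesis using tau_closed[OF Y, of 1] by (simp add: laurent_t_def)
qed

lemma smult_t_pow_minus_1:
  assumes Y: "Y \<in> carrier A" and r: "r \<ge> 1"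
  shows "(laurent_t ^ r - 1) \<odot>\<^bsub>M\<^esub> Y = tau (int r) Y \<otimes>\<^bsub>A\<^esub> inv\<^bsub>A\<^esub> Y"
proof -
  interpret A: comm_group A by (rule comm_group_A)
  let ?p = "laurent_t ^ r - 1"
  \<comment> \<open>A positive \<open>r\<close> keeps the exponents \<open>int r\<close> and 0
    apart, so that the support has two elements.\<close>
  have l: "Poly_Mapping.lookup ?p i = (if i = int r then 1 else if i = 0 then -1 else 0)" for i
    using r by (auto simp: laurent_t_power lookup_minus lookup_single lookup_one when_def)
  have k: "Poly_Mapping.keys ?p = {int r, 0}"
    using r by (auto simp: in_keys_iff l split: if_splits)
  let ?f = "\<lambda>i. tau i Y [^]\<^bsub>A\<^esub> Poly_Mapping.lookup ?p i"
  have c: "?f i \<in> carrier A" for i by (rule A.int_pow_closed[OF tau_closed[OF Y]])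
  have "?p \<odot>\<^bsub>M\<^esub> Y = finprod A ?f (insert (int r) {0})" unfolding M_simps k by (rule refl)
  also have "\<dots> = ?f (int r) \<otimes>\<^bsub>A\<^esub> finprod A ?f {0}"
    by (rule A.finprod_insert) (use r c in auto)
  also have "finprod A ?f {0} = ?f 0"
    by (rule finprod_singleton[OF c])
  also have "?f 0 = inv\<^bsub>A\<^esub> Y" using r Y by (simp add: l tau_0 A.int_pow_neg)
  also have "?f (int r) = tau (int r) Y" using tau_closed[OF Y] by (simp add: l)
  finally show ?thesis .
qed

lemma comm_group_add: "comm_group (add_monoid M)"
proof -
  interpret A: comm_group A by (rule comm_group_A)
  show ?thesis
  proof (rule comm_groupI)
    show "\<exists>y\<in>carrier (add_monoid M). y \<otimes>\<^bsub>add_monoid M\<^esub> Y = \<one>\<^bsub>add_monoid M\<^esub>" if "Y \<in> carrier (add_monoid M)" for Y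
      using that by (intro bexI[of _ "inv\<^bsub>A\<^esub> Y"]) (simp_all add: M_simps)
  qed (simp_all add: M_simps A.m_ac)
qed

lemma inv_add: assumes Y: "Y \<in> carrier A" shows "inv\<^bsub>add_monoid M\<^esub> Y = inv\<^bsub>A\<^esub> Y"
proof -
  interpret A: comm_group A by (rule comm_group_A)
  interpret B: comm_group "add_monoid M" by (rule comm_group_add)
  show ?thesis by (rule B.inv_equality) (use Y in \<open>simp_all add: M_simps\<close>)
qed

text \<open>It remains to present the module by a map \<open>\<theta>\<close> from vectors of integer polynomials.\<close>

lemma torsion_number_eq_idx:
  assumes \<theta>c: "\<And>v. v \<in> supported I \<Longrightarrow> \<theta> v \<in> carrier A"
    and \<theta>a: "\<And>u v. u \<in> supported I \<Longrightarrow> v \<in> supported I \<Longrightarrow> \<theta> (u + v) = \<theta> u \<otimes>\<^bsub>A\<^esub> \<theta> v"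
    and \<theta>t: "\<And>v. v \<in> supported I \<Longrightarrow> \<theta> (\<lambda>i. monom 1 1 * v i) = tau 1 (\<theta> v)"
    and sur: "\<And>Y. Y \<in> carrier A \<Longrightarrow> \<exists>j. \<exists>v\<in>supported I. tau (int j) Y = \<theta> v"
    and r: "r \<ge> 1"
  defines "D \<equiv> {v \<in> supported I. \<theta> v = \<one>\<^bsub>A\<^esub>} + (\<lambda>v i. t_pow_minus_1 r * v i) ` supported I"
  shows "torsion_number G \<chi> x r = idx (vec.zsat (supported I) D) D"
proof -
  have h: "tau 1 \<in> hom (add_monoid M) (add_monoid M)" using tau_hom[of 1] by (simp add: hom_def M_simps)
  have e1: "card (torsion_subgroup (add_monoid M Mod ((\<lambda>Y. (tau 1 ^^ r) Y \<otimes>\<^bsub>add_monoid M\<^esub> inv\<^bsub>add_monoid M\<^esub> Y) ` carrier (add_monoid M))))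
    = idx (vec.zsat (supported I) ({v \<in> supported I. \<theta> v = \<one>\<^bsub>add_monoid M\<^esub>} + (\<lambda>v i. t_pow_minus_1 r * v i) ` supported I))
        ({v \<in> supported I. \<theta> v = \<one>\<^bsub>add_monoid M\<^esub>} + (\<lambda>v i. t_pow_minus_1 r * v i) ` supported I)"
  proof (rule vec.card_torsion_eq_idx[OF comm_group_add vec_subspace_supported _ _ h _ _ r])
    show "\<theta> v \<in> carrier (add_monoid M)" if "v \<in> supported I" for v using \<theta>c[OF that] by (simp add: M_simps)
    show "\<theta> (u + v) = \<theta> u \<otimes>\<^bsub>add_monoid M\<^esub> \<theta> v" if "u \<in> supported I" "v \<in> supported I" for u v
      using \<theta>a[OF that] by (simp add: M_simps)
    show "\<theta> (\<lambda>i. monom 1 1 * v i) = tau 1 (\<theta> v)" if "v \<in> supported I" for v by (rule \<theta>t[OF that])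
    show "\<exists>j. \<exists>v\<in>supported I. (tau 1 ^^ j) Y = \<theta> v" if "Y \<in> carrier (add_monoid M)" for Y
    proof -
      have Y: "Y \<in> carrier A" using that by (simp add: M_simps)
      show ?thesis unfolding tau_funpow[OF Y] by (rule sur[OF Y])
    qed
  qed
  have e2: "(\<lambda>Y. (tau 1 ^^ r) Y \<otimes>\<^bsub>add_monoid M\<^esub> inv\<^bsub>add_monoid M\<^esub> Y) ` carrier (add_monoid M)
      = (\<lambda>v. (laurent_t ^ r - 1) \<odot>\<^bsub>M\<^esub> v) ` carrier M"
  proof (rule image_cong)
    fix Y assume "Y \<in> carrier M"
    then have Y: "Y \<in> carrier A" by (simp add: M_simps)
    show "(tau 1 ^^ r) Y \<otimes>\<^bsub>add_monoid M\<^esub> inv\<^bsub>add_monoid M\<^esub> Y = (laurent_t ^ r - 1) \<odot>\<^bsub>M\<^esub> Y"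
      unfolding tau_funpow[OF Y] inv_add[OF Y] smult_t_pow_minus_1[OF Y r] by (simp add: M_simps)
  qed simp
  show ?thesis using e1[unfolded e2] unfolding torsion_number_def Let_def D_def by (simp add: M_simps)
qed

text \<open>\<open>\<theta>\<close> embeds polynomial vectors into Laurent vectors and then inverts
  the given isomorphism. Its kernel is cut out by divisibility by the polynomials \<open>q i\<close>
  that \<open>laurent_associate\<close> attaches to the \<open>\<pi> i\<close>, so the presented
  module again splits into cyclic pieces.\<close>

lemma lin_rec_torsion_number_cyclic:
  assumes "direct_sum_of_cyclics M"
  shows "lin_rec (\<lambda>r. of_nat (torsion_number G \<chi> x r))"
proof -
  interpret A: comm_group A by (rule comm_group_A)
  obtain n \<pi> h where h: "h \<in> module_iso laurent_ring M (module_sum {1..n::nat} (\<lambda>i. cyclic_module laurent_ring (\<pi> i)))"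
    using assms unfolding direct_sum_of_cyclics_def by blast
  let ?I = "{1..n}"
  let ?S = "\<Pi>\<^sub>E i\<in>?I. range (lcoset (\<pi> i))"
  have bij: "bij_betw h (carrier A) ?S"
    using h unfolding module_iso_def iso_def by (simp add: M_simps module_sum_def cyclic_module_carrier)
  have hm: "h (Y \<otimes>\<^bsub>A\<^esub> Z) = (\<lambda>i\<in>?I. h Y i \<oplus>\<^bsub>cyclic_module laurent_ring (\<pi> i)\<^esub> h Z i)"
    if "Y \<in> carrier A" "Z \<in> carrier A" for Y Z
    using h that unfolding module_iso_def iso_def hom_def by (simp add: M_simps module_sum_def)
  have hsm: "h (laurent_t \<odot>\<^bsub>M\<^esub> Y) = (\<lambda>i\<in>?I. laurent_t \<odot>\<^bsub>cyclic_module laurent_ring (\<pi> i)\<^esub> h Y i)" if "Y \<in> carrier A" for Y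
  proof -
    have "\<forall>a\<in>carrier laurent_ring. \<forall>v\<in>carrier M. h (a \<odot>\<^bsub>M\<^esub> v) = a \<odot>\<^bsub>module_sum ?I (\<lambda>i. cyclic_module laurent_ring (\<pi> i))\<^esub> h v"
      using h unfolding module_iso_def by blast
    then have "h (laurent_t \<odot>\<^bsub>M\<^esub> Y) = laurent_t \<odot>\<^bsub>module_sum ?I (\<lambda>i. cyclic_module laurent_ring (\<pi> i))\<^esub> h Y"
      using that by (simp add: laurent_ring_def M_simps(1))
    then show ?thesis by (simp add: module_sum_def)
  qed
  have ht: "h (tau 1 Y) = (\<lambda>i\<in>?I. laurent_t \<odot>\<^bsub>cyclic_module laurent_ring (\<pi> i)\<^esub> h Y i)" if "Y \<in> carrier A" for Y
    using hsm[OF that] unfolding smult_t[OF that] .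
  have inj: "inj_on h (carrier A)" using bij by (rule bij_betw_imp_inj_on)
  define \<kappa> where "\<kappa> a = (\<lambda>i\<in>?I. lcoset (\<pi> i) (a i))" for a
  have \<kappa>S: "\<kappa> a \<in> ?S" for a unfolding \<kappa>_def by auto
  have \<kappa>add: "(\<lambda>i\<in>?I. \<kappa> a i \<oplus>\<^bsub>cyclic_module laurent_ring (\<pi> i)\<^esub> \<kappa> b i) = \<kappa> (\<lambda>i. a i + b i)" for a b
    unfolding \<kappa>_def by (rule restrict_ext) (simp add: cyclic_module_add)
  have \<kappa>t: "(\<lambda>i\<in>?I. laurent_t \<odot>\<^bsub>cyclic_module laurent_ring (\<pi> i)\<^esub> \<kappa> a i) = \<kappa> (\<lambda>i. laurent_t * a i)" for a
    unfolding \<kappa>_def by (rule restrict_ext) (simp add: cyclic_module_smult)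
  have \<kappa>sur: "\<exists>a. y = \<kappa> a" if y: "y \<in> ?S" for y
  proof -
    have "\<forall>i\<in>?I. \<exists>a. y i = lcoset (\<pi> i) a" using y by (auto simp: PiE_iff image_iff)
    then obtain a where a: "\<forall>i\<in>?I. y i = lcoset (\<pi> i) (a i)" by metis
    have "y i = \<kappa> a i" for i
      using a y by (cases "i \<in> ?I") (auto simp: \<kappa>_def PiE_iff extensional_def)
    then have "y = \<kappa> a" by (rule ext)
    then show ?thesis by blast
  qed
  define \<psi> where "\<psi> a = inv_into (carrier A) h (\<kappa> a)" for a
  have hS: "h ` carrier A = ?S" using bij by (rule bij_betw_imp_surj_on)
  have \<psi>c: "\<psi> a \<in> carrier A" for a unfolding \<psi>_def using \<kappa>S hS by (intro inv_into_into) simp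
  have h\<psi>: "h (\<psi> a) = \<kappa> a" for a unfolding \<psi>_def using \<kappa>S hS by (intro f_inv_into_f) simp
  have \<psi>I: "Y = \<psi> a" if "Y \<in> carrier A" "h Y = \<kappa> a" for Y a
    by (rule inj_onD[OF inj _ that(1) \<psi>c]) (simp only: that(2) h\<psi>)
  have \<psi>add: "\<psi> (\<lambda>i. a i + b i) = \<psi> a \<otimes>\<^bsub>A\<^esub> \<psi> b" for a b
    by (rule \<psi>I[symmetric]) (simp_all only: A.m_closed \<psi>c hm h\<psi> \<kappa>add)
  have \<psi>t: "\<psi> (\<lambda>i. laurent_t * a i) = tau 1 (\<psi> a)" for a
    by (rule \<psi>I[symmetric]) (simp_all only: tau_closed \<psi>c ht h\<psi> \<kappa>t)
  define \<theta> where "\<theta> v = \<psi> (\<lambda>i. laurent_of (v i))" for v :: "nat \<Rightarrow> int poly"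
  have \<theta>c: "\<theta> v \<in> carrier A" for v unfolding \<theta>_def by (rule \<psi>c)
  have \<theta>a: "\<theta> (u + v) = \<theta> u \<otimes>\<^bsub>A\<^esub> \<theta> v" for u v
    unfolding \<theta>_def plus_fun_apply laurent_of_add by (rule \<psi>add)
  have X: "laurent_of (monom 1 1) = laurent_t" by (simp add: laurent_of_monom laurent_t_def)
  have \<theta>t: "\<theta> (\<lambda>i. monom 1 1 * v i) = tau 1 (\<theta> v)" for v
    unfolding \<theta>_def laurent_of_mult X by (rule \<psi>t)
  have \<psi>tj: "tau (int j) (\<psi> a) = \<psi> (\<lambda>i. laurent_t ^ j * a i)" for j a
  proof (induction j)
    case 0 then show ?case by (simp add: tau_0[OF \<psi>c])
  next
    case (Suc j)
    have "tau (int (Suc j)) (\<psi> a) = tau 1 (tau (int j) (\<psi> a))" using tau_tau[OF \<psi>c, of 1 "int j" a] by simp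
    also have "\<dots> = \<psi> (\<lambda>i. laurent_t * (laurent_t ^ j * a i))" unfolding Suc by (rule \<psi>t[symmetric])
    finally show ?case by (simp add: mult.assoc)
  qed
  have \<psi>cong: "\<psi> a = \<psi> b" if "\<And>i. i \<in> ?I \<Longrightarrow> a i = b i" for a b
  proof -
    have "\<kappa> a = \<kappa> b" unfolding \<kappa>_def by (rule restrict_ext) (simp add: that)
    then show ?thesis unfolding \<psi>_def by simp
  qed
  have sur: "\<exists>j. \<exists>v\<in>supported ?I. tau (int j) Y = \<theta> v" if Y: "Y \<in> carrier A" for Y
  proof -
    have "h Y \<in> ?S" using imageI[OF Y, of h] unfolding hS .
    then obtain a where "h Y = \<kappa> a" using \<kappa>sur by blast
    then have Ya: "Y = \<psi> a" by (rule \<psi>I[OF Y])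
    have "\<forall>i. \<exists>j. \<exists>v. laurent_t ^ j * a i = laurent_of v" using laurent_shift by blast
    then obtain j v where jv: "\<forall>i. laurent_t ^ j i * a i = laurent_of (v i)" by metis
    \<comment> \<open>One power of \<open>t\<close> clears the denominators of all coordinates; the
      sum of the exponents bounds each of them.\<close>
    define m where "m = (\<Sum>i\<in>?I. j i)"
    have jm: "j i \<le> m" if "i \<in> ?I" for i unfolding m_def by (rule member_le_sum[OF that]) auto
    define w where "w i = (if i \<in> ?I then [:0, 1:] ^ (m - j i) * v i else 0)" for i
    have "laurent_t ^ m * a i = laurent_of (w i)" if i: "i \<in> ?I" for i
    proof -
      have "laurent_t ^ m * a i = laurent_t ^ (m - j i) * (laurent_t ^ j i * a i)"
        using jm[OF i] by (simp add: mult.assoc[symmetric] power_add[symmetric])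
      also have "\<dots> = laurent_of (w i)" using i jv by (simp only: w_def if_True laurent_of_mult laurent_of_X)
      finally show ?thesis .
    qed
    then have "tau (int m) Y = \<theta> w" unfolding Ya \<psi>tj \<theta>_def by (rule \<psi>cong)
    moreover have "w \<in> supported ?I" by (simp add: supported_def w_def)
    ultimately show ?thesis by blast
  qed
  have "\<forall>i. \<exists>q. \<forall>v. \<pi> i dvd laurent_of v \<longleftrightarrow> q dvd v" using laurent_associate by blast
  then obtain q where q: "\<forall>i v. \<pi> i dvd laurent_of v \<longleftrightarrow> q i dvd v" by metis
  have one: "\<psi> (\<lambda>_. 0) = \<one>\<^bsub>A\<^esub>"
  proof -
    have "\<psi> (\<lambda>_. 0) \<otimes>\<^bsub>A\<^esub> \<psi> (\<lambda>_. 0) = \<psi> (\<lambda>_. 0) \<otimes>\<^bsub>A\<^esub> \<one>\<^bsub>A\<^esub>"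
      using \<psi>add[of "\<lambda>_. 0" "\<lambda>_. 0"] by (simp add: \<psi>c)
    then show ?thesis by (simp only: A.l_cancel A.one_closed \<psi>c)
  qed
  have ker: "\<theta> v = \<one>\<^bsub>A\<^esub> \<longleftrightarrow> (\<forall>i\<in>?I. q i dvd v i)" for v
  proof -
    have "\<theta> v = \<one>\<^bsub>A\<^esub> \<longleftrightarrow> h (\<theta> v) = h (\<psi> (\<lambda>_. 0))"
      unfolding one[symmetric] by (rule inj_on_eq_iff[OF inj \<theta>c \<psi>c, symmetric])
    also have "\<dots> \<longleftrightarrow> \<kappa> (\<lambda>i. laurent_of (v i)) = \<kappa> (\<lambda>_. 0)" unfolding \<theta>_def h\<psi> ..
    also have "\<dots> \<longleftrightarrow> (\<forall>i\<in>?I. lcoset (\<pi> i) (laurent_of (v i)) = lcoset (\<pi> i) 0)"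
    proof
      assume e: "\<kappa> (\<lambda>i. laurent_of (v i)) = \<kappa> (\<lambda>_. 0)"
      show "\<forall>i\<in>?I. lcoset (\<pi> i) (laurent_of (v i)) = lcoset (\<pi> i) 0"
      proof
        fix i assume "i \<in> ?I"
        then show "lcoset (\<pi> i) (laurent_of (v i)) = lcoset (\<pi> i) 0" using fun_cong[OF e, of i] by (simp add: \<kappa>_def)
      qed
    next
      assume "\<forall>i\<in>?I. lcoset (\<pi> i) (laurent_of (v i)) = lcoset (\<pi> i) 0"
      then show "\<kappa> (\<lambda>i. laurent_of (v i)) = \<kappa> (\<lambda>_. 0)" unfolding \<kappa>_def by (intro restrict_ext) simp
    qed
    also have "\<dots> \<longleftrightarrow> (\<forall>i\<in>?I. q i dvd v i)" unfolding lcoset_eq_iff using q by simp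
    finally show ?thesis .
  qed
  have "lin_rec (\<lambda>r. of_nat (idx (vec.zsat (supported ?I) ({v \<in> supported ?I. \<forall>i\<in>?I. q i dvd v i} + (\<lambda>v i. t_pow_minus_1 r * v i) ` supported ?I))
      ({v \<in> supported ?I. \<forall>i\<in>?I. q i dvd v i} + (\<lambda>v i. t_pow_minus_1 r * v i) ` supported ?I)))"
    by (rule lin_rec_idx_sum_of_cyclics) simp
  then show ?thesis
  proof (rule lin_rec_cong[rotated])
    fix r :: nat assume r: "r \<ge> 1"
    have "torsion_number G \<chi> x r = idx (vec.zsat (supported ?I) ({v \<in> supported ?I. \<theta> v = \<one>\<^bsub>A\<^esub>} + (\<lambda>v i. t_pow_minus_1 r * v i) ` supported ?I))
        ({v \<in> supported ?I. \<theta> v = \<one>\<^bsub>A\<^esub>} + (\<lambda>v i. t_pow_minus_1 r * v i) ` supported ?I)"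
      by (rule torsion_number_eq_idx[of ?I \<theta> r, OF \<theta>c \<theta>a \<theta>t _ r]) (rule sur)
    then show "of_nat (idx (vec.zsat (supported ?I) ({v \<in> supported ?I. \<forall>i\<in>?I. q i dvd v i} + (\<lambda>v i. t_pow_minus_1 r * v i) ` supported ?I))
      ({v \<in> supported ?I. \<forall>i\<in>?I. q i dvd v i} + (\<lambda>v i. t_pow_minus_1 r * v i) ` supported ?I)) = complex_of_nat (torsion_number G \<chi> x r)"
      unfolding ker by (simp only:)
  qed
qed

text \<open>Horner's scheme with \<open>tau 1\<close> in the role of \<open>t\<close>.\<close>

definition act :: "int poly \<Rightarrow> 'a set \<Rightarrow> 'a set" where
  "act p Y = fold_coeffs (\<lambda>c Z. Y [^]\<^bsub>A\<^esub> c \<otimes>\<^bsub>A\<^esub> tau 1 Z) p \<one>\<^bsub>A\<^esub>"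

lemma tau_one: "tau i \<one>\<^bsub>A\<^esub> = \<one>\<^bsub>A\<^esub>"
  using tau_cl[OF K_one, of i] cj_one x by (simp add: cl_one cj_def)

lemma act_0: "act 0 Y = \<one>\<^bsub>A\<^esub>" by (simp add: act_def)

lemma act_pCons: assumes Y: "Y \<in> carrier A" shows "act (pCons a p) Y = Y [^]\<^bsub>A\<^esub> a \<otimes>\<^bsub>A\<^esub> tau 1 (act p Y)"
proof -
  interpret A: comm_group A by (rule comm_group_A)
  show ?thesis
  proof (cases "a = 0 \<and> p = 0")
    case True then show ?thesis using Y by (simp add: act_0 tau_one)
  next
    case False then show ?thesis by (cases "p = 0") (simp_all add: act_def)
  qed
qed

lemma act_closed: assumes Y: "Y \<in> carrier A" shows "act p Y \<in> carrier A"
proof -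
  interpret A: comm_group A by (rule comm_group_A)
  show ?thesis by (induction p rule: pCons_induct) (simp_all add: act_0 act_pCons[OF Y] Y tau_closed)
qed

lemma act_add: assumes Y: "Y \<in> carrier A" shows "act (p + q) Y = act p Y \<otimes>\<^bsub>A\<^esub> act q Y"
proof -
  interpret A: comm_group A by (rule comm_group_A)
  show ?thesis
  proof (induction p q rule: poly_induct2)
    case 0 then show ?case by (simp add: act_0)
  next
    case (pCons a p b q)
    have "tau 1 (act p Y \<otimes>\<^bsub>A\<^esub> act q Y) = tau 1 (act p Y) \<otimes>\<^bsub>A\<^esub> tau 1 (act q Y)"
      by (rule hom_mult[OF tau_hom act_closed[OF Y] act_closed[OF Y]])
    then show ?case using Y pCons
      by (simp add: act_pCons A.int_pow_mult tau_closed act_closed A.m_ac)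
  qed
qed

text \<open>The combination of the first \<open>k\<close> elements of the family \<open>m\<close>
  with the coordinates of \<open>v\<close> as coefficients.\<close>

primrec theta :: "(nat \<Rightarrow> 'a set) \<Rightarrow> nat \<Rightarrow> (nat \<Rightarrow> int poly) \<Rightarrow> 'a set" where
  "theta m 0 v = \<one>\<^bsub>A\<^esub>"
| "theta m (Suc k) v = theta m k v \<otimes>\<^bsub>A\<^esub> act (v k) (m k)"

lemma theta_closed: assumes "\<And>i. m i \<in> carrier A" shows "theta m k v \<in> carrier A"
proof -
  interpret A: comm_group A by (rule comm_group_A)
  show ?thesis by (induction k) (simp_all add: act_closed assms)
qed

lemma theta_add: assumes m: "\<And>i. m i \<in> carrier A" shows "theta m k (u + v) = theta m k u \<otimes>\<^bsub>A\<^esub> theta m k v"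
proof -
  interpret A: comm_group A by (rule comm_group_A)
  show ?thesis
    by (induction k) (simp_all add: act_add act_closed theta_closed m A.m_ac)
qed

lemma theta_t: assumes m: "\<And>i. m i \<in> carrier A" shows "theta m k (\<lambda>i. monom 1 1 * v i) = tau 1 (theta m k v)"
proof (induction k)
  case 0 then show ?case by (simp add: tau_one)
next
  case (Suc k)
  interpret A: comm_group A by (rule comm_group_A)
  have "monom 1 1 * v k = pCons 0 (v k)" by (simp add: monom_altdef)
  then have "act (monom 1 1 * v k) (m k) = tau 1 (act (v k) (m k))"
    using m[of k] by (simp add: act_pCons tau_closed act_closed)
  then show ?case
    using Suc hom_mult[OF tau_hom theta_closed[OF m] act_closed[OF m]] by simp
qed

lemma theta_unit: assumes m: "\<And>i. m i \<in> carrier A"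
  shows "theta m k (\<lambda>j. if j = i then 1 else 0) = (if i < k then m i else \<one>\<^bsub>A\<^esub>)"
proof -
  interpret A: comm_group A by (rule comm_group_A)
  have a1: "act 1 (m j) = m j" for j using m[of j] by (simp add: one_pCons act_pCons act_0 tau_one)
  show ?thesis by (induction k) (use m in \<open>auto simp: a1 act_0 less_Suc_eq\<close>)
qed

text \<open>Finitely many generators of \<open>G\<close> yield finitely many module generators of
  the abelianized kernel, and these define \<open>\<theta>\<close>. Torsion-freeness says that the
  kernel of \<open>\<theta>\<close> is pure, so that \<open>pure_quotient\<close> applies.\<close>

lemma lin_rec_torsion_number_torsion_free:
  assumes fg: "finite S" "S \<subseteq> carrier G" "generate G S = carrier G" and tf: "additively_torsion_free M"
  shows "lin_rec (\<lambda>r. of_nat (torsion_number G \<chi> x r))"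
proof -
  interpret A: comm_group A by (rule comm_group_A)
  \<comment> \<open>Dividing \<open>g\<close> by the power of \<open>x\<close> with the same value
    of \<open>\<chi>\<close> gives a crossed homomorphism into \<open>A\<close>: \<open>c\<close> of
    a product \<open>g h\<close> is \<open>c g\<close> times \<open>tau (\<chi> g) (c h)\<close>. So
    its values on generators of \<open>G\<close> generate the module; on the kernel of
    \<open>\<chi>\<close> it is just \<open>cl\<close>.\<close>
  define c where "c g = cl (g \<otimes> inv (x [^] \<chi> g))" for g
  have gK: "g \<otimes> inv (x [^] \<chi> g) \<in> carrier K" if "g \<in> carrier G" for g
    using that x \<chi>_inv[OF int_pow_closed[OF x]] by (simp add: mem_K \<chi>_mult \<chi>_pow)
  have cA: "c g \<in> carrier A" if "g \<in> carrier G" for g unfolding c_def by (rule cl_closed[OF gK[OF that]])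
  obtain ss where ss: "set ss = S" using finite_list[OF fg(1)] by blast
  define n where "n = length ss"
  define m where "m i = (if i < n then c (ss ! i) else \<one>\<^bsub>A\<^esub>)" for i
  have m: "m i \<in> carrier A" for i
    unfolding m_def using cA ss fg(2) nth_mem[of i ss] by (auto simp: n_def)
  let ?I = "{..<n}"
  define W where "W = supported ?I"
  define \<theta> where "\<theta> = theta m n"
  have \<theta>c: "\<theta> v \<in> carrier A" for v unfolding \<theta>_def by (rule theta_closed[OF m])
  have \<theta>a: "\<theta> (u + v) = \<theta> u \<otimes>\<^bsub>A\<^esub> \<theta> v" for u v unfolding \<theta>_def by (rule theta_add[OF m])
  have \<theta>t: "\<theta> (\<lambda>i. monom 1 1 * v i) = tau 1 (\<theta> v)" for v unfolding \<theta>_def by (rule theta_t[OF m])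
  have sW: "vec.subspace W" unfolding W_def by (rule vec_subspace_supported)
  have \<theta>tj: "tau (int j) (\<theta> v) = \<theta> (\<lambda>i. monom 1 j * v i)" for j v
  proof (induction j)
    case 0 then show ?case by (simp add: tau_0[OF \<theta>c])
  next
    case (Suc j)
    have "tau (int (Suc j)) (\<theta> v) = tau 1 (tau (int j) (\<theta> v))" using tau_tau[OF \<theta>c, of 1 "int j" v] by simp
    also have "\<dots> = \<theta> (\<lambda>i. monom 1 1 * (monom 1 j * v i))" unfolding Suc by (rule \<theta>t[symmetric])
    finally show ?case by (simp add: mult.assoc[symmetric] mult_monom)
  qed
  \<comment> \<open>\<open>\<theta>\<close> uses nonnegative powers of \<open>t\<close> only, so its
    image need not be everything; \<open>P Y\<close> says that some power of \<open>tau 1\<close>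
    moves \<open>Y\<close> into it. Such \<open>Y\<close> form a subgroup stable under all
    \<open>tau i\<close>, negative \<open>i\<close> included.\<close>
  define P where "P Y \<longleftrightarrow> Y \<in> carrier A \<and> (\<exists>j. \<exists>v\<in>W. tau (int j) Y = \<theta> v)" for Y
  have Pm: "P (Y \<otimes>\<^bsub>A\<^esub> Z)" if PYZ: "P Y" "P Z" for Y Z
  proof -
    obtain j k u v where *: "Y \<in> carrier A" "Z \<in> carrier A" "u \<in> W" "v \<in> W" "tau (int j) Y = \<theta> u" "tau (int k) Z = \<theta> v"
      using PYZ unfolding P_def by blast
    have "tau (int (j + k)) (Y \<otimes>\<^bsub>A\<^esub> Z) = tau (int (j + k)) Y \<otimes>\<^bsub>A\<^esub> tau (int (j + k)) Z"
      by (rule hom_mult[OF tau_hom *(1,2)])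
    also have "tau (int (j + k)) Y = tau (int k) (\<theta> u)" using tau_tau[OF *(1), of "int k" "int j"] *(5) by (simp add: add.commute)
    also have "tau (int (j + k)) Z = tau (int j) (\<theta> v)" using tau_tau[OF *(2), of "int j" "int k"] *(6) by simp
    finally have "tau (int (j + k)) (Y \<otimes>\<^bsub>A\<^esub> Z) = \<theta> ((\<lambda>i. monom 1 k * u i) + (\<lambda>i. monom 1 j * v i))"
      unfolding \<theta>tj \<theta>a .
    moreover have "(\<lambda>i. monom 1 k * u i) + (\<lambda>i. monom 1 j * v i) \<in> W"
      by (rule vec.subspace_add[OF sW vec.subspace_scale[OF sW *(3)] vec.subspace_scale[OF sW *(4)]])
    ultimately show ?thesis unfolding P_def using A.m_closed[OF *(1,2)] by blast
  qed
  have \<theta>0: "\<theta> 0 = \<one>\<^bsub>A\<^esub>"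
  proof -
    have "\<theta> 0 \<otimes>\<^bsub>A\<^esub> \<theta> 0 = \<theta> 0 \<otimes>\<^bsub>A\<^esub> \<one>\<^bsub>A\<^esub>" using \<theta>a[of 0 0] by (simp add: \<theta>c)
    then show ?thesis by (simp only: A.l_cancel A.one_closed \<theta>c)
  qed
  have \<theta>neg: "\<theta> (- v) = inv\<^bsub>A\<^esub> \<theta> v" for v
  proof -
    have "\<theta> (- v) \<otimes>\<^bsub>A\<^esub> \<theta> v = \<one>\<^bsub>A\<^esub>" using \<theta>a[of "- v" v] \<theta>0 by simp
    from A.inv_equality[OF this \<theta>c \<theta>c] show ?thesis by (rule sym)
  qed
  have P1: "P \<one>\<^bsub>A\<^esub>" unfolding P_def
    using tau_one \<theta>0 vec.subspace_0[OF sW] by (intro conjI exI[of _ 0] bexI[of _ 0]) auto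
  have Pi: "P (inv\<^bsub>A\<^esub> Y)" if PY: "P Y" for Y
  proof -
    obtain j u where *: "Y \<in> carrier A" "u \<in> W" "tau (int j) Y = \<theta> u" using PY unfolding P_def by blast
    have "group_hom A A (tau (int j))" by (intro group_hom.intro group_hom_axioms.intro A.is_group tau_hom)
    then have "tau (int j) (inv\<^bsub>A\<^esub> Y) = \<theta> (- u)" unfolding \<theta>neg *(3)[symmetric] by (rule group_hom.hom_inv[OF _ *(1)])
    then show ?thesis unfolding P_def using A.inv_closed[OF *(1)] vec.subspace_neg[OF sW *(2)] by blast
  qed
  have Pt: "P (tau i Y)" if PY: "P Y" for i Y
  proof -
    obtain j u where *: "Y \<in> carrier A" "u \<in> W" "tau (int j) Y = \<theta> u" using PY unfolding P_def by blast
    \<comment> \<open>Adding the absolute value of \<open>i\<close> makes the total shift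
      nonnegative even for negative \<open>i\<close>, so that it is multiplication by a
      monomial.\<close>
    define k where "k = nat (\<bar>i\<bar> + i)"
    have "tau (int (j + nat \<bar>i\<bar>)) (tau i Y) = tau (int k) (tau (int j) Y)"
      unfolding tau_tau[OF *(1)] k_def by (rule arg_cong[of _ _ "\<lambda>i. tau i Y"]) simp
    also have "\<dots> = \<theta> (\<lambda>i. monom 1 k * u i)" unfolding *(3) \<theta>tj ..
    finally show ?thesis unfolding P_def using tau_closed[OF *(1)] vec.subspace_scale[OF sW *(2)] by blast
  qed
  have Pm_i: "P (m i)" if i: "i < n" for i
  proof -
    have "tau (int 0) (m i) = \<theta> (\<lambda>j. if j = i then 1 else 0)"
      unfolding \<theta>_def theta_unit[OF m] using i m by (simp add: tau_0)
    moreover have "(\<lambda>j. if j = i then 1 else 0) \<in> W" unfolding W_def supported_def using i by simp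
    ultimately show ?thesis unfolding P_def using m by blast
  qed
  have Pc: "g \<in> carrier G \<and> P (c g)" if "g \<in> generate G S" for g
    using that
  proof (induction rule: generate.induct)
    case one
    have "c \<one> = \<one>\<^bsub>A\<^esub>" unfolding c_def \<chi>_one using cl_one by simp
    then show ?case using P1 by simp
  next
    case (incl h)
    then obtain i where i: "i < n" "h = ss ! i" using ss unfolding n_def by (metis in_set_conv_nth)
    then have "m i = c h" by (simp add: m_def)
    then show ?case using Pm_i[OF i(1)] incl fg(2) by auto
  next
    case (inv h)
    then obtain i where i: "i < n" "h = ss ! i" using ss unfolding n_def by (metis in_set_conv_nth)
    then have ch: "m i = c h" by (simp add: m_def)
    have hG: "h \<in> carrier G" using inv fg(2) by blast
    have z: "x [^] i \<in> carrier G" for i :: int by (rule int_pow_closed[OF x])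
    \<comment> \<open>The crossed homomorphism rule for inverses: \<open>c\<close> of the inverse of
      \<open>h\<close> is the inverse of \<open>c h\<close>, conjugated by the power of
      \<open>x\<close> with exponent \<open>- \<chi> h\<close>.\<close>
    have "inv h \<otimes> inv (x [^] \<chi> (inv h)) = inv h \<otimes> (x [^] \<chi> h)"
      unfolding \<chi>_inv[OF hG] int_pow_neg[OF x] using z by simp
    also have "\<dots> = cj (x [^] (- \<chi> h)) (inv (h \<otimes> inv (x [^] \<chi> h)))"
      unfolding cj_def int_pow_neg[OF x] using hG z by (simp add: inv_mult_group m_assoc[symmetric])
    finally have "c (inv h) = tau (- \<chi> h) (inv\<^bsub>A\<^esub> c h)"
      unfolding c_def cl_inv[OF gK[OF hG]] tau_cl[OF K_inv[OF gK[OF hG]]] by (rule arg_cong)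
    then show ?case using Pt[OF Pi[OF Pm_i[OF i(1)]]] hG unfolding ch by simp
  next
    case (eng h1 h2)
    then have G: "h1 \<in> carrier G" "h2 \<in> carrier G" by blast+
    have z: "x [^] i \<in> carrier G" for i :: int by (rule int_pow_closed[OF x])
    have e: "x [^] (\<chi> h1 + \<chi> h2) = x [^] \<chi> h1 \<otimes> x [^] \<chi> h2" by (rule int_pow_mult[OF x])
    let ?y = "x [^] \<chi> h1" and ?z = "x [^] \<chi> h2"
    have yz: "?y \<in> carrier G" "?z \<in> carrier G" by (rule z)+
    have "(h1 \<otimes> inv ?y) \<otimes> cj ?y (h2 \<otimes> inv ?z) = h1 \<otimes> (inv ?y \<otimes> ?y) \<otimes> h2 \<otimes> inv ?z \<otimes> inv ?y"
      unfolding cj_def using G yz by (simp only: m_assoc m_closed inv_closed)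
    also have "\<dots> = (h1 \<otimes> h2) \<otimes> inv (?y \<otimes> ?z)"
      using G yz by (simp add: inv_mult_group m_assoc)
    finally have "c h1 \<otimes>\<^bsub>A\<^esub> tau (\<chi> h1) (c h2) = c (h1 \<otimes> h2)"
      unfolding c_def tau_cl[OF gK[OF G(2)]] cl_mult[OF gK[OF G(1)] cj_K[OF z gK[OF G(2)]]] \<chi>_mult[OF G] e by (rule arg_cong)
    moreover have "P (c h1 \<otimes>\<^bsub>A\<^esub> tau (\<chi> h1) (c h2))" using eng by (intro Pm Pt) blast+
    ultimately show ?case using G by simp
  qed
  have sur: "\<exists>j. \<exists>v\<in>supported ?I. tau (int j) Y = \<theta> v" if Y: "Y \<in> carrier A" for Y
  proof -
    obtain k where k: "k \<in> carrier K" "Y = cl k" using Y unfolding carrier_A by blast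
    have kG: "k \<in> carrier G" "\<chi> k = 0" using k(1) unfolding mem_K by blast+
    have "c k = Y" unfolding c_def kG(2) k(2) using kG(1) by simp
    moreover have "P (c k)" using Pc kG(1) unfolding fg(3) by blast
    ultimately show ?thesis unfolding P_def W_def by blast
  qed
  define N where "N = {v \<in> W. \<theta> v = \<one>\<^bsub>A\<^esub>}"
  have sN: "vec.subspace N"
  proof (rule vec.subspaceI)
    show "0 \<in> N" unfolding N_def using vec.subspace_0[OF sW] \<theta>0 by simp
    show "u + v \<in> N" if "u \<in> N" "v \<in> N" for u v
      using that vec.subspace_add[OF sW, of u v] \<theta>a[of u v] unfolding N_def by simp
  next
    fix p v assume "v \<in> N"
    then have v: "v \<in> W" "\<theta> v = \<one>\<^bsub>A\<^esub>" unfolding N_def by simp_all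
    have const: "\<theta> (\<lambda>i. [:a:] * v i) = \<one>\<^bsub>A\<^esub>" for a
    proof (induction a rule: int_induct[where k = 0])
      case base
      have "(\<lambda>i. [:0:] * v i) = 0" by (simp add: fun_eq_iff)
      then show ?case using \<theta>0 by (simp only:)
    next
      case (step1 a)
      have "(\<lambda>i. [:a + 1:] * v i) = (\<lambda>i. [:a:] * v i) + v" by (simp add: fun_eq_iff smult_add_left)
      then show ?case using step1 v(2) \<theta>a by simp
    next
      case (step2 a)
      have eq: "(\<lambda>i. [:a - 1:] * v i) = (\<lambda>i. [:a:] * v i) + - v" by (simp add: fun_eq_iff smult_diff_left)
      show ?case unfolding eq \<theta>a \<theta>neg v(2) using step2 by simp
    qed
    have "\<theta> (\<lambda>i. p * v i) = \<one>\<^bsub>A\<^esub>"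
    proof (induction p rule: pCons_induct)
      case 0
      have "(\<lambda>i. 0 * v i) = 0" by (simp add: fun_eq_iff)
      then show ?case using \<theta>0 by (simp only:)
    next
      case (pCons a p)
      have eq: "(\<lambda>i. pCons a p * v i) = (\<lambda>i. [:a:] * v i) + (\<lambda>i. monom 1 1 * (p * v i))"
        by (simp add: fun_eq_iff monom_altdef)
      show ?case unfolding eq \<theta>a \<theta>t const pCons(2) tau_one by simp
    qed
    then show "(\<lambda>i. p * v i) \<in> N" unfolding N_def using vec.subspace_scale[OF sW v(1)] by simp
  qed
  have pow: "\<theta> (\<lambda>i. [:int k:] * v i) = \<theta> v [^]\<^bsub>add_monoid M\<^esub> k" for k v
  proof (induction k)
    case 0
    have "(\<lambda>i. [:int 0:] * v i) = 0" by (simp add: fun_eq_iff)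
    then show ?case using \<theta>0 by (simp add: M_simps nat_pow_def)
  next
    case (Suc k)
    interpret B: comm_group "add_monoid M" by (rule comm_group_add)
    have "(\<lambda>i. [:int (Suc k):] * v i) = (\<lambda>i. [:int k:] * v i) + v" by (simp add: fun_eq_iff smult_add_left add.commute)
    then have "\<theta> (\<lambda>i. [:int (Suc k):] * v i) = \<theta> v [^]\<^bsub>add_monoid M\<^esub> k \<otimes>\<^bsub>A\<^esub> \<theta> v" using \<theta>a Suc by simp
    moreover have "\<theta> v [^]\<^bsub>add_monoid M\<^esub> Suc k = \<theta> v [^]\<^bsub>add_monoid M\<^esub> k \<otimes>\<^bsub>add_monoid M\<^esub> \<theta> v" by (rule B.nat_pow_Suc)
    ultimately show ?case by (simp add: M_simps)
  qed
  \<comment> \<open>If a nonzero integer multiple of \<open>v\<close> lies in the kernel of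
    \<open>\<theta>\<close>, then \<open>\<theta> v\<close> is a torsion element, hence trivial. The
    sign of the integer is removed first because torsion is defined with positive exponents.\<close>
  have pure: "v \<in> N" if k: "k \<noteq> 0" and v: "v \<in> W" and kv: "(\<lambda>i. [:k:] * v i) \<in> N" for k v
  proof -
    have sk: "sgn k * k = int (nat \<bar>k\<bar>)" by (cases k "0::int" rule: linorder_cases) (simp_all add: sgn_if)
    have sg: "[:sgn k:] * ([:k:] * w) = [:int (nat \<bar>k\<bar>):] * w" for w
      unfolding mult.assoc[symmetric] sk[symmetric] by (simp add: ac_simps)
    have "(\<lambda>i. [:int (nat \<bar>k\<bar>):] * v i) \<in> N"
      using vec.subspace_scale[OF sN kv, of "[:sgn k:]"] unfolding sg .
    then have "\<theta> (\<lambda>i. [:int (nat \<bar>k\<bar>):] * v i) = \<one>\<^bsub>A\<^esub>" unfolding N_def mem_Collect_eq by (rule conjunct2)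
    then have "\<theta> v [^]\<^bsub>add_monoid M\<^esub> nat \<bar>k\<bar> = \<one>\<^bsub>add_monoid M\<^esub>" unfolding pow by (simp add: M_simps)
    moreover have "nat \<bar>k\<bar> > 0" using k by simp
    moreover have "\<theta> v \<in> carrier (add_monoid M)" using \<theta>c by (simp add: M_simps)
    ultimately have "\<theta> v \<in> torsion_subgroup (add_monoid M)" unfolding torsion_subgroup_def by blast
    then have "\<theta> v = \<one>\<^bsub>A\<^esub>" using tf unfolding additively_torsion_free_def by (simp add: M_simps)
    then show ?thesis unfolding N_def using v by blast
  qed
  have NW: "N \<subseteq> W" unfolding N_def by blast
  have Wspan: "W = vec.span ((\<lambda>i j. if j = i then 1 else 0) ` ?I)" unfolding W_def by (rule supported_eq_span) simp
  interpret pq: pure_quotient "\<lambda>a (v :: nat \<Rightarrow> int poly) i. a * v i" N W "(\<lambda>i j. if j = i then 1 else 0) ` ?I"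
    "{v \<in> W. \<exists>g. g \<noteq> 0 \<and> (\<lambda>i. g * v i) \<in> N}"
    by (intro pure_quotient.intro zt_module_vec pure_quotient_axioms.intro sN Wspan NW)
      ((rule pure, assumption+) | rule reflexive | simp)+
  have "lin_rec (\<lambda>r. of_nat (idx (vec.zsat W (N + (\<lambda>v i. t_pow_minus_1 r * v i) ` W)) (N + (\<lambda>v i. t_pow_minus_1 r * v i) ` W)))"
    by (rule pq.lin_rec_idx)
  then show ?thesis
  proof (rule lin_rec_cong[rotated])
    fix r :: nat assume r: "r \<ge> 1"
    have "torsion_number G \<chi> x r = idx (vec.zsat (supported ?I) ({v \<in> supported ?I. \<theta> v = \<one>\<^bsub>A\<^esub>} + (\<lambda>v i. t_pow_minus_1 r * v i) ` supported ?I))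
        ({v \<in> supported ?I. \<theta> v = \<one>\<^bsub>A\<^esub>} + (\<lambda>v i. t_pow_minus_1 r * v i) ` supported ?I)"
      by (rule torsion_number_eq_idx[of ?I \<theta> r, OF \<theta>c \<theta>a \<theta>t _ r]) (rule sur)
    then show "of_nat (idx (vec.zsat W (N + (\<lambda>v i. t_pow_minus_1 r * v i) ` W)) (N + (\<lambda>v i. t_pow_minus_1 r * v i) ` W))
      = complex_of_nat (torsion_number G \<chi> x r)"
      unfolding N_def W_def by (simp only:)
  qed
qed

end

theorem theorem3p9:
  fixes G :: "('a, 'b) monoid_scheme" and \<chi> :: "'a \<Rightarrow> int" and x :: 'a
  assumes "augmented_group G \<chi>"
    and "x \<in> carrier G" and "\<chi> x = 1"
    and "direct_sum_of_cyclics (kernel_abelianization G \<chi> x)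
         \<or> additively_torsion_free (kernel_abelianization G \<chi> x)"
  shows "\<exists>m\<ge>1. \<exists>c :: nat \<Rightarrow> complex. \<forall>r\<ge>1.
           of_nat (torsion_number G \<chi> x (r + m))
             = (\<Sum>i = 1..m. c i * of_nat (torsion_number G \<chi> x (r + m - i)))"
proof -
  have G: "group G" and hom: "\<chi> \<in> hom G integer_group"
    using assms(1) unfolding augmented_group_def finitely_generated_group_def epi_def by blast+
  obtain S where S: "finite S" "S \<subseteq> carrier G" "generate G S = carrier G"
    using assms(1) unfolding augmented_group_def finitely_generated_group_def by blast
  interpret augmented G \<chi> x
    by (intro augmented.intro augmented_axioms.intro G hom assms(2,3))
  have "lin_rec (\<lambda>r. of_nat (torsion_number G \<chi> x r))"
    using assms(4) lin_rec_torsion_number_cyclic lin_rec_torsion_number_torsion_free[OF S] by blast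
  then show ?thesis by (rule lin_rec_recurrence)
qed

end
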